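(* Let $\eta\in(1,2)$. For every $\varepsilon>0$ and for Lebesgue-almost every $\underline{x}=(x_1,x_2)\in\mathbb{R}^2$ there is a constant $C>0$ (depending only on $\underline{x}$, $\varepsilon$ and the fixed $\eta$) such that for all real $T\ge 3$ and all real $b>0$ the following hold. (i) If $(\ln T)^{-\eta}\le b\le(\ln T)^{-\eta/(3-\eta)}$, then $$\Big|\,|L(\underline{x};b)\cap[1,T)|-2\,b\,(\ln T)^2\Big|\le C\, b^{1-1/\eta}\,(\ln\ln T)^{6+\varepsilon}\,\ln T .$$ (ii) If $b\ge(\ln T)^{-\eta/(3-\eta)}$, then $$\Big|\,|L(\underline{x};b)\cap[1,T)|-2\,b\,(\ln T)^2\Big|\le C\, b^{2/\eta}\,(\ln\ln T)^{6+\varepsilon}\,(\ln T)^2 .$$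
   Context: $\mathbb{N}=\{1,2,\dots\}$. For $z\in\mathbb{R}$, $\|z\|$ denotes the distance from $z$ to the closest integer. For $\underline{x}=(x_1,x_2)\in\mathbb{R}^2$ and $b>0$, $$L(\underline{x};b):=\{q\in\mathbb{N}: q\cdot\|qx_1\|\cdot\|qx_2\|\le b\}.$$ $|\cdot|$ applied to a finite set denotes its cardinality. *)

theory Defs
  imports "HOL-Analysis.Analysis"
begin

definition dist_int :: "real \<Rightarrow> real"
  where "dist_int z = \<bar>z - of_int (round z)\<bar>"

lemma dist_int_eq_infdist: "dist_int z = infdist z \<int>"
proof (rule antisym)
  have "dist_int z \<le> dist z a" if "a \<in> \<int>" for a
    using that round_diff_minimal[of z] by (auto simp: dist_int_def dist_real_def elim: Ints_cases)
  moreover have "(\<int> :: real set) \<noteq> {}"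
    using Ints_0 by blast
  ultimately show "dist_int z \<le> infdist z \<int>"
    by (auto simp: infdist_def intro!: cINF_greatest)
  show "infdist z \<int> \<le> dist_int z"
    using infdist_le[of "of_int (round z)" \<int> z] by (simp add: dist_int_def dist_real_def)
qed

definition L :: "real \<times> real \<Rightarrow> real \<Rightarrow> nat set"
  where "L x b = {q. 1 \<le> q \<and>
           real q * dist_int (real q * fst x) * dist_int (real q * snd x) \<le> b}"

end

theory Submission
  imports Defs "HOL-Probability.Probability_Measure"
begin

text \<open>The pair of distances of \<open>q x\<close> and \<open>q' x\<close> to the integers, for \<open>x\<close> uniform in a unit interval,
  has a joint law that on corner rectangles exceeds the product of the marginals by at most a
  singular measure of mass \<open>gcd q q' / q\<close> carried by a line. A section of the region
  \<open>\<parallel>q x\<^sub>1\<parallel> \<parallel>q x\<^sub>2\<parallel> \<le> b / q\<close> with one coordinate fixed is a corner set in the other, so applying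
  this once per coordinate bounds the covariance of the events for \<open>q\<close> and \<open>q'\<close>. Summing over pairs, the variance of
  the number of solutions in a block of \<open>q\<close> is dominated by an additive function of the block whose
  total up to \<open>exp K\<close> is of the order of the mean \<open>b K\<^sup>2\<close>.

  A dyadic maximal inequality over \<open>T = exp k\<close> with \<open>k \<le> K = 2 ^ m\<close> costs only a power of \<open>m\<close>. It is summed
  over \<open>m\<close> and over the levels \<open>b = ((j + 1) / K) powr \<eta>\<close>; this grid is the reason for the shape of
  the error term, as neighbouring levels differ by \<open>O (b powr (1 - 1 / \<eta>) / K)\<close> and the sum over \<open>j\<close> of
  mean over squared error is bounded uniformly in \<open>K\<close>. Monotonicity in \<open>T\<close> and \<open>b\<close> fills the gaps.\<close>

section \<open>Distances of two multiples to the integers\<close>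

text \<open>The events for different \<open>q\<close> are dependent, but a variance needs only upper
  bounds on covariances. The dependence comes from common factors, so the excess is a gcd sum, and
  the divisor functions it produces are harmless on average over \<open>q\<close>. The constant has
  to serve all \<open>T\<close> and \<open>b\<close> at once, with \<open>b\<close> free to vary
  with \<open>T\<close>, so second moments are summed over all levels, infinitely many for each
  \<open>K\<close>. The term \<open>b powr (1 - 1 / \<eta>) * K\<close> is what the grid spacing
  costs in the main term \<open>2 * b * K\<^sup>2\<close>. With it alone the sum over levels
  diverges; \<open>b powr (2 / \<eta>) * K\<^sup>2\<close> is added to make it converge. The two are
  equal at \<open>b = K powr (- \<eta> / (3 - \<eta>))\<close>, so both parts of the theorem are one
  estimate with the larger term kept. The power of \<open>m\<close> that arises is
  \<open>(m + 1)\<^sup>2\<close>, with \<open>m\<close> at most of order \<open>ln (ln T)\<close>,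
  well inside the exponent \<open>6 + \<epsilon>\<close>.\<close>

lemma dist_int_nonneg [simp]: "0 \<le> dist_int z"
  by (simp add: dist_int_def)

lemma dist_int_le_half: "dist_int z \<le> 1 / 2"
  using of_int_round_abs_le[of z] by (simp add: dist_int_def abs_minus_commute)

lemma dist_int_add_int [simp]: "dist_int (z + of_int n) = dist_int z"
proof -
  have "round (z + of_int n) = round z + n"
    by (simp add: round_def)
       (metis floor_add_int add.assoc add.commute)
  thus ?thesis by (simp add: dist_int_def)
qed

lemma dist_int_measurable [measurable]: "dist_int \<in> borel_measurable borel"
proof -
  have "dist_int = (\<lambda>z. infdist z \<int>)"
    by (auto simp: dist_int_eq_infdist)
  show ?thesis
    unfolding \<open>dist_int = _\<close> by (intro borel_measurable_continuous_onI continuous_intros)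
qed

lemma dist_int_unit: "0 \<le> y \<Longrightarrow> y < 1 \<Longrightarrow> dist_int y = min y (1 - y)"
proof -
  assume y: "0 \<le> y" "y < 1"
  show ?thesis
  proof (cases "y < 1/2")
    case True
    then have "round y = 0" using y by (intro round_unique) auto
    thus ?thesis using y True by (simp add: dist_int_def)
  next
    case False
    then have "round y = 1" using y by (auto simp: round_def floor_eq_iff)
    thus ?thesis using y False by (simp add: dist_int_def)
  qed
qed

section \<open>Uniform laws and the slicing of a unit interval\<close>

definition unif_unit :: "int \<Rightarrow> real measure" where
  "unif_unit a = density lborel (indicator {of_int a..<of_int a + 1})"

text \<open>The law of \<open>dist_int (real q * x)\<close> when \<open>x\<close> is drawn from
  \<open>unif_unit a\<close> and \<open>q > 0\<close>.\<close>

definition unif_half :: "real measure" where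
  "unif_half = density lborel (\<lambda>u. 2 * indicator {0..1/2} u)"

lemma sets_unif_unit [simp, measurable_cong]: "sets (unif_unit a) = sets borel"
  and space_unif_unit [simp]: "space (unif_unit a) = UNIV"
  and sets_unif_half [simp, measurable_cong]: "sets unif_half = sets borel"
  and space_unif_half [simp]: "space unif_half = UNIV"
  by (simp_all add: unif_unit_def unif_half_def)

lemma emeasure_unif_unit: "A \<in> sets borel \<Longrightarrow> emeasure (unif_unit a) A = emeasure lborel ({of_int a..<of_int a + 1} \<inter> A)"
  by (simp add: unif_unit_def emeasure_density ac_simps flip: indicator_inter_arith)

lemma emeasure_unif_half: "A \<in> sets borel \<Longrightarrow> emeasure unif_half A = 2 * emeasure lborel ({0..1/2} \<inter> A)"
  by (simp add: unif_half_def emeasure_density nn_integral_cmult mult.assoc flip: indicator_inter_arith)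

lemma prob_space_unif_unit: "prob_space (unif_unit a)"
  by (rule prob_spaceI) (simp add: emeasure_unif_unit)

lemma prob_space_unif_half: "prob_space unif_half"
proof (rule prob_spaceI)
  have "emeasure unif_half UNIV = ennreal 2 * ennreal (1 / 2)"
    by (simp add: emeasure_unif_half)
  also have "\<dots> = 1" by (subst ennreal_mult[symmetric]) auto
  finally show "emeasure unif_half (space unif_half) = 1" by simp
qed

text \<open>Writing \<open>x = a + (y + j) / q\<close> makes \<open>q * x\<close> equal to
  \<open>y\<close> plus an integer. The distance for \<open>q\<close> thus depends on
  \<open>y\<close> alone, while for another multiplier \<open>j\<close> runs uniformly through an
  arithmetic progression.\<close>

lemma nn_integral_unif_unit_split:
  fixes h :: "real \<Rightarrow> ennreal" and q :: nat
  assumes [measurable]: "h \<in> borel_measurable borel" and q: "q > 0"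
  shows "(\<integral>\<^sup>+x. h x \<partial>unif_unit a) =
    ennreal (1 / q) * (\<Sum>j<q. \<integral>\<^sup>+y. h (of_int a + (y + real j) / real q) \<partial>unif_unit 0)"
proof -
  let ?I = "\<lambda>x. indicator {real_of_int a..<real_of_int a + 1} x :: ennreal"
  \<comment> \<open>The substitution \<open>z = q * (x - a)\<close> carries the interval onto
    \<open>{0..<q}\<close>, where exactly one unit piece contains \<open>z\<close>.\<close>
  have ind: "?I (a + (1/q) * z) = (\<Sum>j<q. indicator {real j..<real j + 1} z)" for z :: real
  proof (cases "0 \<le> z \<and> z < q")
    case True
    have "(\<Sum>j<q. indicator {real j..<real j + 1} z :: ennreal) = (\<Sum>j<q. if j = nat \<lfloor>z\<rfloor> then 1 else 0)"
      using True by (intro sum.cong refl) (auto simp: indicator_def, linarith+)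
    also have "\<dots> = 1"
      using True by (subst sum.delta) (auto simp: nat_less_iff floor_less_iff)
    finally show ?thesis using True q by (simp add: indicator_def field_simps)
  next
    case False
    have "(\<Sum>j<q. indicator {real j..<real j + 1} z :: ennreal) = 0"
      using False by (intro sum.neutral) (auto simp: indicator_def)
    with False q show ?thesis by (auto simp: indicator_def field_simps)
  qed
  have "(\<integral>\<^sup>+x. h x \<partial>unif_unit a) = (\<integral>\<^sup>+x. ?I x * h x \<partial>lborel)"
    by (simp add: unif_unit_def nn_integral_density)
  also have "\<dots> = ennreal \<bar>1/q\<bar> * (\<integral>\<^sup>+z. ?I (a + (1/q) * z) * h (a + (1/q) * z) \<partial>lborel)"
    using q by (intro nn_integral_real_affine) auto
  also have "(\<integral>\<^sup>+z. ?I (a + (1/q) * z) * h (a + (1/q) * z) \<partial>lborel) =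
     (\<integral>\<^sup>+z. (\<Sum>j<q. indicator {real j..<real j + 1} z * h (a + (1/q) * z)) \<partial>lborel)"
    unfolding ind by (simp add: sum_distrib_right)
  also have "\<dots> = (\<Sum>j<q. \<integral>\<^sup>+z. indicator {real j..<real j + 1} z * h (a + (1/q) * z) \<partial>lborel)"
    by (intro nn_integral_sum) measurable
  also have "\<dots> = (\<Sum>j<q. \<integral>\<^sup>+y. h (of_int a + (y + real j) / real q) \<partial>unif_unit 0)"
  proof (intro sum.cong refl)
    fix j
    have "(\<integral>\<^sup>+z. indicator {real j..<real j + 1} z * h (a + (1/q) * z) \<partial>lborel) =
      ennreal \<bar>1\<bar> * (\<integral>\<^sup>+y. indicator {real j..<real j + 1} (real j + 1 * y) * h (a + (1/q) * (real j + 1 * y)) \<partial>lborel)"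
      by (intro nn_integral_real_affine) auto
    also have "\<dots> = (\<integral>\<^sup>+y. indicator {0..<1} y * h (of_int a + (y + real j) / real q) \<partial>lborel)"
      by (simp, intro nn_integral_cong) (auto simp: indicator_def add.commute)
    also have "\<dots> = (\<integral>\<^sup>+y. h (of_int a + (y + real j) / real q) \<partial>unif_unit 0)"
      by (simp add: unif_unit_def nn_integral_density)
    finally show "(\<integral>\<^sup>+z. indicator {real j..<real j + 1} z * h (a + (1/q) * z) \<partial>lborel) =
      (\<integral>\<^sup>+y. h (of_int a + (y + real j) / real q) \<partial>unif_unit 0)" .
  qed
  finally show ?thesis by simp
qed

lemma emeasure_unif_unit_dist_int:
  assumes "0 \<le> \<alpha>" "\<alpha> \<le> 1 / 2"
  shows "emeasure (unif_unit 0) {y. dist_int y \<le> \<alpha>} = ennreal (2 * \<alpha>)"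
proof -
  have "emeasure (unif_unit 0) {y. dist_int y \<le> \<alpha>} = emeasure lborel ({0..<1} \<inter> {y. dist_int y \<le> \<alpha>})"
    by (simp add: emeasure_unif_unit)
  also have "{0..<1} \<inter> {y. dist_int y \<le> \<alpha>} = ({0..\<alpha>} \<union> {1-\<alpha>..<1})"
    using assms by (auto simp: dist_int_unit min_le_iff_disj)
  also have "emeasure lborel \<dots> = ennreal (2 * \<alpha>)"
  proof (cases "\<alpha> = 1/2")
    case True
    then have eq: "{0..\<alpha>} \<union> {1-\<alpha>..<1} = {0..<1::real}" by auto
    show ?thesis unfolding eq using True by simp
  next
    case False
    with assms have "emeasure lborel ({0..\<alpha>} \<union> {1-\<alpha>..<1}) = emeasure lborel {0..\<alpha>} + emeasure lborel {1-\<alpha>..<1}"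
      by (intro plus_emeasure[symmetric]) auto
    also have "\<dots> = ennreal (2 * \<alpha>)"
      using assms by (simp flip: ennreal_plus)
    finally show ?thesis .
  qed
  finally show ?thesis .
qed

section \<open>Joint law of two distances\<close>

lemma card_int_interval_le:
  fixes l :: real assumes "0 \<le> l" "\<And>n. n \<in> S \<Longrightarrow> x \<le> real_of_int n \<and> real_of_int n \<le> x + l"
  shows "finite S \<and> real (card S) \<le> l + 1"
proof -
  have sub: "S \<subseteq> {\<lceil>x\<rceil>..\<lfloor>x + l\<rfloor>}"
    using assms(2) by (auto simp: ceiling_le_iff le_floor_iff)
  then have "card S \<le> nat (\<lfloor>x + l\<rfloor> - \<lceil>x\<rceil> + 1)"
    using card_mono[OF _ sub] by simp
  then have "real (card S) \<le> real (nat (\<lfloor>x + l\<rfloor> - \<lceil>x\<rceil> + 1))" by linarith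
  also have "\<dots> \<le> l + 1" using assms(1) by linarith
  finally show ?thesis using sub finite_subset by blast
qed

text \<open>In lowest terms \<open>q' / q = t / s\<close>. Closeness to an integer confines an
  integer built from \<open>j\<close> to an interval of length \<open>2 * s * \<alpha>\<close>, and
  each value is taken at most \<open>g\<close> times, so the count is at most
  \<open>(2 * s * \<alpha> + 1) * g\<close>. The arbitrary shift \<open>y\<close> lets the bound be
  used for every fixed position inside a slice.\<close>

lemma card_dist_int_le:
  fixes q q' :: nat
  assumes q: "q > 0" and "0 \<le> \<alpha>"
  defines "g \<equiv> gcd q q'"
  shows "real (card {j\<in>{..<q}. dist_int (y + real q' * real j / real q) \<le> \<alpha>}) \<le> 2 * \<alpha> * q + g"
proof -
  define s where "s = q div g"
  define t where "t = q' div g"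
  have g: "g > 0" using q by (simp add: g_def)
  have qs: "q = g * s" and qt: "q' = g * t" by (simp_all add: g_def s_def t_def)
  have s: "s > 0" using q qs by simp
  have cop: "coprime (int t) (int s)"
    using g q unfolding s_def t_def g_def by (simp add: div_gcd_coprime coprime_commute)
  define J where "J = {j\<in>{..<q}. dist_int (y + real q' * real j / real q) \<le> \<alpha>}"
  \<comment> \<open>Multiplying the signed offset from the nearest integer by \<open>s\<close> gives
    \<open>s * y + n j\<close>.\<close>
  define n where "n = (\<lambda>j. int t * int j - int s * round (y + real q' * real j / real q))"
  have frac: "real q' * real j / real q = real t * real j / real s" for j
    using g by (simp add: qs qt)
  have sF: "real s * (real q' * real j / real q) = real t * real j" for j
    unfolding frac using s by simp
  have bd: "- (real s * y) - real s * \<alpha> \<le> real_of_int (n j) \<and>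
      real_of_int (n j) \<le> (- (real s * y) - real s * \<alpha>) + 2 * (real s * \<alpha>)" if "j \<in> J" for j
  proof -
    have "abs (y + real q' * real j / real q - round (y + real q' * real j / real q)) \<le> \<alpha>"
      using that by (simp add: J_def dist_int_def)
    then have "abs (s * (y + real q' * real j / real q - round (y + real q' * real j / real q))) \<le> s * \<alpha>"
      using s by (simp add: abs_mult)
    moreover have eq: "s * (y + real q' * real j / real q - round (y + real q' * real j / real q)) = s * y + n j"
      unfolding right_diff_distrib distrib_left sF n_def by simp
    ultimately have "abs (real s * y + real_of_int (n j)) \<le> real s * \<alpha>" by (simp only: eq)
    thus ?thesis by linarith
  qed
  have fin: "finite J" by (simp add: J_def)
  have img: "real (card (n ` J)) \<le> 2 * (real s * \<alpha>) + 1"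
  proof (rule conjunct2[OF card_int_interval_le[where x = "- (real s * y) - real s * \<alpha>"]])
    show "0 \<le> 2 * (real s * \<alpha>)" using assms(2) by simp
    fix z assume "z \<in> n ` J"
    then obtain j where "j \<in> J" "z = n j" by blast
    with bd[of j] show "- (real s * y) - real s * \<alpha> \<le> real_of_int z \<and>
      real_of_int z \<le> (- (real s * y) - real s * \<alpha>) + 2 * (real s * \<alpha>)" by simp
  qed
  have fib: "card {j\<in>J. n j = z} \<le> g" for z
  proof -
    \<comment> \<open>Equal values of \<open>n\<close> make \<open>t * i\<close> and
      \<open>t * j\<close> agree modulo \<open>s\<close>, hence also \<open>i\<close> and
      \<open>j\<close> by coprimality. Below \<open>q = g * s\<close> a residue class has
      \<open>g\<close> members, told apart by the quotient.\<close>
    have "inj_on (\<lambda>j. j div s) {j\<in>J. n j = z}"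
    proof (rule inj_onI, clarsimp)
      fix i j assume ij: "i \<in> J" "j \<in> J" "n j = n i" "i div s = j div s" "z = n i"
      have "int s dvd int t * (int i - int j)"
      proof
        show "int t * (int i - int j) = int s * (round (y + real q' * real i / real q) - round (y + real q' * real j / real q))"
          using ij(3) by (simp add: n_def algebra_simps)
      qed
      then have "int s dvd int i - int j"
        using cop by (meson coprime_commute coprime_dvd_mult_right_iff)
      then have "int i mod int s = int j mod int s" by (simp add: mod_eq_dvd_iff)
      then have "i mod s = j mod s" by (metis of_nat_eq_iff zmod_int)
      with ij(4) show "i = j" by (metis mult_div_mod_eq)
    qed
    moreover have "(\<lambda>j. j div s) ` {j\<in>J. n j = z} \<subseteq> {..<g}"
      using s by (auto simp: J_def qs less_mult_imp_div_less)
    ultimately have "card {j\<in>J. n j = z} \<le> card {..<g}"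
      by (rule card_inj_on_le) simp
    thus ?thesis by simp
  qed
  have "J = (\<Union>z\<in>n ` J. {j\<in>J. n j = z})" by auto
  then have "card J = card (\<Union>z\<in>n ` J. {j\<in>J. n j = z})" by (rule arg_cong)
  also have "\<dots> \<le> (\<Sum>z\<in>n ` J. card {j\<in>J. n j = z})"
    by (intro card_UN_le finite_imageI fin)
  also have "\<dots> \<le> (\<Sum>z\<in>n ` J. g)" by (intro sum_mono fib)
  finally have "card J \<le> card (n ` J) * g" by simp
  then have "real (card J) \<le> real (card (n ` J)) * g"
    unfolding of_nat_mult[symmetric] by (rule of_nat_mono)
  also have "\<dots> \<le> (2 * (real s * \<alpha>) + 1) * g" using img by (intro mult_right_mono) auto
  also have "\<dots> = 2 * \<alpha> * q + g" by (simp add: qs algebra_simps)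
  finally show ?thesis by (simp add: J_def)
qed

lemma ennreal_mult3:
  "0 \<le> x \<Longrightarrow> 0 \<le> y \<Longrightarrow> 0 \<le> z \<Longrightarrow> ennreal x * (ennreal y * ennreal z) = ennreal (x * (y * z))"
  by (simp add: ennreal_mult)

text \<open>For a fixed position \<open>y\<close> in the slice the condition for \<open>q\<close> is
  decided, and at most \<open>2 * \<alpha>' * q + gcd q q'\<close> of the \<open>q\<close> slices
  meet the condition for \<open>q'\<close>. The admissible \<open>y\<close> have measure
  \<open>2 * \<alpha>\<close>; dividing by \<open>q\<close> gives the product of the marginals and
  the gcd excess.\<close>

lemma emeasure_unif_unit_two_dist_int_aux:
  fixes q q' :: nat and \<alpha> \<alpha>' :: real
  assumes q: "q > 0" and "0 \<le> \<alpha>" "\<alpha> \<le> 1/2" "0 \<le> \<alpha>'"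
  shows "emeasure (unif_unit a) {x. dist_int (real q * x) \<le> \<alpha> \<and> dist_int (real q' * x) \<le> \<alpha>'}
    \<le> ennreal (4 * \<alpha> * \<alpha>' + 2 * (\<alpha> * gcd q q' / q))"
proof -
  let ?A = "{x. dist_int (real q * x) \<le> \<alpha> \<and> dist_int (real q' * x) \<le> \<alpha>'}"
  have "emeasure (unif_unit a) ?A = (\<integral>\<^sup>+x. indicator ?A x \<partial>unif_unit a)"
    by (simp add: nn_integral_indicator)
  also have "\<dots> = ennreal (1 / q) * (\<Sum>j<q. \<integral>\<^sup>+y. indicator ?A (of_int a + (y + real j) / real q) \<partial>unif_unit 0)"
    by (rule nn_integral_unif_unit_split) (use q in auto)
  finally have A: "emeasure (unif_unit a) ?A = \<dots>" .
  have "(\<Sum>j<q. \<integral>\<^sup>+y. indicator ?A (of_int a + (y + real j) / real q) \<partial>unif_unit 0) =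
     (\<integral>\<^sup>+y. (\<Sum>j<q. indicator ?A (of_int a + (y + real j) / real q)) \<partial>unif_unit 0)"
    by (rule nn_integral_sum[symmetric]) measurable
  also have "\<dots> \<le> (\<integral>\<^sup>+y. ennreal (2 * \<alpha>' * q + gcd q q') * indicator {y. dist_int y \<le> \<alpha>} y \<partial>unif_unit 0)"
  proof (intro nn_integral_mono)
    fix y :: real
    have e1: "dist_int (real q * (of_int a + (y + real j) / real q)) = dist_int y" for j
    proof -
      have "real q * (of_int a + (y + real j) / real q) = y + of_int (int q * a + int j)"
        using q by (simp add: field_simps)
      thus ?thesis by (metis dist_int_add_int)
    qed
    have e2: "dist_int (real q' * (of_int a + (y + real j) / real q)) = dist_int (real q' * y / q + real q' * real j / real q)" for j
    proof -
      have "real q' * (of_int a + (y + real j) / real q) = (real q' * y / q + real q' * real j / real q) + of_int (int q' * a)"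
        using q by (simp add: field_simps)
      thus ?thesis by (metis dist_int_add_int)
    qed
    have "(\<Sum>j<q. indicator ?A (of_int a + (y + real j) / real q)) =
       indicator {y. dist_int y \<le> \<alpha>} y * (\<Sum>j<q. indicator {j. dist_int (real q' * y / q + real q' * real j / real q) \<le> \<alpha>'} j :: ennreal)"
      unfolding sum_distrib_left by (intro sum.cong refl) (auto simp: indicator_def e1 e2)
    also have "(\<Sum>j<q. indicator {j. dist_int (real q' * y / q + real q' * real j / real q) \<le> \<alpha>'} j :: ennreal)
       = of_nat (card {j\<in>{..<q}. dist_int (real q' * y / q + real q' * real j / real q) \<le> \<alpha>'})"
      by (simp add: indicator_def sum.If_cases Int_def)
    also have "\<dots> \<le> ennreal (2 * \<alpha>' * q + gcd q q')"
      using card_dist_int_le[OF q assms(4), of "real q' * y / q" q']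
      by (simp add: ennreal_of_nat_eq_real_of_nat ennreal_leI)
    finally show "(\<Sum>j<q. indicator ?A (of_int a + (y + real j) / real q)) \<le>
        ennreal (2 * \<alpha>' * q + gcd q q') * indicator {y. dist_int y \<le> \<alpha>} y"
      by (subst (2) mult.commute) (simp add: mult_left_mono)
  qed
  also have "\<dots> = ennreal (2 * \<alpha>' * q + gcd q q') * ennreal (2 * \<alpha>)"
    using emeasure_unif_unit_dist_int[OF assms(2,3)] by (subst nn_integral_cmult_indicator) auto
  finally have "emeasure (unif_unit a) ?A \<le> ennreal (1/q) * (ennreal (2 * \<alpha>' * q + gcd q q') * ennreal (2 * \<alpha>))"
    unfolding A by (rule mult_left_mono) simp
  also have "\<dots> = ennreal (4 * \<alpha> * \<alpha>' + 2 * (\<alpha> * gcd q q' / q))"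
  proof -
    have "ennreal (1/q) * (ennreal (2 * \<alpha>' * q + gcd q q') * ennreal (2 * \<alpha>)) =
       ennreal ((1/q) * ((2 * \<alpha>' * q + gcd q q') * (2 * \<alpha>)))"
      using assms(2,4) by (intro ennreal_mult3) auto
    also have "(1/q) * ((2 * \<alpha>' * q + gcd q q') * (2 * \<alpha>)) = 4 * \<alpha> * \<alpha>' + 2 * (\<alpha> * gcd q q' / q)"
      using q by (simp add: field_simps)
    finally show ?thesis .
  qed
  finally show ?thesis .
qed

text \<open>The event is symmetric in the two multipliers while the preceding bound is not. Keeping
  the smaller excess is what later allows it to be read as a length on a line.\<close>

lemma emeasure_unif_unit_two_dist_int:
  fixes q q' :: nat and \<alpha> \<alpha>' :: real
  assumes "q > 0" "q' > 0" "0 \<le> \<alpha>" "\<alpha> \<le> 1/2" "0 \<le> \<alpha>'" "\<alpha>' \<le> 1/2"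
  shows "emeasure (unif_unit a) {x. dist_int (real q * x) \<le> \<alpha> \<and> dist_int (real q' * x) \<le> \<alpha>'}
    \<le> ennreal (4 * \<alpha> * \<alpha>' + 2 * min (\<alpha> * gcd q q' / q) (\<alpha>' * gcd q q' / q'))"
proof -
  have "emeasure (unif_unit a) {x. dist_int (real q' * x) \<le> \<alpha>' \<and> dist_int (real q * x) \<le> \<alpha>}
      \<le> ennreal (4 * \<alpha>' * \<alpha> + 2 * (\<alpha>' * gcd q' q / q'))"
    using assms by (intro emeasure_unif_unit_two_dist_int_aux)
  moreover have "4 * \<alpha>' * \<alpha> + 2 * (\<alpha>' * gcd q' q / q') = 4 * \<alpha> * \<alpha>' + 2 * (\<alpha>' * gcd q q' / q')"
    by (simp add: gcd.commute)
  moreover have "{x. dist_int (real q' * x) \<le> \<alpha>' \<and> dist_int (real q * x) \<le> \<alpha>} =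
      {x. dist_int (real q * x) \<le> \<alpha> \<and> dist_int (real q' * x) \<le> \<alpha>'}" by auto
  ultimately show ?thesis
    using emeasure_unif_unit_two_dist_int_aux[OF assms(1,3,4,5), of a q']
    by (auto simp only: min_def split: if_split)
qed

text \<open>The largest \<open>u \<le> 1 / 2\<close> with \<open>u * c \<le> \<psi>\<close>. The
  case \<open>c = 0\<close> imposes no constraint and is separate because division by zero yields
  zero.\<close>

definition corner :: "real \<Rightarrow> real \<Rightarrow> real" where
  "corner \<psi> c = (if c = 0 then 1 / 2 else min (1 / 2) (\<psi> / c))"

lemma corner_nonneg: "0 \<le> c \<Longrightarrow> 0 \<le> \<psi> \<Longrightarrow> 0 \<le> corner \<psi> c"
  and corner_le_half: "corner \<psi> c \<le> 1 / 2"
proof -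
  show "0 \<le> c \<Longrightarrow> 0 \<le> \<psi> \<Longrightarrow> 0 \<le> corner \<psi> c" by (simp add: corner_def)
  show "corner \<psi> c \<le> 1 / 2" unfolding corner_def by (metis min.cobounded1 order_refl)
qed

lemma le_corner_iff: "0 \<le> c \<Longrightarrow> 0 \<le> \<psi> \<Longrightarrow> u \<le> 1 / 2 \<Longrightarrow> u * c \<le> \<psi> \<longleftrightarrow> u \<le> corner \<psi> c"
  by (cases "c = 0") (simp_all add: corner_def pos_le_divide_eq)

lemma emeasure_unif_half_le:
  assumes "0 \<le> \<alpha>" "\<alpha> \<le> 1 / 2"
  shows "emeasure unif_half {u. u \<le> \<alpha>} = ennreal (2 * \<alpha>)"
proof -
  have "{0..1/2} \<inter> {u. u \<le> \<alpha>} = {0..\<alpha>}" using assms by auto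
  then have "emeasure unif_half {u. u \<le> \<alpha>} = ennreal 2 * ennreal \<alpha>"
    using assms by (simp add: emeasure_unif_half)
  thus ?thesis using assms by (simp add: ennreal_mult)
qed

lemma AE_unif_half: "AE u in unif_half. 0 \<le> u \<and> u \<le> 1 / 2"
  unfolding unif_half_def by (subst AE_density) (auto intro!: AE_I2 simp del: AE_conj_iff simp: indicator_def split: if_splits)

lemma emeasure_unif_half_mult_le:
  assumes "0 \<le> c" "0 \<le> \<psi>"
  shows "emeasure unif_half {u. u * c \<le> \<psi>} = ennreal (2 * corner \<psi> c)"
proof -
  have "emeasure unif_half {u. u * c \<le> \<psi>} = emeasure unif_half {u. u \<le> corner \<psi> c}"
    using AE_unif_half by (intro emeasure_eq_AE) (auto simp: le_corner_iff assms)
  thus ?thesis using emeasure_unif_half_le[OF corner_nonneg[OF assms] corner_le_half] by simp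
qed

text \<open>The minimum in the two-distance bound is the \<open>unif_half\<close> measure of those
  \<open>u\<close> for which \<open>(u, q' / q * u)\<close> lies in the corner rectangle. In this
  form the excess is itself a measure, so it can be integrated over a second coordinate by
  Tonelli.\<close>

lemma emeasure_unif_unit_corner_le:
  fixes q q' :: nat
  assumes q: "0 < q'" "q' \<le> q" and nn: "0 \<le> c" "0 \<le> c'" "0 \<le> \<psi>" "0 \<le> \<psi>'"
  shows "emeasure (unif_unit a) {x. dist_int (real q * x) * c \<le> \<psi> \<and> dist_int (real q' * x) * c' \<le> \<psi>'} \<le>
    emeasure unif_half {u. u * c \<le> \<psi>} * emeasure unif_half {v. v * c' \<le> \<psi>'} +
    ennreal (gcd q q' / q) * emeasure unif_half {u. u * c \<le> \<psi> \<and> (q' / q * u) * c' \<le> \<psi>'}"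
proof -
  define \<alpha> \<alpha>' where "\<alpha> = corner \<psi> c" and "\<alpha>' = corner \<psi>' c'"
  have \<alpha>: "0 \<le> \<alpha>" "\<alpha> \<le> 1/2" "0 \<le> \<alpha>'" "\<alpha>' \<le> 1/2"
    unfolding \<alpha>_def \<alpha>'_def by (intro corner_nonneg corner_le_half nn)+
  have "{x. dist_int (real q * x) * c \<le> \<psi> \<and> dist_int (real q' * x) * c' \<le> \<psi>'} =
      {x. dist_int (real q * x) \<le> \<alpha> \<and> dist_int (real q' * x) \<le> \<alpha>'}"
    unfolding le_corner_iff[OF nn(1,3) dist_int_le_half] le_corner_iff[OF nn(2,4) dist_int_le_half] \<alpha>_def \<alpha>'_def
    by (rule refl)
  moreover have "emeasure (unif_unit a) {x. dist_int (real q * x) \<le> \<alpha> \<and> dist_int (real q' * x) \<le> \<alpha>'} \<le>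
     ennreal (4 * \<alpha> * \<alpha>' + 2 * min (\<alpha> * gcd q q' / q) (\<alpha>' * gcd q q' / q'))"
    using q \<alpha> by (intro emeasure_unif_unit_two_dist_int) auto
  ultimately have "emeasure (unif_unit a) {x. dist_int (real q * x) * c \<le> \<psi> \<and> dist_int (real q' * x) * c' \<le> \<psi>'} \<le>
     ennreal (4 * \<alpha> * \<alpha>' + 2 * min (\<alpha> * gcd q q' / q) (\<alpha>' * gcd q q' / q'))"
    by (rule ord_eq_le_trans[OF arg_cong])
  also have "\<dots> = ennreal (2 * \<alpha>) * ennreal (2 * \<alpha>') +
     ennreal (gcd q q' / q) * ennreal (2 * min \<alpha> (\<alpha>' * q / q'))"
  proof -
    have "4 * \<alpha> * \<alpha>' + 2 * min (\<alpha> * gcd q q' / q) (\<alpha>' * gcd q q' / q') =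
       (2 * \<alpha>) * (2 * \<alpha>') + (gcd q q' / q) * (2 * min \<alpha> (\<alpha>' * q / q'))"
    proof -
      have "(gcd q q' / q) * min \<alpha> (\<alpha>' * q / q') = min ((gcd q q' / q) * \<alpha>) ((gcd q q' / q) * (\<alpha>' * q / q'))"
        by (simp add: min_mult_distrib_left)
      also have "(gcd q q' / q) * (\<alpha>' * q / q') = \<alpha>' * gcd q q' / q'"
        using q by (simp add: field_simps)
      finally have "(gcd q q' / q) * min \<alpha> (\<alpha>' * q / q') = min (\<alpha> * gcd q q' / q) (\<alpha>' * gcd q q' / q')"
        by (simp only: times_divide_eq_left times_divide_eq_right mult.commute[of _ \<alpha>])
      note E = this
      have "(gcd q q' / q) * (2 * min \<alpha> (\<alpha>' * q / q')) = 2 * ((gcd q q' / q) * min \<alpha> (\<alpha>' * q / q'))"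
        by (rule mult.left_commute)
      thus ?thesis unfolding E by linarith
    qed
    moreover have "0 \<le> (gcd q q' / q) * (2 * min \<alpha> (\<alpha>' * q / q'))" using \<alpha> by simp
    moreover have "ennreal ((2 * \<alpha>) * (2 * \<alpha>')) = ennreal (2 * \<alpha>) * ennreal (2 * \<alpha>')"
      using \<alpha> by (intro ennreal_mult) auto
    moreover have "ennreal ((gcd q q' / q) * (2 * min \<alpha> (\<alpha>' * q / q'))) =
        ennreal (gcd q q' / q) * ennreal (2 * min \<alpha> (\<alpha>' * q / q'))"
      using \<alpha> by (intro ennreal_mult) auto
    moreover have "0 \<le> (2 * \<alpha>) * (2 * \<alpha>')" using \<alpha> by simp
    ultimately show ?thesis by (simp only: ennreal_plus)
  qed
  also have "ennreal (2 * min \<alpha> (\<alpha>' * q / q')) = emeasure unif_half {u. u \<le> min \<alpha> (\<alpha>' * q / q')}"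
    using \<alpha> q by (intro emeasure_unif_half_le[symmetric] min.coboundedI1) auto
  also have "\<dots> = emeasure unif_half {u. u * c \<le> \<psi> \<and> (q' / q * u) * c' \<le> \<psi>'}"
  proof (rule emeasure_eq_AE)
    show "AE u in unif_half. (u \<in> {u. u \<le> min \<alpha> (\<alpha>' * q / q')}) = (u \<in> {u. u * c \<le> \<psi> \<and> (q' / q * u) * c' \<le> \<psi>'})"
      using AE_unif_half
    proof eventually_elim
      case (elim u)
      \<comment> \<open>The slope is at most 1, so the second coordinate stays below one half, where
        \<open>le_corner_iff\<close> applies.\<close>
      have "q' / q * u \<le> 1 * u" using elim q by (intro mult_right_mono) auto
      then have "(q' / q * u) * c' \<le> \<psi>' \<longleftrightarrow> q' / q * u \<le> \<alpha>'"
        unfolding \<alpha>'_def using elim nn by (intro le_corner_iff) linarith+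
      also have "\<dots> \<longleftrightarrow> u \<le> \<alpha>' * q / q'"
        using q by (simp add: field_simps)
      finally show ?case using elim nn by (simp add: le_corner_iff \<alpha>_def)
    qed
    show "{u. u \<le> min \<alpha> (\<alpha>' * q / q')} \<in> sets unif_half" by measurable
    show "{u. u * c \<le> \<psi> \<and> (q' / q * u) * c' \<le> \<psi>'} \<in> sets unif_half" by measurable
  qed
  finally show ?thesis
    unfolding emeasure_unif_half_mult_le[OF nn(1,3), folded \<alpha>_def]
      emeasure_unif_half_mult_le[OF nn(2,4), folded \<alpha>'_def] .
qed

section \<open>Hyperbolic regions\<close>

lemma Collect_in_sets: "Measurable.pred M P \<Longrightarrow> space M = UNIV \<Longrightarrow> Collect P \<in> sets M"
  by (simp add: pred_def)

lemma sigma_finite_unif_unit: "sigma_finite_measure (unif_unit a)"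
  by (rule prob_space_imp_sigma_finite[OF prob_space_unif_unit])

lemma sigma_finite_unif_half: "sigma_finite_measure unif_half"
  by (rule prob_space_imp_sigma_finite[OF prob_space_unif_half])

text \<open>Tonelli for section measures. Once one coordinate has been replaced by auxiliary
  variables, holding these fixed leaves a corner set in the other coordinate, and the
  one-dimensional bound applies again.\<close>

lemma nn_integral_emeasure_swap:
  assumes M: "sigma_finite_measure M" and N: "sigma_finite_measure N"
    and sp: "space M = UNIV" "space N = UNIV"
    and S: "{z. P (fst z) (snd z)} \<in> sets (M \<Otimes>\<^sub>M N)"
  shows "(\<integral>\<^sup>+x. emeasure N {y. P x y} \<partial>M) = (\<integral>\<^sup>+y. emeasure M {x. P x y} \<partial>N)"
proof -
  interpret pair_sigma_finite M N using M N by (simp add: pair_sigma_finite_def)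
  have 1: "Pair x -` {z. P (fst z) (snd z)} = {y. P x y}" for x by auto
  have 2: "(\<lambda>x. (x, y)) -` {z. P (fst z) (snd z)} = {x. P x y}" for y by auto
  show ?thesis
    using M2.emeasure_pair_measure_alt[OF S] emeasure_pair_measure_alt2[OF S] by (simp add: 1 2)
qed

text \<open>In every slice the event is that of \<open>y\<close> alone, so the average over the
  slices depends neither on \<open>q\<close> nor on \<open>a\<close>.\<close>

lemma emeasure_unif_unit_mult_le:
  fixes q :: nat
  assumes q: "q > 0" and nn: "0 \<le> c" "0 \<le> \<psi>"
  shows "emeasure (unif_unit a) {x. dist_int (real q * x) * c \<le> \<psi>} = emeasure unif_half {u. u * c \<le> \<psi>}"
proof -
  define \<alpha> where "\<alpha> = corner \<psi> c"
  have \<alpha>: "0 \<le> \<alpha>" "\<alpha> \<le> 1/2"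
    unfolding \<alpha>_def by (intro corner_nonneg corner_le_half nn)+
  have "{x. dist_int (real q * x) * c \<le> \<psi>} = {x. dist_int (real q * x) \<le> \<alpha>}"
    unfolding le_corner_iff[OF nn dist_int_le_half] \<alpha>_def by (rule refl)
  then have "emeasure (unif_unit a) {x. dist_int (real q * x) * c \<le> \<psi>} =
      (\<integral>\<^sup>+x. indicator {x. dist_int (real q * x) \<le> \<alpha>} x \<partial>unif_unit a)"
    by (simp add: nn_integral_indicator)
  also have "\<dots> = ennreal (1 / q) * (\<Sum>j<q. \<integral>\<^sup>+y. indicator {x. dist_int (real q * x) \<le> \<alpha>} (of_int a + (y + real j) / real q) \<partial>unif_unit 0)"
    by (rule nn_integral_unif_unit_split) (use q in auto)
  also have "(\<Sum>j<q. \<integral>\<^sup>+y. indicator {x. dist_int (real q * x) \<le> \<alpha>} (of_int a + (y + real j) / real q) \<partial>unif_unit 0)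
      = (\<Sum>j<q. ennreal (2 * \<alpha>))"
  proof (intro sum.cong refl)
    fix j
    have "dist_int (real q * (of_int a + (y + real j) / real q)) = dist_int y" for y
    proof -
      have "real q * (of_int a + (y + real j) / real q) = y + of_int (int q * a + int j)"
        using q by (simp add: field_simps)
      thus ?thesis by (metis dist_int_add_int)
    qed
    then have "(\<integral>\<^sup>+y. indicator {x. dist_int (real q * x) \<le> \<alpha>} (of_int a + (y + real j) / real q) \<partial>unif_unit 0) =
       (\<integral>\<^sup>+y. indicator {y. dist_int y \<le> \<alpha>} y \<partial>unif_unit 0)"
      by (intro nn_integral_cong) (simp add: indicator_def)
    also have "\<dots> = ennreal (2 * \<alpha>)"
      using emeasure_unif_unit_dist_int[OF \<alpha>] by (simp add: nn_integral_indicator)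
    finally show "(\<integral>\<^sup>+y. indicator {x. dist_int (real q * x) \<le> \<alpha>} (of_int a + (y + real j) / real q) \<partial>unif_unit 0) = ennreal (2 * \<alpha>)" .
  qed
  also have "ennreal (1 / q) * (\<Sum>j<q. ennreal (2 * \<alpha>)) = ennreal (2 * \<alpha>)"
    using q \<alpha> by (simp add: ennreal_of_nat_eq_real_of_nat ennreal_mult[symmetric])
  also have "\<dots> = emeasure unif_half {u. u * c \<le> \<psi>}"
    unfolding \<alpha>_def by (rule emeasure_unif_half_mult_le[OF nn, symmetric])
  finally show ?thesis .
qed

lemma measurable_emeasure_unif_half [measurable]:
  "(\<lambda>c. emeasure unif_half {u. u * c \<le> \<psi>}) \<in> borel_measurable borel"
proof -
  interpret sigma_finite_measure unif_half by (rule sigma_finite_unif_half)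
  have "(\<lambda>c. emeasure unif_half (Pair c -` {z. snd z * fst z \<le> \<psi>})) \<in> borel_measurable borel"
    by (rule measurable_emeasure_Pair) (rule Collect_in_sets, measurable, simp_all add: space_pair_measure)
  thus ?thesis by (simp add: vimage_def)
qed

lemma measurable_emeasure_unif_half_pair [measurable]:
  "(\<lambda>p. emeasure unif_half {u. u * fst p \<le> \<psi> \<and> r * u * snd p \<le> \<psi>'}) \<in> borel_measurable (borel \<Otimes>\<^sub>M borel)"
proof -
  interpret sigma_finite_measure unif_half by (rule sigma_finite_unif_half)
  have "(\<lambda>c. emeasure unif_half (Pair c -` {z. snd z * fst (fst z) \<le> \<psi> \<and> r * snd z * snd (fst z) \<le> \<psi>'})) \<in> borel_measurable (borel \<Otimes>\<^sub>M borel)"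
    by (rule measurable_emeasure_Pair) (rule Collect_in_sets, measurable, simp_all add: space_pair_measure)
  thus ?thesis by (simp add: vimage_def)
qed

text \<open>The probability that the product of two independent \<open>unif_half\<close> variables
  is at most \<psi>, written through sections because this is how it emerges from the swaps.\<close>

definition region_mass :: "real \<Rightarrow> ennreal" where
  "region_mass \<psi> = (\<integral>\<^sup>+u. emeasure unif_half {v. v * u \<le> \<psi>} \<partial>unif_half)"

definition unit_square :: "int \<Rightarrow> int \<Rightarrow> (real \<times> real) measure" where
  "unit_square a a' = unif_unit a \<Otimes>\<^sub>M unif_unit a'"

lemma emeasure_unit_square_hyperbolic:
  fixes q :: nat
  assumes q: "q > 0" and "0 \<le> \<psi>"
  shows "emeasure (unit_square a a') {x. dist_int (q * fst x) * dist_int (q * snd x) \<le> \<psi>} = region_mass \<psi>"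
proof -
  interpret sigma_finite_measure "unif_unit a'" by (rule sigma_finite_unif_unit)
  have "emeasure (unit_square a a') {x. dist_int (q * fst x) * dist_int (q * snd x) \<le> \<psi>} =
    (\<integral>\<^sup>+x. emeasure (unif_unit a') (Pair x -` {x. dist_int (q * fst x) * dist_int (q * snd x) \<le> \<psi>}) \<partial>unif_unit a)"
    unfolding unit_square_def by (rule emeasure_pair_measure_alt) (rule Collect_in_sets, measurable, simp_all add: space_pair_measure)
  also have "\<dots> = (\<integral>\<^sup>+x. emeasure (unif_unit a') {y. dist_int (q * y) * dist_int (q * x) \<le> \<psi>} \<partial>unif_unit a)"
    by (simp add: vimage_def mult.commute)
  also have "\<dots> = (\<integral>\<^sup>+x. emeasure unif_half {u. u * dist_int (q * x) \<le> \<psi>} \<partial>unif_unit a)"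
    using assms by (simp add: emeasure_unif_unit_mult_le)
  also have "\<dots> = (\<integral>\<^sup>+u. emeasure (unif_unit a) {x. u * dist_int (q * x) \<le> \<psi>} \<partial>unif_half)"
    by (rule nn_integral_emeasure_swap[OF sigma_finite_unif_unit sigma_finite_unif_half])
      (simp, simp, rule Collect_in_sets, measurable, simp_all add: space_pair_measure)
  also have "\<dots> = (\<integral>\<^sup>+u. emeasure unif_half {v. v * u \<le> \<psi>} \<partial>unif_half)"
  proof (rule nn_integral_cong_AE)
    show "AE u in unif_half. emeasure (unif_unit a) {x. u * dist_int (q * x) \<le> \<psi>} = emeasure unif_half {v. v * u \<le> \<psi>}"
      using AE_unif_half
    proof eventually_elim
      case (elim u)
      then show ?case
        using emeasure_unif_unit_mult_le[OF q _ assms(2), of u a] by (simp add: mult.commute)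
    qed
  qed
  finally show ?thesis by (simp add: region_mass_def)
qed

lemma emeasure_unif_half_rectangle:
  "emeasure (unif_half \<Otimes>\<^sub>M unif_half) {p. fst p * c \<le> \<psi> \<and> snd p * c' \<le> \<psi>'} =
    emeasure unif_half {u. u * c \<le> \<psi>} * emeasure unif_half {v. v * c' \<le> \<psi>'}"
proof -
  interpret sigma_finite_measure unif_half by (rule sigma_finite_unif_half)
  have "{p. fst p * c \<le> \<psi> \<and> snd p * c' \<le> \<psi>'} = {u. u * c \<le> \<psi>} \<times> {v. v * c' \<le> \<psi>'}" by auto
  thus ?thesis by (simp add: emeasure_pair_measure_Times)
qed

text \<open>The one-dimensional bound, product part plus line part, is used once per coordinate,
  which gives four terms. Product with product is the independent value; the two mixed terms are the
  same integral along the line, hence the factor 2; line with line carries the square of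
  \<open>gcd q q' / q\<close>.\<close>

lemma emeasure_unit_square_two_hyperbolic_le:
  fixes q q' :: nat
  assumes q: "0 < q'" "q' \<le> q" and nn: "0 \<le> \<psi>" "0 \<le> \<psi>'"
  shows "emeasure (unit_square a a') {x. dist_int (q * fst x) * dist_int (q * snd x) \<le> \<psi> \<and>
      dist_int (q' * fst x) * dist_int (q' * snd x) \<le> \<psi>'} \<le>
    region_mass \<psi> * region_mass \<psi>' +
    2 * (ennreal (gcd q q' / q) *
       (\<integral>\<^sup>+u. emeasure unif_half {v. v * u \<le> \<psi>} * emeasure unif_half {v. v * (q' / q * u) \<le> \<psi>'} \<partial>unif_half)) +
    ennreal (gcd q q' / q) * (ennreal (gcd q q' / q) * region_mass \<psi>)"
proof -
  define k where "k = ennreal (gcd q q' / q)"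
  define r where "r = real q' / real q"
  define e where "e = (\<lambda>\<psi> c. emeasure unif_half {u. u * c \<le> \<psi>})"
  define e2 where "e2 = (\<lambda>c c'. emeasure unif_half {u. u * c \<le> \<psi> \<and> r * u * c' \<le> \<psi>'})"
  define X where "X = (\<integral>\<^sup>+u. e \<psi> u * e \<psi>' (r * u) \<partial>unif_half)"
  have [measurable]: "(\<lambda>c. e \<psi> c) \<in> borel_measurable borel" for \<psi>
    unfolding e_def by measurable
  have [measurable]: "(\<lambda>p. e2 (fst p) (snd p)) \<in> borel_measurable (borel \<Otimes>\<^sub>M borel)"
    unfolding e2_def by measurable
  have e2m: "(\<lambda>x. e2 (f x) (h x)) \<in> borel_measurable M"
    if "f \<in> borel_measurable M" "h \<in> borel_measurable M" for f h :: "'b \<Rightarrow> real" and M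
    using measurable_compose[OF measurable_Pair[OF that] \<open>(\<lambda>p. e2 (fst p) (snd p)) \<in> borel_measurable (borel \<Otimes>\<^sub>M borel)\<close>] by simp
  have r0: "0 \<le> r" by (simp add: r_def)
  interpret U': sigma_finite_measure "unif_unit a'" by (rule sigma_finite_unif_unit)
  interpret H: sigma_finite_measure unif_half by (rule sigma_finite_unif_half)
  interpret HH: pair_sigma_finite unif_half unif_half
    using sigma_finite_unif_half by (simp add: pair_sigma_finite_def)
  have H2: "sigma_finite_measure (unif_half \<Otimes>\<^sub>M unif_half)" by (rule HH.sigma_finite_measure_axioms)
  have swap1: "emeasure (unif_unit a) {x. dist_int (q * x) * c \<le> \<psi> \<and> dist_int (q' * x) * c' \<le> \<psi>'}
       \<le> e \<psi> c * e \<psi>' c' + k * e2 c c'" if "0 \<le> c" "0 \<le> c'" for a c c'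
    using emeasure_unif_unit_corner_le[OF q that nn, of a] unfolding e_def e2_def k_def r_def .
  have S: "{x. dist_int (q * fst x) * dist_int (q * snd x) \<le> \<psi> \<and>
      dist_int (q' * fst x) * dist_int (q' * snd x) \<le> \<psi>'} \<in> sets (unif_unit a \<Otimes>\<^sub>M unif_unit a')"
    by (rule Collect_in_sets, measurable, simp_all add: space_pair_measure)
  have "emeasure (unit_square a a') {x. dist_int (q * fst x) * dist_int (q * snd x) \<le> \<psi> \<and>
      dist_int (q' * fst x) * dist_int (q' * snd x) \<le> \<psi>'} =
     (\<integral>\<^sup>+x. emeasure (unif_unit a') {y. dist_int (q * y) * dist_int (q * x) \<le> \<psi> \<and> dist_int (q' * y) * dist_int (q' * x) \<le> \<psi>'} \<partial>unif_unit a)"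
    unfolding unit_square_def U'.emeasure_pair_measure_alt[OF S] by (simp add: vimage_def mult.commute)
  \<comment> \<open>First use, in the second coordinate: with \<open>x\<close> fixed, its two
    distances are the coefficients of the corner conditions.\<close>
  also have "\<dots> \<le> (\<integral>\<^sup>+x. e \<psi> (dist_int (q * x)) * e \<psi>' (dist_int (q' * x)) + k * e2 (dist_int (q * x)) (dist_int (q' * x)) \<partial>unif_unit a)"
    by (intro nn_integral_mono swap1) auto
  also have "\<dots> = (\<integral>\<^sup>+x. e \<psi> (dist_int (q * x)) * e \<psi>' (dist_int (q' * x)) \<partial>unif_unit a) +
      k * (\<integral>\<^sup>+x. e2 (dist_int (q * x)) (dist_int (q' * x)) \<partial>unif_unit a)"
    using e2m[of "\<lambda>x. dist_int (real q * x)" "unif_unit a" "\<lambda>x. dist_int (real q' * x)"]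
    by (subst nn_integral_add) (auto simp: nn_integral_cmult)
  also have "(\<integral>\<^sup>+x. e \<psi> (dist_int (q * x)) * e \<psi>' (dist_int (q' * x)) \<partial>unif_unit a) =
      (\<integral>\<^sup>+x. emeasure (unif_half \<Otimes>\<^sub>M unif_half) {p. fst p * dist_int (q * x) \<le> \<psi> \<and> snd p * dist_int (q' * x) \<le> \<psi>'} \<partial>unif_unit a)"
    by (simp add: emeasure_unif_half_rectangle e_def)
  also have "\<dots> = (\<integral>\<^sup>+p. emeasure (unif_unit a) {x. fst p * dist_int (q * x) \<le> \<psi> \<and> snd p * dist_int (q' * x) \<le> \<psi>'} \<partial>(unif_half \<Otimes>\<^sub>M unif_half))"
    by (rule nn_integral_emeasure_swap[OF sigma_finite_unif_unit H2])
      (simp, simp add: space_pair_measure, rule Collect_in_sets, measurable, simp_all add: space_pair_measure)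
  \<comment> \<open>Second use, on the product part: the pair \<open>p\<close> now supplies the
    coefficients.\<close>
  also have "\<dots> \<le> (\<integral>\<^sup>+p. e \<psi> (fst p) * e \<psi>' (snd p) + k * e2 (fst p) (snd p) \<partial>(unif_half \<Otimes>\<^sub>M unif_half))"
  proof (rule nn_integral_mono_AE)
    have "AE p in unif_half \<Otimes>\<^sub>M unif_half. 0 \<le> fst p \<and> 0 \<le> snd p"
    proof (rule HH.AE_pair_measure)
      have nonneg: "AE u in unif_half. 0 \<le> u" using AE_unif_half by eventually_elim simp
      then show "AE x in unif_half. AE y in unif_half. 0 \<le> fst (x, y) \<and> 0 \<le> snd (x, y)"
        by eventually_elim (use nonneg in simp)
    qed measurable
    then show "AE p in unif_half \<Otimes>\<^sub>M unif_half. emeasure (unif_unit a) {x. fst p * dist_int (q * x) \<le> \<psi> \<and> snd p * dist_int (q' * x) \<le> \<psi>'}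
        \<le> e \<psi> (fst p) * e \<psi>' (snd p) + k * e2 (fst p) (snd p)"
    proof eventually_elim
      case (elim p)
      then show ?case using swap1[of "fst p" "snd p" a] by (simp add: mult.commute)
    qed
  qed
  also have "\<dots> = (\<integral>\<^sup>+p. e \<psi> (fst p) * e \<psi>' (snd p) \<partial>(unif_half \<Otimes>\<^sub>M unif_half)) + k * (\<integral>\<^sup>+p. e2 (fst p) (snd p) \<partial>(unif_half \<Otimes>\<^sub>M unif_half))"
    by (subst nn_integral_add) (auto simp: nn_integral_cmult)
  also have "(\<integral>\<^sup>+p. e \<psi> (fst p) * e \<psi>' (snd p) \<partial>(unif_half \<Otimes>\<^sub>M unif_half)) = region_mass \<psi> * region_mass \<psi>'"
  proof -
    have "(\<integral>\<^sup>+p. e \<psi> (fst p) * e \<psi>' (snd p) \<partial>(unif_half \<Otimes>\<^sub>M unif_half)) = (\<integral>\<^sup>+u. \<integral>\<^sup>+v. e \<psi> u * e \<psi>' v \<partial>unif_half \<partial>unif_half)"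
      by (subst H.nn_integral_fst[symmetric]) auto
    also have "\<dots> = region_mass \<psi> * region_mass \<psi>'"
      by (simp add: nn_integral_cmult nn_integral_multc region_mass_def e_def)
    finally show ?thesis .
  qed
  \<comment> \<open>Integrating over the point \<open>w\<close> of the line last splits the inner
    event into a rectangle, which yields the first mixed term.\<close>
  also have "(\<integral>\<^sup>+p. e2 (fst p) (snd p) \<partial>(unif_half \<Otimes>\<^sub>M unif_half)) = X"
  proof -
    have "(\<integral>\<^sup>+p. e2 (fst p) (snd p) \<partial>(unif_half \<Otimes>\<^sub>M unif_half)) =
      (\<integral>\<^sup>+w. emeasure (unif_half \<Otimes>\<^sub>M unif_half) {p. w * fst p \<le> \<psi> \<and> r * w * snd p \<le> \<psi>'} \<partial>unif_half)"
      unfolding e2_def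
      by (rule nn_integral_emeasure_swap[OF H2 sigma_finite_unif_half])
        (simp add: space_pair_measure, simp, rule Collect_in_sets, measurable, simp_all add: space_pair_measure)
    also have "\<dots> = X"
      unfolding X_def e_def emeasure_unif_half_rectangle[symmetric] by (simp add: mult.commute mult.left_commute)
    finally show ?thesis .
  qed
  also have "(\<integral>\<^sup>+x. e2 (dist_int (q * x)) (dist_int (q' * x)) \<partial>unif_unit a) =
      (\<integral>\<^sup>+u. emeasure (unif_unit a) {x. u * dist_int (q * x) \<le> \<psi> \<and> r * u * dist_int (q' * x) \<le> \<psi>'} \<partial>unif_half)"
    unfolding e2_def by (rule nn_integral_emeasure_swap[OF sigma_finite_unif_unit sigma_finite_unif_half])
      (simp, simp, rule Collect_in_sets, measurable, simp_all add: space_pair_measure)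
  \<comment> \<open>Second use, on the line part, with coefficients \<open>u\<close> and
    \<open>r * u\<close>.\<close>
  also have "\<dots> \<le> (\<integral>\<^sup>+u. e \<psi> u * e \<psi>' (r * u) + k * e \<psi> u \<partial>unif_half)"
  proof (rule nn_integral_mono_AE)
    show "AE u in unif_half. emeasure (unif_unit a) {x. u * dist_int (q * x) \<le> \<psi> \<and> r * u * dist_int (q' * x) \<le> \<psi>'}
       \<le> e \<psi> u * e \<psi>' (r * u) + k * e \<psi> u"
      using AE_unif_half
    proof eventually_elim
      case (elim u)
      have "emeasure (unif_unit a) {x. u * dist_int (q * x) \<le> \<psi> \<and> r * u * dist_int (q' * x) \<le> \<psi>'} \<le>
          e \<psi> u * e \<psi>' (r * u) + k * e2 u (r * u)"
        using swap1[of u "r * u" a] elim r0 by (simp add: mult.commute)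
      \<comment> \<open>In the line-line term the condition for \<open>q'\<close> is dropped; the
        factor \<open>k * k\<close> already makes this term small enough.\<close>
      also have "e2 u (r * u) \<le> e \<psi> u"
        unfolding e2_def e_def by (intro emeasure_mono) auto
      finally show ?case by (simp add: add_left_mono mult_left_mono)
    qed
  qed
  also have "\<dots> = X + k * region_mass \<psi>"
    by (subst nn_integral_add) (auto simp: nn_integral_cmult X_def region_mass_def e_def)
  finally have "emeasure (unit_square a a') {x. dist_int (q * fst x) * dist_int (q * snd x) \<le> \<psi> \<and>
      dist_int (q' * fst x) * dist_int (q' * snd x) \<le> \<psi>'} \<le>
      region_mass \<psi> * region_mass \<psi>' + k * X + k * (X + k * region_mass \<psi>)"
    by (simp add: add_left_mono add_right_mono mult_left_mono add.assoc)
  also have "\<dots> = region_mass \<psi> * region_mass \<psi>' + 2 * (k * X) + k * (k * region_mass \<psi>)"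
    by (simp add: distrib_left mult_2 add.assoc)
  finally show ?thesis unfolding k_def X_def e_def r_def .
qed

section \<open>Closed form of the probability of a hyperbolic region\<close>

lemma emeasure_unif_half_min:
  assumes "0 < u" "0 < \<psi>"
  shows "emeasure unif_half {v. v * u \<le> \<psi>} = ennreal (min 1 (2 * \<psi> / u))"
proof -
  have "2 * corner \<psi> u = min (2 * (1 / 2)) (2 * (\<psi> / u))"
    using assms by (simp only: corner_def min_mult_distrib_left) simp
  thus ?thesis using assms by (simp add: emeasure_unif_half_mult_le)
qed

lemma AE_unif_half_pos: "AE u in unif_half. 0 < u \<and> u \<le> 1 / 2"
proof -
  have "AE u in lborel. u \<noteq> (0::real)" by (rule AE_lborel_singleton)
  then have "AE u in unif_half. u \<noteq> 0"
    unfolding unif_half_def by (subst AE_density) auto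
  with AE_unif_half show ?thesis by eventually_elim auto
qed

lemma nn_integral_unif_half:
  "f \<in> borel_measurable borel \<Longrightarrow> (\<integral>\<^sup>+u. f u \<partial>unif_half) = 2 * (\<integral>\<^sup>+u. f u * indicator {0..1/2} u \<partial>lborel)"
  unfolding unif_half_def by (subst nn_integral_density) (simp_all add: nn_integral_cmult[symmetric] ac_simps)

text \<open>With \<open>t = 4 * \<psi>\<close> this is \<open>t * (1 - ln t)\<close>, the
  distribution function of a product of two independent uniform variables on the unit interval, each
  being twice a distance. The largest product of two distances is 1/4.\<close>

definition region_prob :: "real \<Rightarrow> real" where
  "region_prob \<psi> = (if \<psi> \<ge> 1 / 4 then 1 else 4 * \<psi> * (1 - ln (4 * \<psi>)))"

lemma region_mass_eq:
  assumes "0 < \<psi>"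
  shows "region_mass \<psi> = ennreal (region_prob \<psi>)"
proof -
  have "region_mass \<psi> = (\<integral>\<^sup>+u. ennreal (min 1 (2 * \<psi> / u)) \<partial>unif_half)"
    unfolding region_mass_def
    by (rule nn_integral_cong_AE) (use AE_unif_half_pos in eventually_elim, simp add: emeasure_unif_half_min assms)
  also have "\<dots> = ennreal (region_prob \<psi>)"
  proof (cases "\<psi> \<ge> 1 / 4")
    case True
    have "(\<integral>\<^sup>+u. ennreal (min 1 (2 * \<psi> / u)) \<partial>unif_half) = (\<integral>\<^sup>+u. 1 \<partial>unif_half)"
    proof (rule nn_integral_cong_AE)
      show "AE u in unif_half. ennreal (min 1 (2 * \<psi> / u)) = 1"
        using AE_unif_half_pos
      proof eventually_elim
        case (elim u)
        then have "1 \<le> 2 * \<psi> / u" using True by (simp add: pos_le_divide_eq)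
        then have "min 1 (2 * \<psi> / u) = 1" by (rule min_absorb1)
        thus ?case by simp
      qed
    qed
    also have "\<dots> = 1" using prob_space.emeasure_space_1[OF prob_space_unif_half] by simp
    finally show ?thesis using True by (simp add: region_prob_def)
  next
    case False
    then have \<psi>: "0 < \<psi>" "2 * \<psi> < 1/2" using assms by auto
    have "(\<integral>\<^sup>+u. ennreal (min 1 (2 * \<psi> / u)) \<partial>unif_half) =
        2 * (\<integral>\<^sup>+u. ennreal (min 1 (2 * \<psi> / u)) * indicator {0..1/2} u \<partial>lborel)"
      by (rule nn_integral_unif_half) measurable
    also have "(\<integral>\<^sup>+u. ennreal (min 1 (2 * \<psi> / u)) * indicator {0..1/2} u \<partial>lborel) =
        (\<integral>\<^sup>+u. indicator {0..2*\<psi>} u + ennreal (2 * \<psi> / u) * indicator {2*\<psi>..1/2} u \<partial>lborel)"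
    proof (rule nn_integral_cong_AE)
      \<comment> \<open>Two points are excluded: at \<open>2 * \<psi>\<close> both indicators are 1,
        and at 0 the quotient is 0 instead of infinite.\<close>
      have "AE u in lborel. u \<noteq> (0::real)" "AE u in lborel. u \<noteq> 2 * \<psi>" by (rule AE_lborel_singleton)+
      then show "AE u in lborel. ennreal (min 1 (2 * \<psi> / u)) * indicator {0..1/2} u =
          indicator {0..2*\<psi>} u + ennreal (2 * \<psi> / u) * indicator {2*\<psi>..1/2} u"
      proof eventually_elim
        case (elim u)
        show ?case
        proof (cases "u < 2 * \<psi>")
          case True
          show ?thesis
          proof (cases "0 < u")
            case 0: True
            then have "1 \<le> 2 * \<psi> / u" using True by (simp add: pos_le_divide_eq)
            then have "min 1 (2 * \<psi> / u) = 1" by (rule min_absorb1)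
            thus ?thesis using 0 True \<psi> by (simp add: indicator_def)
          next
            case False
            thus ?thesis using elim True \<psi> by (simp add: indicator_def)
          qed
        next
          case False
          then have "2 * \<psi> / u \<le> 1" using \<psi> by (simp add: pos_divide_le_eq)
          then have "min 1 (2 * \<psi> / u) = 2 * \<psi> / u" by (rule min_absorb2)
          thus ?thesis using False \<psi> elim by (simp add: indicator_def)
        qed
      qed
    qed
    also have "\<dots> = (\<integral>\<^sup>+u. indicator {0..2*\<psi>} u \<partial>lborel) + (\<integral>\<^sup>+u. ennreal (2 * \<psi> / u) * indicator {2*\<psi>..1/2} u \<partial>lborel)"
      by (rule nn_integral_add) measurable
    also have "(\<integral>\<^sup>+u. indicator {0..2*\<psi>} u \<partial>lborel) = ennreal (2 * \<psi>)"
      using \<psi> by simp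
    also have "(\<integral>\<^sup>+u. ennreal (2 * \<psi> / u) * indicator {2*\<psi>..1/2} u \<partial>lborel) =
        ennreal (2 * \<psi> * ln (1/2) - 2 * \<psi> * ln (2 * \<psi>))"
    proof (rule nn_integral_FTC_Icc)
      show "(\<lambda>u. 2 * \<psi> / u) \<in> borel_measurable borel" by measurable
      show "2 * \<psi> \<le> 1 / 2" using \<psi> by simp
      fix u assume u: "u \<in> {2 * \<psi>..1 / 2}"
      then have "0 < u" using \<psi> by auto
      then show "((\<lambda>u. 2 * \<psi> * ln u) has_real_derivative 2 * \<psi> / u) (at u)"
        by (auto intro!: derivative_eq_intros)
      show "0 \<le> 2 * \<psi> / u" using \<psi> \<open>0 < u\<close> by simp
    qed
    also have "2 * (ennreal (2 * \<psi>) + ennreal (2 * \<psi> * ln (1/2) - 2 * \<psi> * ln (2 * \<psi>))) =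
       ennreal (2 * (2 * \<psi> + (2 * \<psi> * ln (1/2) - 2 * \<psi> * ln (2 * \<psi>))))"
    proof -
      have "ln (2 * \<psi>) \<le> ln (1/2)" using \<psi> by (subst ln_le_cancel_iff) auto
      then have "0 \<le> 2 * \<psi> * ln (1/2) - 2 * \<psi> * ln (2 * \<psi>)"
        using \<psi> by (simp only: right_diff_distrib[symmetric]) simp
      then show ?thesis
        using \<psi> by (simp only: ennreal_plus[symmetric] ennreal_numeral[symmetric]) (subst ennreal_mult, auto)
    qed
    also have "2 * (2 * \<psi> + (2 * \<psi> * ln (1/2) - 2 * \<psi> * ln (2 * \<psi>))) = region_prob \<psi>"
    proof -
      have "ln (4 * \<psi>) = ln ((2 * \<psi>) * 2)" by (simp add: mult.commute)
      also have "\<dots> = ln (2 * \<psi>) - ln (1/2)"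
        using \<psi> ln_mult[of "2 * \<psi>" 2] ln_div[of 1 2] by simp
      finally have eq: "ln (4 * \<psi>) = ln (2 * \<psi>) - ln (1/2)" .
      show ?thesis using False unfolding region_prob_def eq by (simp only: if_False) algebra
    qed
    finally show ?thesis .
  qed
  finally show ?thesis .
qed

lemma region_prob_nonneg: "0 < \<psi> \<Longrightarrow> 0 \<le> region_prob \<psi>"
proof -
  assume "0 < \<psi>"
  then have "\<psi> < 1 / 4 \<Longrightarrow> ln (4 * \<psi>) < 0" by (intro ln_less_zero) auto
  with \<open>0 < \<psi>\<close> show ?thesis
    by (cases "\<psi> \<ge> 1 / 4") (simp_all add: region_prob_def del: ln_less_zero_iff)
qed

section \<open>The mixed term\<close>

lemma nn_integral_min_powr:
  assumes c: "0 < c"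
  shows "(\<integral>\<^sup>+u. ennreal (min 1 ((c / u) powr (5/4))) * indicator {0..1/2} u \<partial>lborel) \<le> ennreal (5 * c)"
proof -
  have "(\<integral>\<^sup>+u. ennreal (min 1 ((c / u) powr (5/4))) * indicator {0..1/2} u \<partial>lborel) \<le>
     (\<integral>\<^sup>+u. indicator {0..c} u + ennreal (c powr (5/4) * u powr (-5/4)) * indicator {c..} u \<partial>lborel)"
  proof (rule nn_integral_mono)
    fix u
    show "ennreal (min 1 ((c / u) powr (5/4))) * indicator {0..1/2} u \<le>
      indicator {0..c} u + ennreal (c powr (5/4) * u powr (-5/4)) * indicator {c..} u"
    proof (cases "u \<le> c")
      case True
      thus ?thesis by (auto simp: indicator_def)
    next
      case False
      then have "(c / u) powr (5/4) = c powr (5/4) * u powr (-5/4)"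
        using c by (simp add: powr_divide powr_minus_divide)
      thus ?thesis using False c by (auto simp: indicator_def intro!: ennreal_leI)
    qed
  qed
  also have "\<dots> = (\<integral>\<^sup>+u. indicator {0..c} u \<partial>lborel) + (\<integral>\<^sup>+u. ennreal (c powr (5/4) * u powr (-5/4)) * indicator {c..} u \<partial>lborel)"
    by (rule nn_integral_add) measurable
  also have "(\<integral>\<^sup>+u. indicator {0..c} u \<partial>lborel) = ennreal c"
    using c by simp
  also have "(\<integral>\<^sup>+u. ennreal (c powr (5/4) * u powr (-5/4)) * indicator {c..} u \<partial>lborel) =
     ennreal (0 - (- 4 * c powr (5/4) * c powr (-1/4)))"
  proof (rule nn_integral_FTC_atLeast[where F = "\<lambda>u. - 4 * c powr (5/4) * u powr (-1/4)"])
    show "(\<lambda>u. c powr (5/4) * u powr (-5/4)) \<in> borel_measurable borel" by measurable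
    show "((\<lambda>u. - 4 * c powr (5/4) * u powr (-1/4)) has_real_derivative c powr (5/4) * u powr (-5/4)) (at u)" if "c \<le> u" for u
      using that c by (auto intro!: derivative_eq_intros)
    show "0 \<le> c powr (5/4) * u powr (-5/4)" for u by simp
    have "((\<lambda>u::real. u powr (-1/4)) \<longlongrightarrow> 0) at_top"
      by (rule tendsto_neg_powr) (auto simp: filterlim_ident)
    then show "((\<lambda>u. - 4 * c powr (5/4) * u powr (-1/4)) \<longlongrightarrow> 0) at_top"
      by (rule tendsto_mult_right_zero)
  qed
  also have "0 - (- 4 * c powr (5/4) * c powr (-1/4)) = 4 * c"
    using c by (simp add: powr_add[symmetric])
  also have "ennreal c + ennreal (4 * c) = ennreal (5 * c)"
    using c by (subst ennreal_plus[symmetric]) auto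
  finally show ?thesis .
qed

text \<open>Interpolation: for \<open>x \<le> 1\<close> the second factor is at most
  \<open>(\<rho> * x) powr (1/4)\<close>. Any positive exponent in place of 1/4 makes the power of
  \<open>x\<close> integrable at infinity after scaling, so no logarithm appears. As \<rho> will be
  the square of \<open>q / q'\<close>, an exponent below 1/2 keeps the later sum over
  \<open>q'\<close> of order \<open>q\<close>; 1/4 meets both demands.\<close>

lemma min_mult_le_powr:
  fixes x \<rho> :: real
  assumes "0 < x" "1 \<le> \<rho>"
  shows "min 1 x * min 1 (\<rho> * x) \<le> \<rho> powr (1/4) * min 1 (x powr (5/4))"
proof (cases "x \<le> 1")
  case True
  have "min 1 (\<rho> * x) \<le> (\<rho> * x) powr (1/4)"
  proof (cases "\<rho> * x \<le> 1")
    case True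
    have "(\<rho> * x) powr 1 \<le> (\<rho> * x) powr (1/4)"
      using assms True by (intro powr_mono') auto
    thus ?thesis using assms by simp
  next
    case False
    thus ?thesis using ge_one_powr_ge_zero[of "\<rho> * x" "1/4"] by simp
  qed
  then have "x * min 1 (\<rho> * x) \<le> x * (\<rho> * x) powr (1/4)"
    using assms by (intro mult_left_mono) auto
  also have "\<dots> = \<rho> powr (1/4) * (x powr 1 * x powr (1/4))"
    using assms by (simp add: powr_mult)
  also have "\<dots> = \<rho> powr (1/4) * x powr (5/4)"
    by (simp only: powr_add[symmetric]) simp
  finally show ?thesis
    using True assms powr_mono2[of "5/4" x 1] by simp
next
  case False
  have "1 \<le> \<rho> powr (1/4)" using assms by (intro ge_one_powr_ge_zero) auto
  moreover have "1 \<le> x powr (5/4)" using False by (intro ge_one_powr_ge_zero) auto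
  moreover have "min 1 (\<rho> * x) \<le> 1" by simp
  ultimately show ?thesis using False by (simp del: min.bounded_iff)
qed

text \<open>The sections are \<open>min 1 (c / u)\<close> and
  \<open>min 1 (\<rho> * (c / u))\<close> with \<open>c = 2 * (b / q)\<close>. One factor
  \<open>q / q'\<close> of \<rho> comes from the level \<open>b / q'\<close>, the other from the
  slope of the line.\<close>

lemma nn_integral_cross_le:
  fixes q q' :: nat
  assumes q: "0 < q'" "q' \<le> q" and b: "0 < b"
  shows "(\<integral>\<^sup>+u. emeasure unif_half {v. v * u \<le> b / q} * emeasure unif_half {v. v * (q' / q * u) \<le> b / q'} \<partial>unif_half)
     \<le> ennreal (20 * sqrt (q / q') * (b / q))"
proof -
  define c where "c = 2 * (b / q)"
  define \<rho> where "\<rho> = (real q / real q')\<^sup>2"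
  have c: "0 < c" using q b by (simp add: c_def)
  have \<rho>: "1 \<le> \<rho>" unfolding \<rho>_def using q by (intro one_le_power) simp
  have \<rho>s: "\<rho> powr (1/4) = sqrt (q / q')"
    unfolding \<rho>_def using q by (simp add: powr_half_sqrt[symmetric] powr_powr flip: powr_numeral)
  have "(\<integral>\<^sup>+u. emeasure unif_half {v. v * u \<le> b / q} * emeasure unif_half {v. v * (q' / q * u) \<le> b / q'} \<partial>unif_half) \<le>
     (\<integral>\<^sup>+u. ennreal (sqrt (q / q')) * ennreal (min 1 ((c / u) powr (5/4))) \<partial>unif_half)"
  proof (rule nn_integral_mono_AE)
    show "AE u in unif_half. emeasure unif_half {v. v * u \<le> b / q} * emeasure unif_half {v. v * (q' / q * u) \<le> b / q'}
       \<le> ennreal (sqrt (q / q')) * ennreal (min 1 ((c / u) powr (5/4)))"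
      using AE_unif_half_pos
    proof eventually_elim
      case (elim u)
      have 1: "emeasure unif_half {v. v * u \<le> b / q} = ennreal (min 1 (c / u))"
        using elim q b by (subst emeasure_unif_half_min) (auto simp: c_def)
      have "2 * (b / q') / (q' / q * u) = \<rho> * (c / u)"
        using q elim by (simp add: \<rho>_def c_def field_simps power2_eq_square)
      then have 2: "emeasure unif_half {v. v * (q' / q * u) \<le> b / q'} = ennreal (min 1 (\<rho> * (c / u)))"
        using elim q b by (subst emeasure_unif_half_min) auto
      have "min 1 (c / u) * min 1 (\<rho> * (c / u)) \<le> \<rho> powr (1/4) * min 1 ((c / u) powr (5/4))"
        using elim c \<rho> by (intro min_mult_le_powr) auto
      then have "ennreal (min 1 (c / u) * min 1 (\<rho> * (c / u))) \<le> ennreal (\<rho> powr (1/4) * min 1 ((c / u) powr (5/4)))"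
        by (rule ennreal_leI)
      then show ?case unfolding 1 2 \<rho>s using elim c \<rho> by (simp add: ennreal_mult)
    qed
  qed
  also have "\<dots> = ennreal (sqrt (q / q')) * (\<integral>\<^sup>+u. ennreal (min 1 ((c / u) powr (5/4))) \<partial>unif_half)"
    by (rule nn_integral_cmult) measurable
  also have "(\<integral>\<^sup>+u. ennreal (min 1 ((c / u) powr (5/4))) \<partial>unif_half) =
      2 * (\<integral>\<^sup>+u. ennreal (min 1 ((c / u) powr (5/4))) * indicator {0..1/2} u \<partial>lborel)"
    by (rule nn_integral_unif_half) measurable
  also have "ennreal (sqrt (q / q')) * \<dots> \<le> ennreal (sqrt (q / q')) * (2 * ennreal (5 * c))"
    by (intro mult_left_mono nn_integral_min_powr c) auto
  also have "\<dots> = ennreal (sqrt (q / q') * (2 * (5 * c)))"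
    using c by (simp add: ennreal_mult)
  also have "sqrt (q / q') * (2 * (5 * c)) = 20 * sqrt (q / q') * (b / q)"
    by (simp add: c_def)
  finally show ?thesis .
qed

section \<open>Variance\<close>

text \<open>Expanding the square leaves covariances, each bounded by \<open>K\<close>. An
  off-diagonal pair occurs in both orders, whence the factor 2.\<close>

lemma (in prob_space) expectation_sum_indicator_sq_le:
  fixes A :: "nat \<Rightarrow> 'a set" and K :: "nat \<Rightarrow> nat \<Rightarrow> real"
  assumes I: "finite I" and A: "\<And>i. i \<in> I \<Longrightarrow> A i \<in> events"
    and K: "\<And>i j. i \<in> I \<Longrightarrow> j \<in> I \<Longrightarrow> j \<le> i \<Longrightarrow> prob (A i \<inter> A j) \<le> prob (A i) * prob (A j) + K i j"
    and K0: "\<And>i j. i \<in> I \<Longrightarrow> j \<in> I \<Longrightarrow> j \<le> i \<Longrightarrow> 0 \<le> K i j"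
  shows "(\<integral>x. (\<Sum>i\<in>I. indicator (A i) x - prob (A i))\<^sup>2 \<partial>M) \<le> 2 * (\<Sum>i\<in>I. \<Sum>j\<in>{j\<in>I. j \<le> i}. K i j)"
proof -
  define Z where "Z = (\<lambda>i x. indicator (A i) x - prob (A i) :: real)"
  have int: "integrable M (\<lambda>x. Z i x * Z j x)" if "i \<in> I" "j \<in> I" for i j
  proof -
    have "Z i \<in> borel_measurable M" if "i \<in> I" for i
      using A[OF that] unfolding Z_def by measurable
    moreover have "\<bar>Z i x\<bar> \<le> 1" for i x
      unfolding Z_def using prob_le_1[of "A i"] measure_nonneg[of M "A i"]
      by (auto simp: indicator_def simp del: prob_le_1 measure_nonneg)
    then have "norm (Z i x * Z j x) \<le> 1" for x
      by (simp add: abs_mult mult_le_one)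
    ultimately show ?thesis
      using that by (intro integrable_const_bound[where B = 1]) auto
  qed
  have cov: "(\<integral>x. Z i x * Z j x \<partial>M) = prob (A i \<inter> A j) - prob (A i) * prob (A j)"
    if "i \<in> I" "j \<in> I" for i j
  proof -
    have [measurable]: "A i \<in> events" "A j \<in> events" using A that by auto
    have "Z i x * Z j x = indicator (A i \<inter> A j) x - prob (A j) * indicator (A i) x
       - prob (A i) * indicator (A j) x + prob (A i) * prob (A j)" for x
      by (simp add: Z_def indicator_inter_arith algebra_simps)
    then have "(\<integral>x. Z i x * Z j x \<partial>M) = (\<integral>x. indicator (A i \<inter> A j) x - prob (A j) * indicator (A i) x
       - prob (A i) * indicator (A j) x + prob (A i) * prob (A j) \<partial>M)" by simp
    also have "\<dots> = prob (A i \<inter> A j) - prob (A i) * prob (A j)"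
      by (simp add: prob_space less_top[symmetric])
    finally show ?thesis .
  qed
  have "(\<integral>x. (\<Sum>i\<in>I. Z i x)\<^sup>2 \<partial>M) = (\<integral>x. (\<Sum>i\<in>I. \<Sum>j\<in>I. Z i x * Z j x) \<partial>M)"
    by (simp add: power2_eq_square sum_product)
  also have "\<dots> = (\<Sum>i\<in>I. \<Sum>j\<in>I. (\<integral>x. Z i x * Z j x \<partial>M))"
    using int by (subst Bochner_Integration.integral_sum) (auto intro!: sum.cong Bochner_Integration.integral_sum)
  \<comment> \<open>On the diagonal both alternatives hold and \<open>K i i\<close> is counted
    twice, which is harmless since it is nonnegative.\<close>
  also have "\<dots> \<le> (\<Sum>i\<in>I. \<Sum>j\<in>I. (if j \<le> i then K i j else 0) + (if i \<le> j then K j i else 0))"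
  proof (intro sum_mono)
    fix i j assume ij: "i \<in> I" "j \<in> I"
    show "(\<integral>x. Z i x * Z j x \<partial>M) \<le> (if j \<le> i then K i j else 0) + (if i \<le> j then K j i else 0)"
      using K[OF ij] K[OF ij(2,1)] K0[OF ij] K0[OF ij(2,1)]
      by (auto simp: cov[OF ij] Int_commute mult.commute)
  qed
  also have "\<dots> = (\<Sum>i\<in>I. \<Sum>j\<in>I. if j \<le> i then K i j else 0) + (\<Sum>i\<in>I. \<Sum>j\<in>I. if i \<le> j then K j i else 0)"
    by (simp add: sum.distrib)
  also have "(\<Sum>i\<in>I. \<Sum>j\<in>I. if i \<le> j then K j i else 0) = (\<Sum>i\<in>I. \<Sum>j\<in>I. if j \<le> i then K i j else 0)"
    by (rule sum.swap)
  finally show ?thesis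
    unfolding Z_def using I by (simp add: sum.inter_filter)
qed

definition region :: "real \<Rightarrow> nat \<Rightarrow> (real \<times> real) set" where
  "region b q = {x. dist_int (real q * fst x) * dist_int (real q * snd x) \<le> b / q}"

lemma sets_unit_square [simp, measurable_cong]: "sets (unit_square a a') = sets (borel \<Otimes>\<^sub>M borel)"
  and space_unit_square [simp]: "space (unit_square a a') = UNIV"
  by (auto simp: unit_square_def space_pair_measure intro!: sets_pair_measure_cong)

lemma sets_region [measurable]: "region b q \<in> sets (borel \<Otimes>\<^sub>M borel)"
  unfolding region_def by (rule Collect_in_sets, measurable, simp add: space_pair_measure)

lemma prob_space_unit_square: "prob_space (unit_square a a')"
proof -
  interpret pair_prob_space "unif_unit a" "unif_unit a'"
    using prob_space_unif_unit by (simp add: pair_prob_space_def pair_sigma_finite_def sigma_finite_unif_unit)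
  show ?thesis unfolding unit_square_def by (rule P.prob_space_axioms)
qed

lemma measure_region: "0 < b \<Longrightarrow> 0 < q \<Longrightarrow> measure (unit_square a a') (region b q) = region_prob (b / q)"
  by (simp add: measure_def region_def emeasure_unit_square_hyperbolic region_mass_eq region_prob_nonneg)

text \<open>The first summand is the pair of mixed terms, 40 being twice the constant of the cross
  integral; the second is the line-line term.\<close>

definition cov_bound :: "real \<Rightarrow> nat \<Rightarrow> nat \<Rightarrow> real" where
  "cov_bound b q q' = 40 * (gcd q q' / q) * sqrt (q / q') * (b / q) + (gcd q q' / q)\<^sup>2 * region_prob (b / q)"

lemma cov_bound_nonneg: "0 < b \<Longrightarrow> 0 < q \<Longrightarrow> 0 \<le> cov_bound b q q'"
  by (simp add: cov_bound_def region_prob_nonneg)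

lemma measure_region_Int_le:
  assumes b: "0 < b" and q: "0 < q'" "q' \<le> q"
  shows "measure (unit_square a a') (region b q \<inter> region b q') \<le> region_prob (b / q) * region_prob (b / q') + cov_bound b q q'"
proof -
  interpret prob_space "unit_square a a'" by (rule prob_space_unit_square)
  define k where "k = real (gcd q q') / real q"
  define y where "y = 20 * sqrt (q / q') * (b / q)"
  have y: "0 \<le> y" using b by (simp add: y_def)
  have pos: "0 < b / q" "0 < b / q'" "0 \<le> k" using b q by (auto simp: k_def)
  have "region b q \<inter> region b q' = {x. dist_int (q * fst x) * dist_int (q * snd x) \<le> b / q \<and>
      dist_int (q' * fst x) * dist_int (q' * snd x) \<le> b / q'}"
    by (auto simp: region_def)
  then have "emeasure (unit_square a a') (region b q \<inter> region b q') \<le> region_mass (b / q) * region_mass (b / q') +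
    2 * (ennreal k *
       (\<integral>\<^sup>+u. emeasure unif_half {v. v * u \<le> b / q} * emeasure unif_half {v. v * (q' / q * u) \<le> b / q'} \<partial>unif_half)) +
    ennreal k * (ennreal k * region_mass (b / q))"
    using emeasure_unit_square_two_hyperbolic_le[OF q, of "b / q" "b / q'" a a'] pos unfolding k_def by simp
  also have "\<dots> \<le> region_mass (b / q) * region_mass (b / q') +
    2 * (ennreal k * ennreal y) + ennreal k * (ennreal k * region_mass (b / q))"
    unfolding y_def by (intro add_mono mult_left_mono nn_integral_cross_le q b order_refl) auto
  also have "\<dots> = ennreal (region_prob (b / q) * region_prob (b / q') + 2 * (k * y) + k * (k * region_prob (b / q)))"
    using pos region_prob_nonneg[OF pos(1)] region_prob_nonneg[OF pos(2)] b y
    by (simp add: region_mass_eq ennreal_plus ennreal_mult)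
  also have "region_prob (b / q) * region_prob (b / q') + 2 * (k * y) + k * (k * region_prob (b / q))
    = region_prob (b / q) * region_prob (b / q') + cov_bound b q q'"
    by (simp add: cov_bound_def k_def[symmetric] y_def power2_eq_square)
  finally show ?thesis
    unfolding emeasure_eq_measure
    using region_prob_nonneg[OF pos(1)] region_prob_nonneg[OF pos(2)] cov_bound_nonneg[OF b, of q q'] q
    by (subst (asm) ennreal_le_iff) auto
qed

section \<open>Gcd sums and divisor sums\<close>

lemma sum_gcd_le:
  fixes F :: "nat \<Rightarrow> nat \<Rightarrow> real"
  assumes q: "q > 0" and F: "\<And>d j. 0 \<le> F d j"
  shows "(\<Sum>j\<in>{1..q}. F (gcd q j) j) \<le> (\<Sum>d | d dvd q. \<Sum>i\<in>{1..q div d}. F d (d * i))"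
proof -
  have "(\<Sum>j\<in>{1..q}. F (gcd q j) j) = (\<Sum>d | d dvd q. \<Sum>j\<in>{j\<in>{1..q}. gcd q j = d}. F (gcd q j) j)"
    using q by (intro sum.group[symmetric]) auto
  \<comment> \<open>For each divisor \<open>d\<close> the condition \<open>gcd q j = d\<close> is
    relaxed to divisibility of \<open>j\<close> by \<open>d\<close>.\<close>
  also have "\<dots> \<le> (\<Sum>d | d dvd q. \<Sum>i\<in>{1..q div d}. F d (d * i))"
  proof (rule sum_mono)
    fix d assume "d \<in> {d. d dvd q}"
    then have d: "d dvd q" "d > 0" using q by (auto intro: Nat.gr0I)
    have "(\<Sum>j\<in>{j\<in>{1..q}. gcd q j = d}. F (gcd q j) j) = (\<Sum>j\<in>{j\<in>{1..q}. gcd q j = d}. F d j)"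
      by (intro sum.cong) auto
    also have "\<dots> \<le> (\<Sum>j\<in>(\<lambda>i. d * i) ` {1..q div d}. F d j)"
    proof (rule sum_mono2)
      show "{j\<in>{1..q}. gcd q j = d} \<subseteq> (\<lambda>i. d * i) ` {1..q div d}"
      proof
        fix j assume "j \<in> {j\<in>{1..q}. gcd q j = d}"
        then have j: "1 \<le> j" "j \<le> q" "gcd q j = d" by auto
        then obtain i where i: "j = d * i" by (metis dvdE gcd_dvd2)
        with j d have "i \<ge> 1" "i \<le> q div d" by (auto simp: less_eq_div_iff_mult_less_eq mult.commute Suc_le_eq intro: Nat.gr0I)
        with i show "j \<in> (\<lambda>i. d * i) ` {1..q div d}" by auto
      qed
    qed (auto intro: F)
    also have "\<dots> = (\<Sum>i\<in>{1..q div d}. F d (d * i))"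
      using d by (subst sum.reindex) (auto simp: inj_on_def)
    finally show "(\<Sum>j\<in>{j\<in>{1..q}. gcd q j = d}. F (gcd q j) j) \<le> (\<Sum>i\<in>{1..q div d}. F d (d * i))" .
  qed
  finally show ?thesis .
qed

lemma sum_inverse_sqrt_le: "(\<Sum>i\<in>{1..n::nat}. 1 / sqrt i) \<le> 2 * sqrt n"
proof (induction n)
  case (Suc n)
  have "(sqrt (Suc n) - sqrt n) * (sqrt (Suc n) + sqrt n) = 1"
    by (simp add: algebra_simps)
  moreover have "(sqrt (Suc n) - sqrt n) * (sqrt (Suc n) + sqrt n) \<le> (sqrt (Suc n) - sqrt n) * (2 * sqrt (Suc n))"
    by (intro mult_left_mono) auto
  ultimately have "1 \<le> (2 * (sqrt (Suc n) - sqrt n)) * sqrt (Suc n)"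
    by (simp only: mult.assoc mult.left_commute)
  then have "1 / sqrt (Suc n) \<le> 2 * (sqrt (Suc n) - sqrt n)"
    by (subst pos_divide_le_eq) auto
  with Suc.IH show ?case by simp
qed simp

text \<open>With \<open>q = d * e\<close> and \<open>j = d * i\<close> the summand is
  \<open>d * sqrt (e / i)\<close>; summing over \<open>i \<le> e\<close> gives at most
  \<open>2 * d * e = 2 * q\<close> for every divisor.\<close>

lemma sum_gcd_sqrt_le:
  fixes q :: nat
  assumes q: "q > 0"
  shows "(\<Sum>j\<in>{1..q}. real (gcd q j) * sqrt (real q / real j)) \<le> 2 * real q * card {d. d dvd q}"
proof -
  have "(\<Sum>j\<in>{1..q}. real (gcd q j) * sqrt (real q / real j)) \<le>
      (\<Sum>d | d dvd q. \<Sum>i\<in>{1..q div d}. real d * sqrt (real q / real (d * i)))"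
    using q by (intro sum_gcd_le[of q "\<lambda>d j. real d * sqrt (real q / real j)"]) auto
  also have "\<dots> \<le> (\<Sum>d | d dvd q. 2 * real q)"
  proof (rule sum_mono)
    fix d assume "d \<in> {d. d dvd q}"
    then obtain e where e: "q = d * e" "d > 0" using q by (auto intro: Nat.gr0I)
    have "(\<Sum>i\<in>{1..q div d}. real d * sqrt (real q / real (d * i))) = d * (sqrt e * (\<Sum>i\<in>{1..e}. 1 / sqrt i))"
      using e by (simp add: real_sqrt_divide sum_distrib_left)
    also have "\<dots> \<le> d * (sqrt e * (2 * sqrt e))"
      by (intro mult_left_mono sum_inverse_sqrt_le) auto
    also have "\<dots> = 2 * real q" using e by simp
    finally show "(\<Sum>i\<in>{1..q div d}. real d * sqrt (real q / real (d * i))) \<le> 2 * real q" .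
  qed
  also have "\<dots> = 2 * real q * card {d. d dvd q}" by simp
  finally show ?thesis .
qed

lemma sum_gcd_square_le:
  fixes q :: nat
  assumes q: "q > 0"
  shows "(\<Sum>j\<in>{1..q}. (real (gcd q j) / real q)\<^sup>2) \<le> (\<Sum>d | d dvd q. real d / real q)"
proof -
  have "(\<Sum>j\<in>{1..q}. (real (gcd q j) / real q)\<^sup>2) \<le> (\<Sum>d | d dvd q. \<Sum>i\<in>{1..q div d}. (real d / real q)\<^sup>2)"
    using q by (intro sum_gcd_le[of q "\<lambda>d j. (real d / real q)\<^sup>2"]) auto
  also have "\<dots> = (\<Sum>d | d dvd q. real d / real q)"
  proof (rule sum.cong)
    fix d assume "d \<in> {d. d dvd q}"
    then obtain e where e: "q = d * e" by auto
    with q have "d > 0" "e > 0" by auto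
    with e show "(\<Sum>i\<in>{1..q div d}. (real d / real q)\<^sup>2) = real d / real q"
      by (simp add: power2_eq_square)
  qed simp
  finally show ?thesis .
qed

text \<open>A weight attached to the larger index alone, so that its sum over a block is additive in
  the block. The constant 160 is 40 times 2 from the square root sum times 2 from the two orders of
  a pair.\<close>

definition var_bound :: "real \<Rightarrow> nat \<Rightarrow> real" where
  "var_bound b q = 160 * b * card {d. d dvd q} / q + 2 * region_prob (b / q) * (\<Sum>d | d dvd q. real d / real q)"

lemma sum_cov_bound_le:
  assumes b: "0 < b" and q: "0 < q"
  shows "2 * (\<Sum>j\<in>{1..q}. cov_bound b q j) \<le> var_bound b q"
proof -
  have "(\<Sum>j\<in>{1..q}. cov_bound b q j) =
     40 * b / (real q)\<^sup>2 * (\<Sum>j\<in>{1..q}. real (gcd q j) * sqrt (real q / real j)) +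
       region_prob (b / q) * (\<Sum>j\<in>{1..q}. (real (gcd q j) / real q)\<^sup>2)"
    unfolding cov_bound_def sum.distrib sum_distrib_left
    by (intro arg_cong2[where f = "(+)"] sum.cong) (auto simp: power2_eq_square)
  also have "\<dots> \<le> 40 * b / (real q)\<^sup>2 * (2 * real q * card {d. d dvd q}) + region_prob (b / q) * (\<Sum>d | d dvd q. real d / real q)"
    using b q by (intro add_mono mult_left_mono sum_gcd_sqrt_le sum_gcd_square_le region_prob_nonneg) auto
  also have "40 * b / (real q)\<^sup>2 * (2 * real q * card {d. d dvd q}) = 80 * b * card {d. d dvd q} / q"
    using q by (simp add: power2_eq_square)
  finally show ?thesis by (simp add: var_bound_def)
qed

definition disc :: "real \<Rightarrow> nat set \<Rightarrow> real \<times> real \<Rightarrow> real" where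
  "disc b I x = (\<Sum>q\<in>I. indicator (region b q) x - region_prob (b / q))"

lemma measurable_disc [measurable]: "disc b I \<in> borel_measurable (borel \<Otimes>\<^sub>M borel)"
  unfolding disc_def by measurable

lemma integrable_disc_sq: "finite I \<Longrightarrow> integrable (unit_square a a') (\<lambda>x. (disc b I x)\<^sup>2)"
proof -
  assume "finite I"
  interpret prob_space "unit_square a a'" by (rule prob_space_unit_square)
  have "\<bar>disc b I x\<bar> \<le> (\<Sum>q\<in>I. 1 + \<bar>region_prob (b / q)\<bar>)" for x
    unfolding disc_def by (rule order_trans[OF sum_abs], rule sum_mono) (auto simp: indicator_def)
  then have "\<bar>disc b I x\<bar>\<^sup>2 \<le> (\<Sum>q\<in>I. 1 + \<bar>region_prob (b / q)\<bar>)\<^sup>2" for x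
    by (intro power_mono) auto
  then show ?thesis
    by (intro integrable_const_bound[where B = "(\<Sum>q\<in>I. 1 + \<bar>region_prob (b / q)\<bar>)\<^sup>2"]) auto
qed

text \<open>The inner sum over smaller members of \<open>I\<close> is enlarged to all of
  \<open>{1..i}\<close>. This loses the cancellation of scale inside short blocks but produces a
  bound additive in \<open>I\<close>, as the dyadic argument needs.\<close>

lemma expectation_disc_sq_le:
  assumes b: "0 < b" and I: "finite I" "0 \<notin> I"
  shows "(\<integral>x. (disc b I x)\<^sup>2 \<partial>unit_square a a') \<le> (\<Sum>q\<in>I. var_bound b q)"
proof -
  interpret prob_space "unit_square a a'" by (rule prob_space_unit_square)
  have pos: "q > 0" if "q \<in> I" for q using that I(2) by (cases q) auto
  have "(\<integral>x. (disc b I x)\<^sup>2 \<partial>unit_square a a') = (\<integral>x. (\<Sum>q\<in>I. indicator (region b q) x - prob (region b q))\<^sup>2 \<partial>unit_square a a')"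
    unfolding disc_def using b pos by (simp add: measure_region)
  also have "\<dots> \<le> 2 * (\<Sum>i\<in>I. \<Sum>j\<in>{j\<in>I. j \<le> i}. cov_bound b i j)"
    using b pos measure_region_Int_le[OF b] by (intro expectation_sum_indicator_sq_le I) (auto simp: measure_region cov_bound_nonneg)
  also have "\<dots> \<le> (\<Sum>i\<in>I. 2 * (\<Sum>j\<in>{1..i}. cov_bound b i j))"
    unfolding sum_distrib_left[of 2 "\<lambda>i. \<Sum>j\<in>{j\<in>I. j \<le> i}. cov_bound b i j"]
  proof (intro sum_mono mult_left_mono sum_mono2)
    fix i assume "i \<in> I"
    show "{j\<in>I. j \<le> i} \<subseteq> {1..i}" using pos by (auto simp: Suc_le_eq)
    show "0 \<le> cov_bound b i j" for j using cov_bound_nonneg[OF b pos[OF \<open>i \<in> I\<close>]] .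
  qed auto
  also have "\<dots> \<le> (\<Sum>q\<in>I. var_bound b q)"
    by (intro sum_mono sum_cov_bound_le b pos)
  finally show ?thesis .
qed

text \<open>A divisor pair is a factorisation \<open>q = d * e\<close> with both factors at most
  \<open>N\<close>; letting them range independently makes the double sum factor.\<close>

lemma sum_divisors_le:
  fixes G :: "nat \<Rightarrow> nat \<Rightarrow> real"
  assumes "\<And>q d. 0 \<le> G q d"
  shows "(\<Sum>q\<in>{1..N}. \<Sum>d | d dvd q. G q d) \<le> (\<Sum>d\<in>{1..N}. \<Sum>e\<in>{1..N}. G (d * e) d)"
proof -
  have "(\<Sum>q\<in>{1..N}. \<Sum>d | d dvd q. G q d) = (\<Sum>(q, d)\<in>(SIGMA q:{1..N}. {d. d dvd q}). G q d)"
    by (intro sum.Sigma) auto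
  also have "\<dots> \<le> (\<Sum>(q, d)\<in>(\<lambda>(d, e). (d * e, d)) ` ({1..N} \<times> {1..N}). G q d)"
  proof (rule sum_mono2)
    show "(SIGMA q:{1..N}. {d. d dvd q}) \<subseteq> (\<lambda>(d, e). (d * e, d)) ` ({1..N} \<times> {1..N})"
    proof clarify
      fix q d assume q: "q \<in> {1..N}" "d dvd q"
      then obtain e where e: "q = d * e" by auto
      with q have "d \<ge> 1" "e \<ge> 1" by (auto simp: Suc_le_eq intro: Nat.gr0I)
      moreover from this e have "d \<le> q" "e \<le> q" by auto
      then have "d \<le> N" "e \<le> N" using q by auto
      ultimately show "(q, d) \<in> (\<lambda>(d, e). (d * e, d)) ` ({1..N} \<times> {1..N})"
        using q e by (intro image_eqI[of _ _ "(d, e)"]) auto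
    qed
  qed (use assms in auto)
  also have "\<dots> = (\<Sum>(d, e)\<in>{1..N} \<times> {1..N}. G (d * e) d)"
    by (subst sum.reindex) (auto simp: inj_on_def case_prod_unfold)
  also have "\<dots> = (\<Sum>d\<in>{1..N}. \<Sum>e\<in>{1..N}. G (d * e) d)"
    by (rule sum.cartesian_product[symmetric])
  finally show ?thesis .
qed

lemma sum_inverse_squares_le: "(\<Sum>e\<in>{1..N::nat}. 1 / (real e)\<^sup>2) \<le> 2"
proof -
  have *: "(\<Sum>e\<in>{1..Suc n}. 1 / (real e)\<^sup>2) \<le> 2 - 1 / real (Suc n)" for n
  proof (induction n)
    case (Suc n)
    have "1 / (real (Suc (Suc n)))\<^sup>2 \<le> 1 / (real (Suc n) * real (Suc (Suc n)))"
      unfolding power2_eq_square by (intro divide_left_mono mult_right_mono mult_pos_pos) auto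
    also have "\<dots> = 1 / real (Suc n) - 1 / real (Suc (Suc n))"
      by (simp add: diff_frac_eq)
    finally show ?case using Suc.IH by (subst sum.cl_ivl_Suc) simp
  qed simp
  show ?thesis
  proof (cases N)
    case (Suc n)
    have "(0::real) \<le> 1 / real (Suc n)" by simp
    with *[of n] show ?thesis unfolding Suc by linarith
  qed simp
qed

lemma sum_inverse_le: "(\<Sum>e\<in>{1..N}. 1 / real e) \<le> 1 + ln (real (max 1 N))"
proof (cases N)
  case (Suc n)
  have "(\<Sum>e\<in>{1..Suc n}. 1 / real e) \<le> 1 + ln (real (Suc n))" for n
  proof (induction n)
    case (Suc n)
    have "1 / real (Suc (Suc n)) \<le> ln (real (Suc (Suc n))) - ln (real (Suc n))"
      using ln_diff_le[of "real (Suc n)" "real (Suc (Suc n))"] by (simp add: field_simps)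
    with Suc.IH show ?case by (subst sum.cl_ivl_Suc) simp
  qed simp
  with Suc show ?thesis by (simp add: max_def)
qed simp

text \<open>The divisor count divided by \<open>q\<close> sums to at most a squared harmonic sum. In
  the other part \<open>region_prob\<close> contributes a logarithm of size \<open>K\<close>, while
  the weights \<open>d / q\<^sup>2\<close> split into a harmonic sum times a convergent one. Both
  parts are of order \<open>b * K\<^sup>2\<close>.\<close>

lemma sum_var_bound_le:
  fixes K b :: real and N :: nat
  assumes b: "0 < b" and K: "1 \<le> K" "exp (- 2 * K) \<le> b" and N: "real N \<le> exp K"
  shows "(\<Sum>q\<in>{1..N}. var_bound b q) \<le> 900 * b * K\<^sup>2"
proof -
  define H where "H = (\<Sum>e\<in>{1..N}. 1 / real e)"
  have "ln (real (max 1 N)) \<le> K"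
  proof -
    have "real (max 1 N) \<le> exp K" using N K by (simp add: max_def)
    then have "ln (real (max 1 N)) \<le> ln (exp K)" by (subst ln_le_cancel_iff) auto
    thus ?thesis by simp
  qed
  then have H: "H \<le> 1 + K" "0 \<le> H" using sum_inverse_le[of N] by (auto simp: H_def intro: sum_nonneg)
  have "(\<Sum>q\<in>{1..N}. var_bound b q) \<le>
     (\<Sum>q\<in>{1..N}. \<Sum>d | d dvd q. 160 * b / q + 24 * b * K * (d / (real q)\<^sup>2))"
  proof (rule sum_mono)
    fix q assume q: "q \<in> {1..N}"
    \<comment> \<open>Below the cap the logarithmic factor is \<open>1 - ln 4 + ln q - ln b\<close>,
      where \<open>ln q \<le> K\<close> and \<open>- ln b \<le> 2 * K\<close>; hence
      \<open>3 * K\<close>.\<close>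
    have "region_prob (b / q) \<le> 4 * (b / q) * (3 * K)"
    proof (cases "b / q \<ge> 1 / 4")
      case True
      have "1 \<le> 4 * (b / q)" "1 \<le> 3 * K" using True K by linarith+
      then have "1 * 1 \<le> 4 * (b / q) * (3 * K)" by (intro mult_mono) linarith+
      with True show ?thesis by (simp add: region_prob_def)
    next
      case False
      have "b / q > 0" using b q by auto
      have "ln (q / (4 * b)) = ln q - ln 4 - ln b"
        using b q by (simp add: ln_div ln_mult)
      moreover have "ln q \<le> ln (exp K)" using q N by (subst ln_le_cancel_iff) auto
      then have "ln q \<le> K" by simp
      moreover have "- 2 * K \<le> ln b" using K(2) b by (simp add: ln_ge_iff)
      moreover have "1 \<le> ln (4::real)" using exp_le by (simp add: ln_ge_iff)
      moreover have "ln (4 * (b / q)) = - ln (q / (4 * b))"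
        using b q by (simp add: ln_div ln_mult)
      ultimately have "1 - ln (4 * (b / q)) \<le> 3 * K" by linarith
      then have "4 * (b / q) * (1 - ln (4 * (b / q))) \<le> 4 * (b / q) * (3 * K)"
        using \<open>b / q > 0\<close> by (intro mult_left_mono) auto
      with False show ?thesis by (simp add: region_prob_def)
    qed
    then have "2 * region_prob (b / q) * (\<Sum>d | d dvd q. real d / real q) \<le> 2 * (4 * (b / q) * (3 * K)) * (\<Sum>d | d dvd q. real d / real q)"
      by (intro mult_right_mono sum_nonneg mult_left_mono) auto
    also have "\<dots> = (\<Sum>d | d dvd q. 24 * b * K * (d / (real q)\<^sup>2))"
      unfolding sum_distrib_left by (intro sum.cong refl) (simp add: power2_eq_square)
    finally show "var_bound b q \<le> (\<Sum>d | d dvd q. 160 * b / q + 24 * b * K * (d / (real q)\<^sup>2))"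
      by (simp add: var_bound_def sum.distrib mult.commute)
  qed
  also have "\<dots> \<le> (\<Sum>d\<in>{1..N}. \<Sum>e\<in>{1..N}. 160 * b / real (d * e) + 24 * b * K * (d / (real (d * e))\<^sup>2))"
    using b K by (intro sum_divisors_le[of "\<lambda>q d. 160 * b / real q + 24 * b * K * (d / (real q)\<^sup>2)"]) auto
  also have "\<dots> = (\<Sum>d\<in>{1..N}. \<Sum>e\<in>{1..N}. 160 * b * (1 / d * (1 / e)) + 24 * b * K * (1 / d * (1 / (real e)\<^sup>2)))"
    by (intro sum.cong refl) (simp add: power2_eq_square)
  also have "\<dots> = 160 * b * (H * H) + 24 * b * K * (H * (\<Sum>e\<in>{1..N}. 1 / (real e)\<^sup>2))"
    unfolding H_def sum_product by (simp add: sum.distrib sum_distrib_left)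
  also have "\<dots> \<le> 160 * b * ((1 + K) * (1 + K)) + 24 * b * K * ((1 + K) * 2)"
    using H b K by (intro add_mono mult_left_mono mult_mono sum_inverse_squares_le) (auto intro: sum_nonneg)
  also have "\<dots> \<le> 160 * b * (2 * K * (2 * K)) + 24 * b * K * (2 * K * 2)"
    using b K by (intro add_mono mult_left_mono mult_mono mult_right_mono) auto
  also have "\<dots> \<le> 900 * b * K\<^sup>2"
    using b K by (simp add: power2_eq_square)
  finally show ?thesis .
qed

section \<open>The maximal inequality\<close>

text \<open>A recursive form of the Rademacher--Menshov decomposition: \<open>f s t\<close> is the sum of a sequence
  over the indices in \<open>{s..<t}\<close>, and the squares of the sums over all dyadic blocks are added up.\<close>

primrec dyadic_sq :: "nat \<Rightarrow> (nat \<Rightarrow> nat \<Rightarrow> real) \<Rightarrow> nat \<Rightarrow> real" where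
  "dyadic_sq 0 f s = (f s (Suc s))\<^sup>2"
| "dyadic_sq (Suc m) f s = (f s (s + 2 ^ Suc m))\<^sup>2 + dyadic_sq m f s + dyadic_sq m f (s + 2 ^ m)"

lemma dyadic_sq_nonneg: "0 \<le> dyadic_sq m f s"
  by (induction m arbitrary: s) auto

lemma sq_block_le_dyadic_sq: "(f s (s + 2 ^ m))\<^sup>2 \<le> dyadic_sq m f s"
  using dyadic_sq_nonneg by (cases m) (auto intro!: add_increasing2 add_nonneg_nonneg)

text \<open>An initial segment longer than half the block is the first half followed by an initial
  segment of the second. Weighting the two pieces unequally makes the constant grow by one per level
  instead of doubling.\<close>

lemma sq_le_dyadic_sq:
  assumes add: "\<And>s t u. s \<le> t \<Longrightarrow> t \<le> u \<Longrightarrow> f s u = f s t + f t u"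
  shows "k \<le> 2 ^ m \<Longrightarrow> (f s (s + k))\<^sup>2 \<le> (real m + 1) * dyadic_sq m f s"
proof (induction m arbitrary: s k)
  case 0
  have "f s s = 0" using add[of s s s] by simp
  moreover have "k = 0 \<or> k = 1" using 0 by auto
  ultimately show ?case by auto
next
  case (Suc m)
  let ?D = "dyadic_sq m f"
  have step: "(real m + 2) * (?D s + ?D (s + 2 ^ m)) \<le> (real (Suc m) + 1) * dyadic_sq (Suc m) f s"
    by (simp add: mult_left_mono add.commute)
  show ?case
  proof (cases "k \<le> 2 ^ m")
    case True
    have "(f s (s + k))\<^sup>2 \<le> (real m + 1) * ?D s" by (rule Suc.IH[OF True])
    also have "\<dots> \<le> (real m + 2) * (?D s + ?D (s + 2 ^ m))"
      using dyadic_sq_nonneg[of m f] by (intro mult_mono) auto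
    finally show ?thesis using step by linarith
  next
    case False
    define A where "A = f s (s + 2 ^ m)"
    define B where "B = f (s + 2 ^ m) (s + k)"
    have AB: "f s (s + k) = A + B"
      unfolding A_def B_def using False by (intro add) auto
    have A: "A\<^sup>2 \<le> ?D s" unfolding A_def by (rule sq_block_le_dyadic_sq)
    have B: "B\<^sup>2 \<le> (real m + 1) * ?D (s + 2 ^ m)"
      using Suc.IH[of "k - 2 ^ m" "s + 2 ^ m"] False Suc.prems by (simp add: B_def)
    \<comment> \<open>Weighted Cauchy-Schwarz: this square is exactly the difference of the two
      sides of the next inequality.\<close>
    have "0 \<le> ((real m + 1) * A - B)\<^sup>2" by simp
    then have "(real m + 1) * (A + B)\<^sup>2 \<le> (real m + 2) * ((real m + 1) * A\<^sup>2 + B\<^sup>2)"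
      by (simp add: power2_eq_square algebra_simps)
    also have "\<dots> \<le> (real m + 2) * ((real m + 1) * ?D s + (real m + 1) * ?D (s + 2 ^ m))"
      using A B by (intro mult_left_mono add_mono) auto
    also have "\<dots> = (real m + 1) * ((real m + 2) * (?D s + ?D (s + 2 ^ m)))"
      by (simp add: algebra_simps)
    finally have "(A + B)\<^sup>2 \<le> (real m + 2) * (?D s + ?D (s + 2 ^ m))"
      by (rule mult_left_le_imp_le) simp
    then show ?thesis using step AB by simp
  qed
qed

section \<open>Blocks on the exponential scale\<close>

definition ceil_exp :: "nat \<Rightarrow> nat" where
  "ceil_exp k = nat \<lceil>exp (real k)\<rceil>"

text \<open>Because of the ceiling, half-open blocks between values of \<open>ceil_exp\<close> match
  strict real bounds on \<open>q\<close> with no boundary correction.\<close>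

lemma less_ceil_exp_iff: "q < ceil_exp k \<longleftrightarrow> real q < exp (real k)"
  by (simp add: ceil_exp_def zless_nat_eq_int_zless less_ceiling_iff)

lemma ceil_exp_0 [simp]: "ceil_exp 0 = 1"
  by (simp add: ceil_exp_def)

lemma ceil_exp_mono: "k \<le> l \<Longrightarrow> ceil_exp k \<le> ceil_exp l"
  unfolding ceil_exp_def by (intro nat_mono ceiling_mono) simp

lemma ceil_exp_ge_1: "1 \<le> ceil_exp k"
  using ceil_exp_mono[of 0 k] by simp

definition dyadic_disc :: "nat \<Rightarrow> real \<Rightarrow> nat \<Rightarrow> real \<times> real \<Rightarrow> real" where
  "dyadic_disc m b s x = dyadic_sq m (\<lambda>s t. disc b {ceil_exp s..<ceil_exp t} x) s"

lemma disc_sq_le_dyadic_disc: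
  assumes "k \<le> 2 ^ m"
  shows "(disc b {1..<ceil_exp k} x)\<^sup>2 \<le> (real m + 1) * dyadic_disc m b 0 x"
proof -
  have "(disc b {ceil_exp 0..<ceil_exp (0 + k)} x)\<^sup>2 \<le> (real m + 1) * dyadic_disc m b 0 x"
    unfolding dyadic_disc_def
  proof (rule sq_le_dyadic_sq[OF _ assms])
    fix s t u :: nat assume "s \<le> t" "t \<le> u"
    then show "disc b {ceil_exp s..<ceil_exp u} x = disc b {ceil_exp s..<ceil_exp t} x + disc b {ceil_exp t..<ceil_exp u} x"
      unfolding disc_def by (intro sum.atLeastLessThan_concat[symmetric] ceil_exp_mono)
  qed
  thus ?thesis by simp
qed

lemma integrable_dyadic_disc: "integrable (unit_square a a') (dyadic_disc m b s)"
proof (induction m arbitrary: s)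
  case 0
  then show ?case
    using integrable_disc_sq[of "{ceil_exp s..<ceil_exp (Suc s)}"] by (simp add: dyadic_disc_def[abs_def])
next
  case (Suc m)
  have "integrable (unit_square a a') (\<lambda>x. (disc b {ceil_exp s..<ceil_exp (s + 2 ^ Suc m)} x)\<^sup>2 + dyadic_disc m b s x + dyadic_disc m b (s + 2 ^ m) x)"
    by (intro Bochner_Integration.integrable_add integrable_disc_sq Suc.IH) simp
  then show ?case by (simp add: dyadic_disc_def[abs_def])
qed

text \<open>Each of the \<open>m + 1\<close> levels of the dyadic tree partitions the whole range,
  and the additive weight makes every level cost the same total.\<close>

lemma expectation_dyadic_disc_le:
  assumes b: "0 < b"
  shows "(\<integral>x. dyadic_disc m b s x \<partial>unit_square a a') \<le> (real m + 1) * (\<Sum>q\<in>{ceil_exp s..<ceil_exp (s + 2 ^ m)}. var_bound b q)"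
proof (induction m arbitrary: s)
  case 0
  then show ?case
    using expectation_disc_sq_le[OF b, of "{ceil_exp s..<ceil_exp (Suc s)}" a a'] ceil_exp_ge_1[of s]
    by (simp add: dyadic_disc_def)
next
  case (Suc m)
  let ?V = "\<lambda>s t. \<Sum>q\<in>{ceil_exp s..<ceil_exp t}. var_bound b q"
  have split: "?V s (s + 2 ^ Suc m) = ?V s (s + 2 ^ m) + ?V (s + 2 ^ m) (s + 2 ^ m + 2 ^ m)"
    by (subst sum.atLeastLessThan_concat) (auto intro!: ceil_exp_mono simp: add.assoc mult_2)
  have "(\<integral>x. dyadic_disc (Suc m) b s x \<partial>unit_square a a') =
    (\<integral>x. (disc b {ceil_exp s..<ceil_exp (s + 2 ^ Suc m)} x)\<^sup>2 + dyadic_disc m b s x + dyadic_disc m b (s + 2 ^ m) x \<partial>unit_square a a')"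
    by (simp add: dyadic_disc_def)
  also have "\<dots> = (\<integral>x. (disc b {ceil_exp s..<ceil_exp (s + 2 ^ Suc m)} x)\<^sup>2 \<partial>unit_square a a') +
      (\<integral>x. dyadic_disc m b s x \<partial>unit_square a a') + (\<integral>x. dyadic_disc m b (s + 2 ^ m) x \<partial>unit_square a a')"
    by (simp add: integrable_dyadic_disc integrable_disc_sq)
  also have "\<dots> \<le> ?V s (s + 2 ^ Suc m) + (real m + 1) * ?V s (s + 2 ^ m) + (real m + 1) * ?V (s + 2 ^ m) (s + 2 ^ m + 2 ^ m)"
    using ceil_exp_ge_1[of s] by (intro add_mono Suc.IH expectation_disc_sq_le b) auto
  also have "\<dots> = (real (Suc m) + 1) * ?V s (s + 2 ^ Suc m)"
    unfolding split by (simp add: algebra_simps)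
  finally show ?case .
qed

section \<open>The grid of levels and the normalised error\<close>

definition grid :: "real \<Rightarrow> nat \<Rightarrow> nat \<Rightarrow> real" where
  "grid \<eta> m j = ((real j + 1) / 2 ^ m) powr \<eta>"

text \<open>Up to the power of \<open>m\<close>, the target error at scale \<open>K\<close> and
  level \<open>b\<close>.\<close>

definition err :: "real \<Rightarrow> real \<Rightarrow> real \<Rightarrow> real" where
  "err \<eta> K b = b powr (1 - 1 / \<eta>) * K + b powr (2 / \<eta>) * K\<^sup>2"

lemma grid_pos: "0 < grid \<eta> m j"
  by (simp add: grid_def add_nonneg_pos)

lemma err_pos: "0 < b \<Longrightarrow> 0 < K \<Longrightarrow> 0 < err \<eta> K b"
  by (auto simp: err_def intro!: add_pos_pos mult_pos_pos)

lemma expectation_dyadic_disc_grid_le: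
  assumes \<eta>: "1 < \<eta>" "\<eta> < 2"
  shows "(\<integral>x. dyadic_disc m (grid \<eta> m j) 0 x \<partial>unit_square a a') \<le> (real m + 1) * (900 * grid \<eta> m j * (2 ^ m)\<^sup>2)"
proof -
  define K where "K = (2::real) ^ m"
  have K: "1 \<le> K" by (simp add: K_def)
  \<comment> \<open>The lowest level is \<open>(1 / K) powr \<eta>\<close>, which is at least the
    square of \<open>1 / K\<close> as \<eta> < 2, and \<open>K \<le> exp K\<close>.\<close>
  have "exp (- 2 * K) \<le> grid \<eta> m j"
  proof -
    have "exp (- 2 * K) = (exp (- K)) powr 2" by (simp add: exp_powr_real)
    also have "\<dots> \<le> (1 / K) powr 2"
    proof (rule powr_mono2)
      have "K \<le> exp K" using exp_ge_add_one_self[of K] by linarith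
      then show "exp (- K) \<le> 1 / K" using K by (simp add: exp_minus field_simps)
    qed auto
    also have "\<dots> \<le> (1 / K) powr \<eta>" using \<eta> K by (intro powr_mono') auto
    also have "\<dots> \<le> grid \<eta> m j"
      unfolding grid_def K_def using \<eta> by (intro powr_mono2 divide_right_mono) auto
    finally show ?thesis .
  qed
  have "(\<integral>x. dyadic_disc m (grid \<eta> m j) 0 x \<partial>unit_square a a') \<le> (real m + 1) * (\<Sum>q\<in>{ceil_exp 0..<ceil_exp (0 + 2 ^ m)}. var_bound (grid \<eta> m j) q)"
    by (rule expectation_dyadic_disc_le[OF grid_pos])
  also have "{ceil_exp 0..<ceil_exp (0 + 2 ^ m)} = {1..ceil_exp (2 ^ m) - 1}"
    using ceil_exp_ge_1[of "2 ^ m"] by auto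
  also have "(\<Sum>q\<in>{1..ceil_exp (2 ^ m) - 1}. var_bound (grid \<eta> m j) q) \<le> 900 * grid \<eta> m j * K\<^sup>2"
  proof (rule sum_var_bound_le[OF grid_pos K])
    have "ceil_exp (2 ^ m) - 1 < ceil_exp (2 ^ m)" using ceil_exp_ge_1[of "2 ^ m"] by simp
    then show "real (ceil_exp (2 ^ m) - 1) \<le> exp K" unfolding less_ceil_exp_iff by (simp add: K_def)
  qed fact
  finally show ?thesis by (simp add: K_def mult_left_mono)
qed

text \<open>Since \<open>p \<ge> 1\<close>, replacing one factor \<open>y powr (p - 1)\<close> by
  \<open>x powr (p - 1)\<close> only enlarges \<open>y powr p\<close>. The chord slope is thus
  compared with a power of the right end point.\<close>

lemma powr_diff_ge:
  fixes x y p :: real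
  assumes "0 \<le> y" "y \<le> x" "0 < x" "1 \<le> p"
  shows "(x - y) * x powr (p - 1) \<le> x powr p - y powr p"
proof -
  have "y powr p = y * y powr (p - 1)"
    using assms powr_mult_base[of y "p - 1"] by simp
  also have "\<dots> \<le> y * x powr (p - 1)"
    using assms by (intro mult_left_mono powr_mono2) auto
  finally have "y powr p \<le> y * x powr (p - 1)" .
  moreover have "x powr p = x * x powr (p - 1)"
    using assms powr_mult_base[of x "p - 1"] by simp
  ultimately show ?thesis by (simp add: left_diff_distrib)
qed

text \<open>With \<open>x = (j + 1) / K\<close> and \<open>p = 3 - \<eta>\<close> the summand is \<open>x powr (p - 1) / (1 + K * x powr p)\<^sup>2\<close>,
  which is dominated by the increment of \<open>- 1 / (1 + K * x powr p)\<close> over a step of length \<open>1 / K\<close>.\<close>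

lemma sum_grid_le:
  assumes \<eta>: "1 < \<eta>" "\<eta> < 2"
  shows "(\<Sum>j<n. grid \<eta> m j * (2 ^ m)\<^sup>2 / (err \<eta> (2 ^ m) (grid \<eta> m j))\<^sup>2) \<le> 1"
proof -
  define K where "K = (2::real) ^ m"
  define p where "p = 3 - \<eta>"
  define g where "g = (\<lambda>j::nat. 1 / (1 + K * (real j / K) powr p))"
  have K: "0 < K" by (simp add: K_def)
  have "grid \<eta> m j * K\<^sup>2 / (err \<eta> K (grid \<eta> m j))\<^sup>2 \<le> g j - g (Suc j)" for j
  proof -
    define x where "x = (real j + 1) / K"
    define y where "y = real j / K"
    have x: "0 < x" using K by (simp add: x_def)
    have y: "0 \<le> y" "y \<le> x" using K by (auto simp: x_def y_def divide_right_mono)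
    have u: "0 < 1 + K * x powr p" "0 < 1 + K * y powr p" using K by (auto intro!: add_pos_nonneg)
    have "err \<eta> K (grid \<eta> m j) = x powr (\<eta> - 1) * K + x powr 2 * K\<^sup>2"
      using \<eta> by (simp add: err_def grid_def x_def K_def powr_powr algebra_simps)
    also have "x powr 2 = x powr (\<eta> - 1) * x powr p"
      by (simp add: p_def powr_add[symmetric])
    also have "x powr (\<eta> - 1) * K + x powr (\<eta> - 1) * x powr p * K\<^sup>2 = x powr (\<eta> - 1) * K * (1 + K * x powr p)"
      by (simp add: algebra_simps power2_eq_square)
    finally have err: "err \<eta> K (grid \<eta> m j) = x powr (\<eta> - 1) * K * (1 + K * x powr p)" .
    have "grid \<eta> m j * K\<^sup>2 / (err \<eta> K (grid \<eta> m j))\<^sup>2 = x powr \<eta> / (x powr (\<eta> - 1))\<^sup>2 / (1 + K * x powr p)\<^sup>2"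
      unfolding err using K by (simp add: grid_def x_def K_def power_mult_distrib)
    also have "x powr \<eta> / (x powr (\<eta> - 1))\<^sup>2 = x powr (p - 1)"
      using x by (simp add: power2_eq_square p_def powr_add[symmetric] powr_diff[symmetric])
    also have "x powr (p - 1) / (1 + K * x powr p)\<^sup>2 \<le> (K * x powr p - K * y powr p) / (1 + K * x powr p)\<^sup>2"
    proof (rule divide_right_mono)
      have "(x - y) * x powr (p - 1) \<le> x powr p - y powr p"
        using x y \<eta> by (intro powr_diff_ge) (auto simp: p_def)
      then have "K * ((x - y) * x powr (p - 1)) \<le> K * (x powr p - y powr p)"
        using K by (intro mult_left_mono) auto
      moreover have "K * (x - y) = 1" using K by (simp add: x_def y_def diff_divide_distrib[symmetric])
      ultimately show "x powr (p - 1) \<le> K * x powr p - K * y powr p"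
        by (simp add: right_diff_distrib mult.assoc[symmetric])
    qed simp
    \<comment> \<open>One of the two equal denominators is lowered to its value at \<open>y\<close>,
      after which the fraction telescopes.\<close>
    also have "\<dots> \<le> (K * x powr p - K * y powr p) / ((1 + K * x powr p) * (1 + K * y powr p))"
      unfolding power2_eq_square
      using K x y u \<eta> by (intro divide_left_mono mult_left_mono mult_pos_pos) (auto simp: p_def intro!: powr_mono2)
    also have "\<dots> = 1 / (1 + K * y powr p) - 1 / (1 + K * x powr p)"
      using u by (subst diff_frac_eq) auto
    also have "\<dots> = g j - g (Suc j)"
      by (simp add: g_def x_def y_def add.commute)
    finally show ?thesis .
  qed
  then have "(\<Sum>j<n. grid \<eta> m j * K\<^sup>2 / (err \<eta> K (grid \<eta> m j))\<^sup>2) \<le> (\<Sum>j<n. g j - g (Suc j))"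
    by (intro sum_mono)
  also have "\<dots> = g 0 - g n" by (rule sum_lessThan_telescope')
  also have "\<dots> \<le> 1"
  proof -
    have "0 \<le> g n" using K by (auto simp: g_def intro!: divide_nonneg_nonneg add_nonneg_nonneg)
    thus ?thesis by (simp add: g_def)
  qed
  finally show ?thesis by (simp add: K_def)
qed

text \<open>The normalised dyadic sums, added over all \<open>m\<close> and \<open>j\<close>, have
  finite integral. Almost everywhere the total is therefore a finite \<open>c\<close>, and being a
  sum of nonnegative terms it bounds each of them; this gives one constant for all scales and
  levels.\<close>

lemma AE_unit_square_disc_bound:
  assumes \<eta>: "1 < \<eta>" "\<eta> < 2"
  shows "AE x in unit_square a a'. \<exists>C>0. \<forall>m j k. k \<le> 2 ^ m \<longrightarrow>
    \<bar>disc (grid \<eta> m j) {1..<ceil_exp k} x\<bar> \<le> C * (real m + 1)\<^sup>2 * err \<eta> (2 ^ m) (grid \<eta> m j)"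
proof -
  \<comment> \<open>Of the three factors \<open>m + 1\<close>, one pays for the dyadic levels in the
    expectation and two leave the summable \<open>1 / (m + 1)\<^sup>2\<close>. The pointwise maximal
    bound adds a fourth, so the square root is \<open>(m + 1)\<^sup>2\<close>.\<close>
  define w where "w = (\<lambda>m j. (real m + 1) ^ 3 * (err \<eta> (2 ^ m) (grid \<eta> m j))\<^sup>2)"
  define F where "F = (\<lambda>m j x. ennreal (dyadic_disc m (grid \<eta> m j) 0 x / w m j))"
  have err0: "0 < err \<eta> (2 ^ m) (grid \<eta> m j)" for m j
    by (intro err_pos grid_pos) simp
  then have w: "0 < w m j" for m j
    by (auto simp: w_def intro!: mult_pos_pos zero_less_power)
  have D0: "0 \<le> dyadic_disc m b s x" for m b s x
    by (simp add: dyadic_disc_def dyadic_sq_nonneg)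
  have [measurable]: "dyadic_disc m b s \<in> borel_measurable (borel \<Otimes>\<^sub>M borel)" for m b s
    using borel_measurable_integrable[OF integrable_dyadic_disc[of a a' m b s]] by simp
  have FM [measurable]: "F m j \<in> borel_measurable (unit_square a a')" for m j
    unfolding F_def by measurable
  have intF: "(\<integral>\<^sup>+x. F m j x \<partial>unit_square a a') \<le>
      ennreal (900 / (real m + 1)\<^sup>2) * ennreal (grid \<eta> m j * (2 ^ m)\<^sup>2 / (err \<eta> (2 ^ m) (grid \<eta> m j))\<^sup>2)" for m j
  proof -
    have "(\<integral>\<^sup>+x. F m j x \<partial>unit_square a a') = ennreal (\<integral>x. dyadic_disc m (grid \<eta> m j) 0 x / w m j \<partial>unit_square a a')"
      unfolding F_def using D0 w by (intro nn_integral_eq_integral integrable_divide integrable_dyadic_disc) (auto intro!: AE_I2 divide_nonneg_pos)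
    also have "(\<integral>x. dyadic_disc m (grid \<eta> m j) 0 x / w m j \<partial>unit_square a a') = (\<integral>x. dyadic_disc m (grid \<eta> m j) 0 x \<partial>unit_square a a') / w m j"
      by simp
    also have "\<dots> \<le> (real m + 1) * (900 * grid \<eta> m j * (2 ^ m)\<^sup>2) / w m j"
      using w[of m j] by (intro divide_right_mono expectation_dyadic_disc_grid_le \<eta>) auto
    also have "\<dots> = 900 / (real m + 1)\<^sup>2 * (grid \<eta> m j * (2 ^ m)\<^sup>2 / (err \<eta> (2 ^ m) (grid \<eta> m j))\<^sup>2)"
    proof -
      have "(1 + real m) \<noteq> 0" by linarith
      thus ?thesis using err0[of m j] unfolding w_def by (simp add: divide_simps power2_eq_square power3_eq_cube)
    qed
    finally show ?thesis
      using grid_pos[of \<eta> m j] by (simp add: ennreal_leI ennreal_mult[symmetric] less_imp_le)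
  qed
  have "(\<integral>\<^sup>+x. (\<Sum>m. \<Sum>j. F m j x) \<partial>unit_square a a') = (\<Sum>m. \<Sum>j. (\<integral>\<^sup>+x. F m j x \<partial>unit_square a a'))"
    by (simp add: nn_integral_suminf)
  also have "\<dots> \<le> (\<Sum>m. \<Sum>j. ennreal (900 / (real m + 1)\<^sup>2) * ennreal (grid \<eta> m j * (2 ^ m)\<^sup>2 / (err \<eta> (2 ^ m) (grid \<eta> m j))\<^sup>2))"
    by (intro suminf_le summableI intF)
  also have "\<dots> \<le> (\<Sum>m. ennreal (900 / (real m + 1)\<^sup>2) * 1)"
  proof (intro suminf_le summableI)
    fix m
    have "(\<Sum>j. ennreal (grid \<eta> m j * (2 ^ m)\<^sup>2 / (err \<eta> (2 ^ m) (grid \<eta> m j))\<^sup>2)) \<le> 1"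
    proof (rule suminf_le_const[OF summableI])
      fix n
      have "(\<Sum>j<n. ennreal (grid \<eta> m j * (2 ^ m)\<^sup>2 / (err \<eta> (2 ^ m) (grid \<eta> m j))\<^sup>2)) =
        ennreal (\<Sum>j<n. grid \<eta> m j * (2 ^ m)\<^sup>2 / (err \<eta> (2 ^ m) (grid \<eta> m j))\<^sup>2)"
        using grid_pos by (intro sum_ennreal divide_nonneg_nonneg mult_nonneg_nonneg) (auto intro: less_imp_le)
      also have "\<dots> \<le> 1" using sum_grid_le[OF \<eta>, of m n] by (simp add: ennreal_le_1)
      finally show "(\<Sum>j<n. ennreal (grid \<eta> m j * (2 ^ m)\<^sup>2 / (err \<eta> (2 ^ m) (grid \<eta> m j))\<^sup>2)) \<le> 1" .
    qed
    then show "(\<Sum>j. ennreal (900 / (real m + 1)\<^sup>2) * ennreal (grid \<eta> m j * (2 ^ m)\<^sup>2 / (err \<eta> (2 ^ m) (grid \<eta> m j))\<^sup>2))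
      \<le> ennreal (900 / (real m + 1)\<^sup>2) * 1"
      unfolding ennreal_suminf_cmult by (intro mult_left_mono) auto
  qed
  also have "\<dots> \<le> ennreal 1800"
  proof (rule suminf_le_const[OF summableI])
    fix n
    have "(\<Sum>m<n. ennreal (900 / (real m + 1)\<^sup>2) * 1) = ennreal (900 * (\<Sum>m<n. 1 / (real (Suc m))\<^sup>2))"
      by (simp add: sum_distrib_left add.commute)
    also have "(\<Sum>m<n. 1 / (real (Suc m))\<^sup>2) = (\<Sum>e\<in>{1..n}. 1 / (real e)\<^sup>2)"
      by (rule sum.reindex_bij_witness[of _ "\<lambda>e. e - 1" Suc]) auto
    also have "ennreal (900 * \<dots>) \<le> ennreal 1800"
      using sum_inverse_squares_le[of n] by (intro ennreal_leI) simp
    finally show "(\<Sum>m<n. ennreal (900 / (real m + 1)\<^sup>2) * 1) \<le> ennreal 1800" .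
  qed
  finally have "(\<integral>\<^sup>+x. (\<Sum>m. \<Sum>j. F m j x) \<partial>unit_square a a') \<noteq> \<infinity>"
    by (auto simp: top_unique)
  then have "AE x in unit_square a a'. (\<Sum>m. \<Sum>j. F m j x) \<noteq> \<infinity>"
    by (intro nn_integral_noteq_infinite) measurable
  then show ?thesis
  proof eventually_elim
    case (elim x)
    then obtain c where c: "(\<Sum>m. \<Sum>j. F m j x) = ennreal c" "0 \<le> c"
      by (cases "\<Sum>m. \<Sum>j. F m j x") auto
    have bd: "dyadic_disc m (grid \<eta> m j) 0 x \<le> c * w m j" for m j
    proof -
      have "F m j x \<le> (\<Sum>j. F m j x)" using sum_le_suminf[OF summableI, of "{j}" "\<lambda>j. F m j x"] by simp
      also have "\<dots> \<le> (\<Sum>m. \<Sum>j. F m j x)" using sum_le_suminf[OF summableI, of "{m}" "\<lambda>m. \<Sum>j. F m j x"] by simp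
      finally have "dyadic_disc m (grid \<eta> m j) 0 x / w m j \<le> c"
        using c by (simp add: F_def)
      thus ?thesis using w[of m j] by (simp add: pos_divide_le_eq)
    qed
    show ?case
    \<comment> \<open>Adding 1 keeps the constant positive when \<open>c = 0\<close>.\<close>
    proof (intro exI[of _ "sqrt c + 1"] conjI allI impI)
      show "0 < sqrt c + 1" using c by (intro add_nonneg_pos) auto
      fix m j k :: nat assume k: "k \<le> 2 ^ m"
      let ?e = "err \<eta> (2 ^ m) (grid \<eta> m j)"
      have "(disc (grid \<eta> m j) {1..<ceil_exp k} x)\<^sup>2 \<le> (real m + 1) * dyadic_disc m (grid \<eta> m j) 0 x"
        by (rule disc_sq_le_dyadic_disc[OF k])
      also have "\<dots> \<le> (real m + 1) * (c * w m j)"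
        by (intro mult_left_mono bd) auto
      also have "\<dots> = (sqrt c * (real m + 1)\<^sup>2 * ?e)\<^sup>2"
        using c by (simp add: w_def power_mult_distrib eval_nat_numeral)
      finally have "\<bar>disc (grid \<eta> m j) {1..<ceil_exp k} x\<bar> \<le> \<bar>sqrt c * (real m + 1)\<^sup>2 * ?e\<bar>"
        by (simp add: abs_le_square_iff)
      also have "\<dots> = sqrt c * (real m + 1)\<^sup>2 * ?e" using c err0[of m j] by simp
      also have "\<dots> \<le> (sqrt c + 1) * (real m + 1)\<^sup>2 * ?e"
        using err0[of m j] by (intro mult_right_mono) auto
      finally show "\<bar>disc (grid \<eta> m j) {1..<ceil_exp k} x\<bar> \<le> (sqrt c + 1) * (real m + 1)\<^sup>2 * ?e" .
    qed
  qed
qed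

text \<open>Countably many half-open unit squares tile the plane, and \<open>unit_square\<close> is
  Lebesgue measure restricted to one of them.\<close>

lemma AE_lborel_unit_squares:
  assumes "\<And>a a'. AE x in unit_square a a'. P x"
  shows "AE x in (lborel :: (real \<times> real) measure). P x"
proof -
  have "AE x in lborel. x \<in> {of_int a..<of_int a + 1} \<times> {of_int a'..<of_int a' + 1} \<longrightarrow> P x" for a a'
  proof -
    have "unit_square a a' = density (lborel \<Otimes>\<^sub>M lborel)
       (\<lambda>(x, y). indicator {of_int a..<of_int a + 1} x * indicator {of_int a'..<of_int a' + 1} y)"
      unfolding unit_square_def unif_unit_def
      by (rule pair_measure_density)
        (auto simp: sigma_finite_lborel intro: prob_space_imp_sigma_finite prob_space_unif_unit[unfolded unif_unit_def])
    also have "\<dots> = density lborel (\<lambda>x. indicator ({of_int a..<of_int a + 1} \<times> {of_int a'..<of_int a' + 1}) x)"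
      by (simp add: lborel_prod case_prod_unfold indicator_times)
    finally have eq: "unit_square a a' = density lborel (\<lambda>x. indicator ({of_int a..<of_int a + 1} \<times> {of_int a'..<of_int a' + 1}) x)" .
    have "{of_int a..<of_int a + 1} \<times> {of_int a'..<of_int a' + 1} \<in> sets (lborel \<Otimes>\<^sub>M lborel :: (real \<times> real) measure)"
      by (rule pair_measureI) auto
    then have "(\<lambda>x. indicator ({of_int a..<of_int a + 1} \<times> {of_int a'..<of_int a' + 1}) x :: ennreal) \<in> borel_measurable (lborel :: (real \<times> real) measure)"
      unfolding lborel_prod by (rule borel_measurable_indicator)
    from AE_density[OF this, of P] assms[of a a'] show ?thesis
      unfolding eq by (auto simp: indicator_def elim!: eventually_mono)
  qed
  then have "AE x in lborel. \<forall>a a'. x \<in> {of_int a..<of_int a + 1} \<times> {of_int a'..<of_int a' + 1} \<longrightarrow> P x"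
    by (simp only: AE_all_countable) blast
  then show ?thesis
  proof eventually_elim
    case (elim x)
    have "x \<in> {of_int \<lfloor>fst x\<rfloor>..<of_int \<lfloor>fst x\<rfloor> + 1} \<times> {of_int \<lfloor>snd x\<rfloor>..<of_int \<lfloor>snd x\<rfloor> + 1}"
      by (auto simp: mem_Times_iff)
    with elim show ?case by blast
  qed
qed

section \<open>The mean and the interpolation\<close>

lemma ln_four_bounds: "1 \<le> ln (4::real)" "ln (4::real) \<le> 2"
proof -
  show "1 \<le> ln (4::real)" using exp_le by (simp add: ln_ge_iff)
  have "(2::real) \<le> exp 1" using exp_ge_add_one_self[of 1] by simp
  then have "2 * 2 \<le> exp 1 * exp (1::real)" by (intro mult_mono) auto
  then have "4 \<le> exp (2::real)" by (simp add: exp_add[symmetric])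
  then have "ln 4 \<le> ln (exp (2::real))" by (subst ln_le_cancel_iff) auto
  then show "ln (4::real) \<le> 2" by simp
qed

text \<open>Below the cap the difference is exactly \<open>c * (1 - ln 4 - ln b)\<close> with
  \<open>c = 4 * (b / q)\<close>. Above it \<open>c \<ge> 1\<close> forces
  \<open>ln q \<le> 2 + \<bar>ln b\<bar>\<close>, so each of the two quantities is separately within
  the bound.\<close>

lemma region_prob_approx:
  fixes b q :: real
  assumes b: "0 < b" and q: "1 \<le> q"
  shows "\<bar>region_prob (b / q) - 4 * (b / q) * ln q\<bar> \<le> 10 * (b / q) * (1 + \<bar>ln b\<bar>)"
proof -
  define c where "c = 4 * (b / q)"
  have c: "0 < c" using b q by (simp add: c_def)
  have lnq: "0 \<le> ln q" using q by simp
  have lnc: "ln c = ln 4 + ln b - ln q"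
    using b q by (simp add: c_def ln_mult ln_div)
  have "\<bar>region_prob (b / q) - c * ln q\<bar> \<le> c * (5 / 2 * (1 + \<bar>ln b\<bar>))"
  proof (cases "b / q \<ge> 1 / 4")
    case True
    then have c1: "1 \<le> c" unfolding c_def by linarith
    then have "0 \<le> ln c" by simp
    then have "ln q \<le> 2 + \<bar>ln b\<bar>" using ln_four_bounds lnc by linarith
    then have "c * ln q \<le> c * (2 + \<bar>ln b\<bar>)" using c by (intro mult_left_mono) auto
    moreover have "0 \<le> c * ln q" using c lnq by simp
    moreover have "c * (2 + \<bar>ln b\<bar>) \<le> c * (5 / 2 * (1 + \<bar>ln b\<bar>))" using c by (intro mult_left_mono) (auto simp: algebra_simps)
    moreover have "1 \<le> c * (5 / 2 * (1 + \<bar>ln b\<bar>))"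
    proof -
      have "1 * 1 \<le> c * (5 / 2 * (1 + \<bar>ln b\<bar>))" using c1 by (intro mult_mono) auto
      thus ?thesis by simp
    qed
    moreover have "region_prob (b / q) = 1" using True by (simp add: region_prob_def)
    ultimately show ?thesis by (intro abs_leI) linarith+
  next
    case False
    then have "region_prob (b / q) = c * (1 - ln c)" by (simp add: region_prob_def c_def)
    then have "region_prob (b / q) - c * ln q = c * (1 - ln 4 - ln b)"
      unfolding lnc by (simp add: algebra_simps)
    also have "\<bar>\<dots>\<bar> = c * \<bar>1 - ln 4 - ln b\<bar>" using c by (simp add: abs_mult)
    also have "\<dots> \<le> c * (5 / 2 * (1 + \<bar>ln b\<bar>))"
    proof -
      have "\<bar>1 - ln 4 - ln b\<bar> \<le> 5 / 2 * (1 + \<bar>ln b\<bar>)"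
        using ln_four_bounds abs_ge_self[of "ln b"] abs_ge_minus_self[of "ln b"]
        by (intro abs_leI) (simp_all add: field_simps)
      thus ?thesis using c by (intro mult_left_mono) auto
    qed
    finally show ?thesis .
  qed
  also have "c * (5 / 2 * (1 + \<bar>ln b\<bar>)) = 10 * (b / q) * (1 + \<bar>ln b\<bar>)"
    using q by (simp add: c_def field_simps)
  finally show ?thesis unfolding c_def .
qed

lemma ln_ceil_exp_bounds: "real k \<le> ln (ceil_exp k)" "ln (ceil_exp k) \<le> real k + 1"
proof -
  have pos: "0 < real (ceil_exp k)" using ceil_exp_ge_1[of k] by simp
  have "exp (real k) \<le> real (ceil_exp k)" by (simp add: ceil_exp_def of_nat_nat)
  then have "ln (exp (real k)) \<le> ln (ceil_exp k)" using pos by (subst ln_le_cancel_iff) auto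
  then show "real k \<le> ln (ceil_exp k)" by simp
  have "real (ceil_exp k) = of_int \<lceil>exp (real k)\<rceil>" by (simp add: ceil_exp_def of_nat_nat)
  then have "real (ceil_exp k) \<le> exp (real k) + 1" by linarith
  also have "\<dots> \<le> exp (real k) + exp (real k) * 1" by simp
  also have "\<dots> \<le> exp (real k) * exp 1"
  proof -
    have "(2::real) \<le> exp 1" using exp_ge_add_one_self[of 1] by simp
    then have "exp (real k) * 2 \<le> exp (real k) * exp 1" by (intro mult_left_mono) auto
    thus ?thesis by simp
  qed
  also have "\<dots> = exp (real k + 1)" by (simp add: exp_add)
  finally have "ln (ceil_exp k) \<le> ln (exp (real k + 1))" using pos by (subst ln_le_cancel_iff) auto
  then show "ln (ceil_exp k) \<le> real k + 1" by simp
qed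

lemma sum_inverse_ceil_exp_le: "(\<Sum>q\<in>{1..<ceil_exp k}. 1 / real q) \<le> 1 + real k"
proof -
  have "{1..<ceil_exp k} = {1..ceil_exp k - 1}" using ceil_exp_ge_1[of k] by auto
  then have "(\<Sum>q\<in>{1..<ceil_exp k}. 1 / real q) \<le> 1 + ln (real (max 1 (ceil_exp k - 1)))"
    using sum_inverse_le[of "ceil_exp k - 1"] by simp
  also have "ln (real (max 1 (ceil_exp k - 1))) \<le> ln (exp (real k))"
  proof -
    have "ceil_exp k - 1 < ceil_exp k" using ceil_exp_ge_1[of k] by simp
    then have "real (ceil_exp k - 1) < exp (real k)" unfolding less_ceil_exp_iff .
    moreover have "1 \<le> exp (real k)" by simp
    ultimately have "real (max 1 (ceil_exp k - 1)) \<le> exp (real k)" by (auto simp only: max_def of_nat_1 split: if_split)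
    thus ?thesis by (subst ln_le_cancel_iff) auto
  qed
  finally show ?thesis by simp
qed

text \<open>The sum is compared with the telescoping increments of half the squared logarithm. Each
  increment is within \<open>1 / q\<close> of the summand, costing a harmonic sum, and the end point
  costs at most \<open>k + 1/2\<close>.\<close>

lemma sum_ln_over_ceil_exp:
  "\<bar>(\<Sum>q\<in>{1..<ceil_exp k}. ln q / q) - (real k)\<^sup>2 / 2\<bar> \<le> 2 * (1 + real k)"
proof -
  define D where "D = (\<lambda>q::nat. ((ln (real (Suc q)))\<^sup>2 - (ln (real q))\<^sup>2) / 2)"
  have D: "\<bar>D q - ln q / q\<bar> \<le> 1 / q" if q: "1 \<le> q" for q :: nat
  proof -
    define d where "d = ln (real (Suc q)) - ln (real q)"
    have lnq: "0 \<le> ln (real q)" "ln (real q) \<le> real q - 1"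
      using q ln_le_minus_one[of "real q"] by auto
    have d1: "d \<le> 1 / q"
      using q ln_diff_le[of "real (Suc q)" "real q"] by (simp add: d_def)
    have d2: "1 / (real q + 1) \<le> d"
      using q ln_diff_le[of "real q" "real (Suc q)"] by (simp add: d_def field_simps)
    have q1: "1 / real q \<le> 1" "0 < 1 / real q" using q by auto
    have d0: "0 \<le> d" using order_trans[OF _ d2] by simp
    have Dq: "D q = d * ln q + d * d / 2"
      by (simp add: D_def d_def power2_eq_square algebra_simps add_divide_distrib diff_divide_distrib)
    have "d * ln q \<le> 1 / q * ln q" using d1 lnq by (intro mult_right_mono)
    moreover have "d * d \<le> 1 / q * 1"
      using d1 d0 q1 by (intro mult_mono) linarith+
    moreover have "0 \<le> d * d" by simp
    ultimately have up: "D q \<le> ln q / q + 1 / q" unfolding Dq by (simp only: mult_1_right times_divide_eq_left mult_1_left)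
    have "1 / (real q + 1) * ln q \<le> d * ln q" using d2 lnq by (intro mult_right_mono)
    moreover have "ln q / q - 1 / q \<le> 1 / (real q + 1) * ln q"
    proof -
      have "ln q / q - 1 / (real q + 1) * ln q = ln q / (real q * (real q + 1))"
        using q by (simp add: field_simps)
      also have "\<dots> \<le> (real q + 1) / (real q * (real q + 1))"
        using lnq by (intro divide_right_mono) auto
      also have "\<dots> = 1 / q" by simp
      finally show ?thesis by simp
    qed
    moreover have "0 \<le> d * d" by simp
    ultimately have "ln q / q - 1 / q \<le> D q" unfolding Dq by linarith
    with up show ?thesis by linarith
  qed
  have "\<bar>(\<Sum>q\<in>{1..<ceil_exp k}. D q) - (\<Sum>q\<in>{1..<ceil_exp k}. ln q / q)\<bar> \<le> (\<Sum>q\<in>{1..<ceil_exp k}. 1 / real q)"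
    unfolding sum_subtractf[symmetric] by (rule order_trans[OF sum_abs]) (intro sum_mono D, simp)
  also have "\<dots> \<le> 1 + real k" by (rule sum_inverse_ceil_exp_le)
  finally have 1: "\<bar>(\<Sum>q\<in>{1..<ceil_exp k}. D q) - (\<Sum>q\<in>{1..<ceil_exp k}. ln q / q)\<bar> \<le> 1 + real k" .
  have "(\<Sum>q\<in>{1..<ceil_exp k}. D q) = (\<Sum>q\<in>{1..<ceil_exp k}. (ln (real (Suc q)))\<^sup>2 - (ln (real q))\<^sup>2) / 2"
    by (simp add: D_def sum_divide_distrib)
  also have "(\<Sum>q\<in>{1..<ceil_exp k}. (ln (real (Suc q)))\<^sup>2 - (ln (real q))\<^sup>2) = (ln (ceil_exp k))\<^sup>2"
    using sum_Suc_diff'[of 1 "ceil_exp k" "\<lambda>q. (ln (real q))\<^sup>2"] ceil_exp_ge_1[of k] by simp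
  finally have 2: "(\<Sum>q\<in>{1..<ceil_exp k}. D q) = (ln (ceil_exp k))\<^sup>2 / 2" .
  have "(real k)\<^sup>2 \<le> (ln (ceil_exp k))\<^sup>2" using ln_ceil_exp_bounds[of k] by (intro power_mono) auto
  moreover have "(ln (ceil_exp k))\<^sup>2 \<le> (real k + 1)\<^sup>2" using ln_ceil_exp_bounds[of k] by (intro power_mono) auto
  then have "(ln (ceil_exp k))\<^sup>2 \<le> (real k)\<^sup>2 + 2 * real k + 1" by (simp add: power2_eq_square algebra_simps)
  ultimately show ?thesis using 1 2 unfolding abs_le_iff
    by (simp add: field_simps)
qed

text \<open>The mean is \<open>4 * b\<close> times the sum of \<open>ln q / q\<close>, half a square
  in \<open>k\<close>; this is the origin of the main term \<open>2 * b * (ln T)\<^sup>2\<close>.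
  The constant 18 is 10 from the pointwise approximation plus 8 from that sum.\<close>

lemma sum_region_prob_approx:
  assumes b: "0 < b"
  shows "\<bar>(\<Sum>q\<in>{1..<ceil_exp k}. region_prob (b / q)) - 2 * b * (real k)\<^sup>2\<bar> \<le> 18 * (b * (1 + \<bar>ln b\<bar>)) * (1 + real k)"
proof -
  have "\<bar>(\<Sum>q\<in>{1..<ceil_exp k}. region_prob (b / q)) - (\<Sum>q\<in>{1..<ceil_exp k}. 4 * (b / q) * ln q)\<bar> \<le>
      (\<Sum>q\<in>{1..<ceil_exp k}. 10 * (b / q) * (1 + \<bar>ln b\<bar>))"
    unfolding sum_subtractf[symmetric]
    by (rule order_trans[OF sum_abs]) (intro sum_mono region_prob_approx b, simp)
  also have "\<dots> = 10 * b * (1 + \<bar>ln b\<bar>) * (\<Sum>q\<in>{1..<ceil_exp k}. 1 / real q)"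
    unfolding sum_distrib_left by (intro sum.cong) auto
  also have "\<dots> \<le> 10 * b * (1 + \<bar>ln b\<bar>) * (1 + real k)"
    using b by (intro mult_left_mono sum_inverse_ceil_exp_le) auto
  finally have 1: "\<bar>(\<Sum>q\<in>{1..<ceil_exp k}. region_prob (b / q)) - (\<Sum>q\<in>{1..<ceil_exp k}. 4 * (b / q) * ln q)\<bar> \<le>
      10 * b * (1 + \<bar>ln b\<bar>) * (1 + real k)" .
  have "(\<Sum>q\<in>{1..<ceil_exp k}. 4 * (b / q) * ln q) = 4 * b * (\<Sum>q\<in>{1..<ceil_exp k}. ln q / q)"
    unfolding sum_distrib_left by (intro sum.cong) auto
  then have "(\<Sum>q\<in>{1..<ceil_exp k}. 4 * (b / q) * ln q) - 2 * b * (real k)\<^sup>2 =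
      4 * b * ((\<Sum>q\<in>{1..<ceil_exp k}. ln q / q) - (real k)\<^sup>2 / 2)"
    by (simp add: algebra_simps)
  also have "\<bar>\<dots>\<bar> = 4 * b * \<bar>(\<Sum>q\<in>{1..<ceil_exp k}. ln q / q) - (real k)\<^sup>2 / 2\<bar>"
    using b by (simp add: abs_mult)
  also have "\<dots> \<le> 4 * b * (2 * (1 + real k))"
    using b by (intro mult_left_mono sum_ln_over_ceil_exp) auto
  also have "\<dots> \<le> 8 * (b * (1 + \<bar>ln b\<bar>)) * (1 + real k)"
    using b by (simp add: algebra_simps)
  finally show ?thesis using 1 by (simp add: algebra_simps)
qed

section \<open>Absorbing logarithms of \<open>b\<close> and comparing values of
  \<open>err\<close>\<close>

lemma mult_ln_le_powr:
  fixes b \<eta> :: real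
  assumes \<eta>: "1 < \<eta>" "\<eta> < 2" and b: "0 < b"
  shows "b * (1 + \<bar>ln b\<bar>) \<le> (3 + 1 / (2 / \<eta> - 1)) * (b powr (1 - 1 / \<eta>) + b powr (2 / \<eta>))"
proof -
  define s where "s = 2 / \<eta> - 1"
  have s: "0 < s" using \<eta> by (simp add: s_def pos_less_divide_eq)
  show ?thesis
  proof (cases "b \<le> 1")
    case True
    \<comment> \<open>For \<open>b \<le> 1\<close> the logarithm is traded for
      \<open>b powr (-1 / \<eta>)\<close>, which turns \<open>b\<close> into the first power in
      \<open>err\<close>.\<close>
    have "ln (b powr (-1 / \<eta>)) \<le> b powr (-1 / \<eta>) - 1"
      using b by (intro ln_le_minus_one) simp
    then have "- ln b / \<eta> \<le> b powr (-1 / \<eta>)"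
      using b by (simp add: ln_powr)
    then have "\<eta> * (- ln b / \<eta>) \<le> \<eta> * b powr (-1 / \<eta>)"
      using \<eta> by (intro mult_left_mono) auto
    then have "- ln b \<le> \<eta> * b powr (-1 / \<eta>)" using \<eta> by simp
    also have "\<dots> \<le> 2 * b powr (-1 / \<eta>)" using \<eta> by (intro mult_right_mono) auto
    finally have "- ln b \<le> 2 * b powr (-1 / \<eta>)" .
    then have 1: "\<bar>ln b\<bar> \<le> 2 * b powr (-1 / \<eta>)" using True b by simp
    have "1 \<le> b powr (-1 / \<eta>)"
      using powr_mono'[of "-1 / \<eta>" 0 b] True b \<eta> by simp
    with 1 have "b * (1 + \<bar>ln b\<bar>) \<le> b * (3 * b powr (-1 / \<eta>))"
      using b by (intro mult_left_mono) auto
    also have "\<dots> = 3 * b powr (1 - 1 / \<eta>)"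
      using b powr_mult_base[of b "-1 / \<eta>"] by simp
    also have "\<dots> \<le> (3 + 1 / s) * (b powr (1 - 1 / \<eta>) + b powr (2 / \<eta>))"
      using s by (intro mult_mono) auto
    finally show ?thesis by (simp add: s_def)
  next
    case False
    \<comment> \<open>For large \<open>b\<close> the second power in \<open>err\<close> exceeds
      \<open>b\<close> by the factor \<open>b powr s\<close>; \<open>s\<close> is positive because
      \<eta> < 2.\<close>
    have "ln (b powr s) \<le> b powr s - 1" using b by (intro ln_le_minus_one) simp
    then have "s * ln b \<le> b powr s" using b by (simp add: ln_powr)
    then have "ln b \<le> 1 / s * b powr s" using s by (simp add: pos_le_divide_eq mult.commute)
    moreover have "1 \<le> b powr s" using False s by (intro ge_one_powr_ge_zero) auto
    ultimately have "b * (1 + \<bar>ln b\<bar>) \<le> b * ((1 + 1 / s) * b powr s)"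
      using b False by (intro mult_left_mono) (auto simp: distrib_right)
    also have "\<dots> = (1 + 1 / s) * b powr (2 / \<eta>)"
      using b powr_mult_base[of b s] by (simp add: s_def)
    also have "\<dots> \<le> (3 + 1 / s) * (b powr (1 - 1 / \<eta>) + b powr (2 / \<eta>))"
      using s by (intro mult_mono) auto
    finally show ?thesis by (simp add: s_def)
  qed
qed

lemma mult_ln_le_err:
  fixes b \<eta> K :: real
  assumes \<eta>: "1 < \<eta>" "\<eta> < 2" and b: "0 < b" and K: "1 \<le> K"
  shows "b * (1 + \<bar>ln b\<bar>) * K \<le> (3 + 1 / (2 / \<eta> - 1)) * err \<eta> K b"
proof -
  have s: "0 < 2 / \<eta> - 1" using \<eta> by (simp add: pos_less_divide_eq)
  have "b * (1 + \<bar>ln b\<bar>) * K \<le> (3 + 1 / (2 / \<eta> - 1)) * (b powr (1 - 1 / \<eta>) + b powr (2 / \<eta>)) * K"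
    using K by (intro mult_right_mono mult_ln_le_powr \<eta> b) auto
  also have "\<dots> \<le> (3 + 1 / (2 / \<eta> - 1)) * err \<eta> K b"
  proof -
    have "b powr (2 / \<eta>) * K \<le> b powr (2 / \<eta>) * K\<^sup>2"
      using K by (intro mult_left_mono) (auto simp: power2_eq_square)
    then have "(b powr (1 - 1 / \<eta>) + b powr (2 / \<eta>)) * K \<le> err \<eta> K b"
      by (simp add: err_def distrib_right)
    then have "(3 + 1 / (2 / \<eta> - 1)) * ((b powr (1 - 1 / \<eta>) + b powr (2 / \<eta>)) * K) \<le> (3 + 1 / (2 / \<eta> - 1)) * err \<eta> K b"
      using s by (intro mult_left_mono) auto
    thus ?thesis by (simp only: mult.assoc)
  qed
  finally show ?thesis .
qed

lemma err_mono:
  assumes "1 < \<eta>" "0 \<le> b" "b \<le> b'" "0 \<le> K" "K \<le> K'"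
  shows "err \<eta> K b \<le> err \<eta> K' b'"
  unfolding err_def using assms by (intro add_mono mult_mono powr_mono2 power_mono) auto

lemma err_4_le:
  assumes "1 < \<eta>" "0 \<le> b" "0 \<le> K"
  shows "err \<eta> K (4 * b) \<le> 16 * err \<eta> K b"
proof -
  have "4 powr (1 - 1 / \<eta>) \<le> 4 powr (2::real)" "4 powr (2 / \<eta>) \<le> 4 powr (2::real)"
    using assms by (intro powr_mono; simp add: field_simps)+
  then have p: "4 powr (1 - 1 / \<eta>) \<le> (16::real)" "4 powr (2 / \<eta>) \<le> (16::real)" by auto
  have "err \<eta> K (4 * b) = 4 powr (1 - 1 / \<eta>) * (b powr (1 - 1 / \<eta>) * K) + 4 powr (2 / \<eta>) * (b powr (2 / \<eta>) * K\<^sup>2)"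
    using assms by (simp add: err_def powr_mult)
  also have "\<dots> \<le> 16 * (b powr (1 - 1 / \<eta>) * K) + 16 * (b powr (2 / \<eta>) * K\<^sup>2)"
    using p assms by (intro add_mono mult_right_mono) auto
  finally show ?thesis by (simp add: err_def)
qed

lemma err_double_le:
  assumes "0 \<le> b" "0 \<le> K"
  shows "err \<eta> (2 * K) b \<le> 4 * err \<eta> K b"
proof -
  have "0 \<le> b powr (1 - 1 / \<eta>) * K" using assms by simp
  moreover have "err \<eta> (2 * K) b = 2 * (b powr (1 - 1 / \<eta>) * K) + 4 * (b powr (2 / \<eta>) * K\<^sup>2)"
    by (simp add: err_def power_mult_distrib)
  moreover have "4 * err \<eta> K b = 4 * (b powr (1 - 1 / \<eta>) * K) + 4 * (b powr (2 / \<eta>) * K\<^sup>2)"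
    by (simp add: err_def)
  ultimately show ?thesis by linarith
qed

text \<open>Round \<open>b powr (1 / \<eta>)\<close> down to a multiple of \<open>1 / 2 ^ m\<close>.
  The lower bound on \<open>b\<close> makes the rounded value at least one step, so the next grid
  point is at most twice the unrounded one and its level at most \<open>4 * b\<close>.\<close>

lemma ex_grid:
  fixes m :: nat
  assumes \<eta>: "1 < \<eta>" "\<eta> < 2" and b: "(2 ^ m) powr (- \<eta>) \<le> b"
  shows "\<exists>j. grid \<eta> m j \<le> b \<and> b \<le> grid \<eta> m (Suc j) \<and> grid \<eta> m (Suc j) \<le> 4 * b \<and>
     (grid \<eta> m (Suc j) - grid \<eta> m j) * 2 ^ m \<le> 4 * b powr (1 - 1 / \<eta>)"
proof -
  define K where "K = (2::real) ^ m"
  have K: "0 < K" by (simp add: K_def)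
  have b0: "0 < b" using b K less_le_trans[of 0 "(2 ^ m) powr (- \<eta>)" b] by simp
  define y where "y = b powr (1 / \<eta>)"
  have y: "b = y powr \<eta>" "0 < y" using \<eta> b0 by (auto simp: y_def powr_powr)
  have "(K powr (- \<eta>)) powr (1 / \<eta>) \<le> y"
    unfolding y_def K_def using b \<eta> by (intro powr_mono2) auto
  moreover have "(K powr (- \<eta>)) powr (1 / \<eta>) = K powr (- 1)" using \<eta> by (simp only: powr_powr) simp
  ultimately have "1 / K \<le> y" using K by (simp add: powr_minus_divide)
  then have yK: "1 \<le> y * K" using K by (simp add: pos_divide_le_eq)
  \<comment> \<open>The index is one less than the floor because \<open>grid\<close> uses
    \<open>j + 1\<close>.\<close>
  define j where "j = nat \<lfloor>y * K\<rfloor> - 1"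
  have fl: "1 \<le> \<lfloor>y * K\<rfloor>" using yK by (simp add: le_floor_iff)
  have j: "real j + 1 = of_int \<lfloor>y * K\<rfloor>"
  proof -
    have "1 \<le> nat \<lfloor>y * K\<rfloor>" using fl by linarith
    then have "real j + 1 = real (nat \<lfloor>y * K\<rfloor>)" by (simp add: j_def of_nat_diff)
    thus ?thesis using fl by simp
  qed
  define x where "x = (real j + 1) / K"
  define x' where "x' = (real (Suc j) + 1) / K"
  have x: "0 < x" "x \<le> y" using K j fl by (auto simp: x_def pos_divide_le_eq)
  have x': "y \<le> x'" unfolding x'_def using K j by (simp add: pos_le_divide_eq) linarith
  have xx': "x' = x + 1 / K" by (simp add: x_def x'_def add_divide_distrib)
  have "1 / K \<le> x" unfolding x_def using K by (intro divide_right_mono) auto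
  then have x'2: "x' \<le> 2 * y" using xx' x by linarith
  have gj: "grid \<eta> m j = x powr \<eta>" "grid \<eta> m (Suc j) = x' powr \<eta>"
    by (auto simp: grid_def x_def x'_def K_def)
  have 1: "x powr \<eta> \<le> b" unfolding y(1) using x \<eta> by (intro powr_mono2) auto
  have 2: "b \<le> x' powr \<eta>" unfolding y(1) using x' y \<eta> by (intro powr_mono2) auto
  have "x' powr \<eta> \<le> (2 * y) powr \<eta>" using x'2 x' y \<eta> by (intro powr_mono2) auto
  also have "\<dots> = 2 powr \<eta> * b" using y by (simp add: powr_mult)
  also have "\<dots> \<le> 2 powr 2 * b" using \<eta> b0 by (intro mult_right_mono powr_mono) auto
  finally have 3: "x' powr \<eta> \<le> 4 * b" by simp
  have "(x' powr \<eta> - x powr \<eta>) * K \<le> 2 * x' powr (\<eta> - 1)"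
  proof -
    have xp: "0 < x'" using x x' by linarith
    \<comment> \<open>Splitting off a square leaves the decreasing power with exponent \<eta> - 2.
      Comparing it at both ends bounds the increment by a difference of squares, which carries the
      step \<open>1 / K\<close>.\<close>
    have "x powr \<eta> = x * x * x powr (\<eta> - 2)"
      using x powr_add[of x 2 "\<eta> - 2"] by (simp add: power2_eq_square)
    moreover have "x * x * x' powr (\<eta> - 2) \<le> x * x * x powr (\<eta> - 2)"
      using x x' \<eta> by (intro mult_left_mono powr_mono2') auto
    moreover have "x' powr \<eta> = x' * x' * x' powr (\<eta> - 2)"
      using xp powr_add[of x' 2 "\<eta> - 2"] by (simp add: power2_eq_square)
    ultimately have "x' powr \<eta> - x powr \<eta> \<le> (x' - x) * (x' + x) * x' powr (\<eta> - 2)"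
      by (simp add: algebra_simps)
    also have "\<dots> \<le> (x' - x) * (2 * x') * x' powr (\<eta> - 2)"
      using x x' by (intro mult_right_mono mult_left_mono) auto
    also have "\<dots> = 1 / K * (2 * (x' * x' powr (\<eta> - 2)))"
      by (simp add: xx')
    also have "x' * x' powr (\<eta> - 2) = x' powr (\<eta> - 1)"
      using xp powr_mult_base[of x' "\<eta> - 2"] by simp
    finally have "(x' powr \<eta> - x powr \<eta>) * K \<le> 1 / K * (2 * x' powr (\<eta> - 1)) * K"
      using K by (intro mult_right_mono) auto
    thus ?thesis using K by simp
  qed
  also have "2 * x' powr (\<eta> - 1) \<le> 2 * (2 * y) powr (\<eta> - 1)"
    using x'2 x' y \<eta> by (intro mult_left_mono powr_mono2) auto
  also have "(2 * y) powr (\<eta> - 1) = 2 powr (\<eta> - 1) * b powr (1 - 1 / \<eta>)"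
    using y \<eta> by (simp add: powr_mult powr_powr algebra_simps)
  also have "2 * (2 powr (\<eta> - 1) * b powr (1 - 1 / \<eta>)) \<le> 2 * (2 powr 1 * b powr (1 - 1 / \<eta>))"
    using \<eta> by (intro mult_left_mono mult_right_mono powr_mono) auto
  finally have 4: "(x' powr \<eta> - x powr \<eta>) * K \<le> 4 * b powr (1 - 1 / \<eta>)" by simp
  show ?thesis using 1 2 3 4 unfolding gj[symmetric] K_def by blast
qed

section \<open>From the grid to arbitrary \<open>T\<close> and \<open>b\<close>\<close>

lemma L_iff_region: "q \<in> L x b \<longleftrightarrow> 1 \<le> q \<and> x \<in> region b q"
  by (auto simp: L_def region_def pos_le_divide_eq ac_simps)

lemma region_mono: "b \<le> b' \<Longrightarrow> region b q \<subseteq> region b' q"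
  using divide_right_mono[of b b' "real q"] by (auto simp: region_def intro: order_trans)

lemma card_region_eq: "real (card {q \<in> {1..<n}. x \<in> region b q}) = disc b {1..<n} x + (\<Sum>q\<in>{1..<n}. region_prob (b / real q))"
proof -
  have "real (card {q \<in> {1..<n}. x \<in> region b q}) = (\<Sum>q\<in>{1..<n}. indicator (region b q) x)"
    by (simp add: indicator_def sum.If_cases Int_def)
  thus ?thesis by (simp add: disc_def sum_subtractf)
qed

lemma card_L_bounds:
  assumes k: "real k \<le> ln T" "ln T \<le> real k + 1" and T: "0 < T" and b: "\<beta> \<le> b" "b \<le> \<beta>'"
  shows "card {q \<in> {1..<ceil_exp k}. x \<in> region \<beta> q} \<le> card {q \<in> L x b. real q \<in> {1..<T}}"
    and "card {q \<in> L x b. real q \<in> {1..<T}} \<le> card {q \<in> {1..<ceil_exp (k + 1)}. x \<in> region \<beta>' q}"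
proof -
  have T1: "exp (real k) \<le> T" using k(1) T by (simp add: ln_ge_iff)
  have T2: "T \<le> exp (real (k + 1))"
    using k(2) T exp_le_cancel_iff[of "ln T" "real k + 1"] by (simp add: add.commute)
  have sub: "{q \<in> L x b. real q \<in> {1..<T}} \<subseteq> {q \<in> {1..<ceil_exp (k + 1)}. x \<in> region \<beta>' q}"
    using T2 region_mono[OF b(2)] by (auto simp: L_iff_region less_ceil_exp_iff)
  show "card {q \<in> L x b. real q \<in> {1..<T}} \<le> card {q \<in> {1..<ceil_exp (k + 1)}. x \<in> region \<beta>' q}"
    by (rule card_mono[OF _ sub]) simp
  show "card {q \<in> {1..<ceil_exp k}. x \<in> region \<beta> q} \<le> card {q \<in> L x b. real q \<in> {1..<T}}"
  proof (rule card_mono)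
    show "finite {q \<in> L x b. real q \<in> {1..<T}}" using sub by (rule finite_subset) simp
    show "{q \<in> {1..<ceil_exp k}. x \<in> region \<beta> q} \<subseteq> {q \<in> L x b. real q \<in> {1..<T}}"
      using T1 region_mono[OF b(1)] by (auto simp: L_iff_region less_ceil_exp_iff)
  qed
qed

text \<open>The count is sandwiched between grid values. In units of \<open>E\<close> the losses are
  \<open>16 * C\<close> times \<open>(m + 1)\<^sup>2\<close> for the discrepancy, 576 c for the
  mean, 8 for the change of level and 4 c for replacing \<open>k\<close> by
  \<open>ln T\<close>.\<close>

lemma card_L_approx:
  fixes \<eta> C T b :: real and x :: "real \<times> real"
  assumes \<eta>: "1 < \<eta>" "\<eta> < 2" and C: "0 < C"
    and bound: "\<And>m j k. k \<le> 2 ^ m \<Longrightarrow>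
      \<bar>disc (grid \<eta> m j) {1..<ceil_exp k} x\<bar> \<le> C * (real m + 1)\<^sup>2 * err \<eta> (2 ^ m) (grid \<eta> m j)"
    and T: "3 \<le> T" and b: "(ln T) powr (- \<eta>) \<le> b"
  defines "c \<equiv> 3 + 1 / (2 / \<eta> - 1)"
  shows "\<exists>m. 2 ^ m \<le> 2 * ln T \<and>
    \<bar>real (card {q \<in> L x b. real q \<in> {1..<T}}) - 2 * b * (ln T)\<^sup>2\<bar>
      \<le> 4 * (16 * C + 580 * c + 8) * (real m + 1)\<^sup>2 * err \<eta> (ln T) b"
proof -
  have "exp 1 \<le> T" using exp_le T by simp
  then have lnT: "1 \<le> ln T" using T by (simp add: ln_ge_iff)
  define k where "k = nat \<lfloor>ln T\<rfloor>"
  have k1: "1 \<le> k" using lnT by (simp add: k_def le_nat_iff le_floor_iff)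
  have "real k = of_int \<lfloor>ln T\<rfloor>" using lnT by (simp add: k_def)
  then have k: "real k \<le> ln T" "ln T < real k + 1" by linarith+
  \<comment> \<open>Rounding up to the next power of two leaves room for \<open>k + 1\<close> and
    keeps \<open>K \<le> 2 * ln T\<close>.\<close>
  obtain n where n: "2 ^ n \<le> k" "k < 2 ^ (n + 1)" using ex_power_ivl1[of 2 k] k1 by auto
  define m where "m = n + 1"
  define K where "K = (2::real) ^ m"
  have kK: "k + 1 \<le> 2 ^ m" using n by (simp add: m_def)
  then have "real (k + 1) \<le> real (2 ^ m)" by (rule of_nat_mono)
  then have kK': "real k + 1 \<le> K" by (simp add: K_def)
  have "real (2 ^ n) \<le> real k" using n(1) by (rule of_nat_mono)
  then have "2 ^ n \<le> real k" by simp
  then have "2 ^ n \<le> ln T" using k by linarith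
  then have K2: "K \<le> 2 * ln T" by (simp add: K_def m_def)
  have K1: "1 \<le> K" using kK' by simp
  have lnTK: "ln T \<le> K" using k kK' by linarith
  have b0: "0 < b" using b lnT less_le_trans[of 0 "(ln T) powr (- \<eta>)" b] by simp
  have "K powr (- \<eta>) \<le> (ln T) powr (- \<eta>)"
    using lnT lnTK \<eta> by (intro powr_mono2') auto
  then have "(2 ^ m) powr (- \<eta>) \<le> b" using b by (simp add: K_def)
  from ex_grid[OF \<eta> this] obtain j where j: "grid \<eta> m j \<le> b" "b \<le> grid \<eta> m (Suc j)" "grid \<eta> m (Suc j) \<le> 4 * b"
    "(grid \<eta> m (Suc j) - grid \<eta> m j) * K \<le> 4 * b powr (1 - 1 / \<eta>)"
    unfolding K_def by auto
  define \<beta> \<beta>' where "\<beta> = grid \<eta> m j" and "\<beta>' = grid \<eta> m (Suc j)"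
  note j = j[folded \<beta>_def \<beta>'_def]
  have \<beta>: "0 < \<beta>" "0 < \<beta>'" by (simp_all add: \<beta>_def \<beta>'_def grid_pos)
  define E where "E = err \<eta> K b"
  define M where "M = (real m + 1)\<^sup>2"
  have M: "1 \<le> M" by (simp add: M_def)
  have c: "0 < c" using \<eta> by (simp add: c_def pos_less_divide_eq add_pos_pos)
  have E: "0 < E" unfolding E_def by (intro err_pos b0) (use K1 in simp)
  have err1: "err \<eta> K \<beta> \<le> E"
    unfolding E_def using \<beta> j K1 \<eta> by (intro err_mono) auto
  have "err \<eta> K \<beta>' \<le> err \<eta> K (4 * b)" using \<beta> j K1 \<eta> by (intro err_mono) auto
  also have "\<dots> \<le> 16 * E" unfolding E_def using b0 K1 \<eta> by (intro err_4_le) auto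
  finally have err2: "err \<eta> K \<beta>' \<le> 16 * E" .
  \<comment> \<open>The change of the main term across one grid cell, controlled by the spacing of
    the levels.\<close>
  have step: "2 * (\<beta>' - \<beta>) * K\<^sup>2 \<le> 8 * E"
  proof -
    have "2 * (\<beta>' - \<beta>) * K\<^sup>2 = 2 * ((\<beta>' - \<beta>) * K * K)" by (simp add: power2_eq_square)
    also have "\<dots> \<le> 2 * (4 * b powr (1 - 1 / \<eta>) * K)"
      using j(4) K1 by (intro mult_left_mono mult_right_mono) auto
    also have "\<dots> \<le> 8 * E" by (simp add: E_def err_def)
    finally show ?thesis .
  qed
  \<comment> \<open>This pays for the passage from \<open>k\<close> or \<open>k + 1\<close> to
    \<open>ln T\<close>, which moves the main term by at most \<open>4 * b * K\<close>.\<close>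
  have bK: "b * K \<le> c * E"
  proof -
    have "b * 1 * K \<le> b * (1 + \<bar>ln b\<bar>) * K" using b0 K1 by (intro mult_right_mono mult_left_mono) auto
    also have "\<dots> \<le> c * E" unfolding c_def E_def by (rule mult_ln_le_err[OF \<eta> b0 K1])
    finally show ?thesis by simp
  qed
  have lnK: "\<beta> * (1 + \<bar>ln \<beta>\<bar>) * K \<le> c * E" "\<beta>' * (1 + \<bar>ln \<beta>'\<bar>) * K \<le> 16 * (c * E)"
  proof -
    have "\<beta> * (1 + \<bar>ln \<beta>\<bar>) * K \<le> c * err \<eta> K \<beta>"
      unfolding c_def by (rule mult_ln_le_err[OF \<eta> \<beta>(1) K1])
    also have "\<dots> \<le> c * E" using c err1 by (intro mult_left_mono) auto
    finally show "\<beta> * (1 + \<bar>ln \<beta>\<bar>) * K \<le> c * E" .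
    have "\<beta>' * (1 + \<bar>ln \<beta>'\<bar>) * K \<le> c * err \<eta> K \<beta>'"
      unfolding c_def by (rule mult_ln_le_err[OF \<eta> \<beta>(2) K1])
    also have "\<dots> \<le> c * (16 * E)" using c err2 by (intro mult_left_mono) auto
    finally show "\<beta>' * (1 + \<bar>ln \<beta>'\<bar>) * K \<le> 16 * (c * E)" by simp
  qed
  define N where "N = real (card {q \<in> L x b. real q \<in> {1..<T}})"
  have T0: "0 < T" using T by simp
  note cards = card_L_bounds[OF k(1) less_imp_le[OF k(2)] T0 j(1,2), of x]
  have up: "N - 2 * b * (ln T)\<^sup>2 \<le> (16 * C + 580 * c + 8) * M * E"
  proof -
    have "N \<le> disc \<beta>' {1..<ceil_exp (k + 1)} x + (\<Sum>q\<in>{1..<ceil_exp (k + 1)}. region_prob (\<beta>' / q))"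
      unfolding card_region_eq[symmetric] N_def by (intro of_nat_mono cards(2))
    also have "disc \<beta>' {1..<ceil_exp (k + 1)} x \<le> C * M * err \<eta> K \<beta>'"
      using bound[OF kK, of "Suc j"] by (simp add: \<beta>'_def M_def K_def)
    also have "\<dots> \<le> C * M * (16 * E)" using C M err2 by (intro mult_left_mono) auto
    also have "(\<Sum>q\<in>{1..<ceil_exp (k + 1)}. region_prob (\<beta>' / q)) \<le> 2 * \<beta>' * (real k + 1)\<^sup>2 + 18 * (\<beta>' * (1 + \<bar>ln \<beta>'\<bar>)) * (2 + real k)"
      using sum_region_prob_approx[OF \<beta>(2), of "k + 1"] by (simp add: add.commute abs_le_iff)
    also have "18 * (\<beta>' * (1 + \<bar>ln \<beta>'\<bar>)) * (2 + real k) \<le> 18 * (\<beta>' * (1 + \<bar>ln \<beta>'\<bar>)) * (2 * K)"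
      using \<beta> kK' by (intro mult_left_mono) auto
    also have "\<dots> = 36 * (\<beta>' * (1 + \<bar>ln \<beta>'\<bar>) * K)" by simp
    also have "\<dots> \<le> 36 * (16 * (c * E))" using lnK(2) by (intro mult_left_mono) auto
    finally have 1: "N \<le> C * M * (16 * E) + (2 * \<beta>' * (real k + 1)\<^sup>2 + 576 * (c * E))" by simp
    have "2 * (\<beta>' - b) * (real k + 1)\<^sup>2 \<le> 2 * (\<beta>' - \<beta>) * K\<^sup>2"
      using j kK' by (intro mult_mono power_mono) auto
    then have 2: "2 * (\<beta>' - b) * (real k + 1)\<^sup>2 \<le> 8 * E" using step by linarith
    have "(real k)\<^sup>2 \<le> (ln T)\<^sup>2" using k by (intro power_mono) auto
    then have "(real k + 1)\<^sup>2 - (ln T)\<^sup>2 \<le> 2 * K" using kK' by (simp add: power2_eq_square algebra_simps)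
    then have "2 * b * ((real k + 1)\<^sup>2 - (ln T)\<^sup>2) \<le> 2 * b * (2 * K)" using b0 by (intro mult_left_mono) auto
    moreover have "2 * b * (2 * K) = 4 * (b * K)" by simp
    ultimately have 3: "2 * b * ((real k + 1)\<^sup>2 - (ln T)\<^sup>2) \<le> 4 * (c * E)" using bK by linarith
    have "N - 2 * b * (ln T)\<^sup>2 \<le> C * M * (16 * E) + 576 * (c * E) + 8 * E + 4 * (c * E)"
      using 1 2 3 by (simp add: algebra_simps)
    also have "\<dots> = (16 * C * M + (580 * c + 8) * 1) * E" by (simp add: algebra_simps)
    also have "\<dots> \<le> (16 * C * M + (580 * c + 8) * M) * E"
      using M E c by (intro mult_right_mono add_mono mult_left_mono) auto
    finally show ?thesis by (simp add: algebra_simps)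
  qed
  \<comment> \<open>The constants of the upper estimate are reused, although smaller ones would do,
    so that both combine into an absolute value.\<close>
  have low: "2 * b * (ln T)\<^sup>2 - N \<le> (16 * C + 580 * c + 8) * M * E"
  proof -
    have "disc \<beta> {1..<ceil_exp k} x + (\<Sum>q\<in>{1..<ceil_exp k}. region_prob (\<beta> / q)) \<le> N"
      unfolding card_region_eq[symmetric] N_def by (intro of_nat_mono cards(1))
    moreover have "- (C * M * err \<eta> K \<beta>) \<le> disc \<beta> {1..<ceil_exp k} x"
      using bound[of k m j] kK by (simp add: \<beta>_def M_def K_def)
    moreover have "C * M * err \<eta> K \<beta> \<le> C * M * (16 * E)" using C M err1 E by (intro mult_left_mono) auto
    moreover have "2 * \<beta> * (real k)\<^sup>2 - 18 * (\<beta> * (1 + \<bar>ln \<beta>\<bar>)) * (1 + real k) \<le> (\<Sum>q\<in>{1..<ceil_exp k}. region_prob (\<beta> / q))"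
      using sum_region_prob_approx[OF \<beta>(1), of k] by (simp add: abs_le_iff)
    moreover have "18 * (\<beta> * (1 + \<bar>ln \<beta>\<bar>)) * (1 + real k) \<le> 18 * (\<beta> * (1 + \<bar>ln \<beta>\<bar>)) * K"
      using \<beta> kK' by (intro mult_left_mono) auto
    moreover have "18 * (\<beta> * (1 + \<bar>ln \<beta>\<bar>)) * K = 18 * (\<beta> * (1 + \<bar>ln \<beta>\<bar>) * K)" by simp
    then have "18 * (\<beta> * (1 + \<bar>ln \<beta>\<bar>)) * K \<le> 576 * (c * E)" using lnK(1) mult_pos_pos[OF c E] by linarith
    ultimately have 1: "2 * \<beta> * (real k)\<^sup>2 - N \<le> C * M * (16 * E) + 576 * (c * E)" by linarith
    have "2 * (b - \<beta>) * (ln T)\<^sup>2 \<le> 2 * (\<beta>' - \<beta>) * K\<^sup>2"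
      using j lnTK lnT by (intro mult_mono power_mono) auto
    then have 2: "2 * (b - \<beta>) * (ln T)\<^sup>2 \<le> 8 * E" using step by linarith
    have "(ln T)\<^sup>2 \<le> (real k + 1)\<^sup>2" using k lnT by (intro power_mono) auto
    then have "(ln T)\<^sup>2 - (real k)\<^sup>2 \<le> 2 * K" using kK' by (simp add: power2_eq_square algebra_simps)
    then have "2 * \<beta> * ((ln T)\<^sup>2 - (real k)\<^sup>2) \<le> 2 * \<beta> * (2 * K)" using \<beta> by (intro mult_left_mono) auto
    also have "\<dots> \<le> 2 * b * (2 * K)" using j K1 by (intro mult_right_mono) auto
    also have "\<dots> = 4 * (b * K)" by simp
    finally have 3: "2 * \<beta> * ((ln T)\<^sup>2 - (real k)\<^sup>2) \<le> 4 * (c * E)" using bK by linarith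
    have "2 * b * (ln T)\<^sup>2 - N \<le> C * M * (16 * E) + 576 * (c * E) + 8 * E + 4 * (c * E)"
      using 1 2 3 by (simp add: algebra_simps)
    also have "\<dots> = (16 * C * M + (580 * c + 8) * 1) * E" by (simp add: algebra_simps)
    also have "\<dots> \<le> (16 * C * M + (580 * c + 8) * M) * E"
      using M E c by (intro mult_right_mono add_mono mult_left_mono) auto
    finally show ?thesis by (simp add: algebra_simps)
  qed
  \<comment> \<open>Since \<open>K\<close> can be as large as \<open>2 * ln T\<close>, passing to
    \<open>ln T\<close> costs the outer factor 4.\<close>
  have "E \<le> err \<eta> (2 * ln T) b"
    unfolding E_def using b0 K1 K2 \<eta> by (intro err_mono) auto
  also have "\<dots> \<le> 4 * err \<eta> (ln T) b" using b0 lnT by (intro err_double_le) auto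
  finally have "(16 * C + 580 * c + 8) * M * E \<le> (16 * C + 580 * c + 8) * M * (4 * err \<eta> (ln T) b)"
    using C c M by (intro mult_left_mono) auto
  moreover have "\<bar>N - 2 * b * (ln T)\<^sup>2\<bar> \<le> (16 * C + 580 * c + 8) * M * E"
    using up low by (simp add: abs_le_iff)
  ultimately have "\<bar>N - 2 * b * (ln T)\<^sup>2\<bar> \<le> 4 * (16 * C + 580 * c + 8) * M * err \<eta> (ln T) b"
    by (simp add: algebra_simps)
  then show ?thesis using K2 unfolding N_def M_def K_def by blast
qed

section \<open>From \<open>m\<close> to the iterated logarithm, and the two ranges of
  \<open>b\<close>\<close>

lemma square_le_ln_ln_powr:
  assumes \<epsilon>: "0 < \<epsilon>" and T: "3 \<le> T" and m: "2 ^ m \<le> 2 * ln T"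
  defines "A \<equiv> 2 / ln (ln 3) + 2"
  shows "(real m + 1)\<^sup>2 \<le> A powr (6 + \<epsilon>) * (ln (ln T)) powr (6 + \<epsilon>)"
proof -
  define l where "l = ln (ln T)"
  have "exp 1 < (3::real)" using exp_le e_less_272 by simp
  then have "1 < ln (3::real)" using ln_less_cancel_iff[of "exp 1" "3::real"] by simp
  then have l0: "0 < ln (ln (3::real))" by simp
  have "ln 3 \<le> ln T" using T by (subst ln_le_cancel_iff) auto
  then have l1: "ln (ln 3) \<le> l" unfolding l_def using \<open>1 < ln 3\<close> by (subst ln_le_cancel_iff) auto
  have lnT: "0 < ln T" using \<open>ln 3 \<le> ln T\<close> \<open>1 < ln 3\<close> by linarith
  have "ln (2 ^ m) \<le> ln (2 * ln T)" using m lnT by (subst ln_le_cancel_iff) auto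
  then have "real m * ln 2 \<le> ln 2 + l" using lnT by (simp add: l_def ln_mult ln_realpow)
  then have "(real m - 1) * ln 2 \<le> l" by (simp add: left_diff_distrib)
  moreover have "1 / 2 \<le> ln (2::real)" using ln2_ge_two_thirds by simp
  ultimately have "real m - 1 \<le> 2 * l"
  proof (cases "1 \<le> real m")
    case True
    then have "(real m - 1) * (1 / 2) \<le> (real m - 1) * ln 2"
      using \<open>1 / 2 \<le> ln 2\<close> by (intro mult_left_mono) auto
    with \<open>(real m - 1) * ln 2 \<le> l\<close> show ?thesis by simp
  next
    case False
    with l0 l1 show ?thesis by linarith
  qed
  \<comment> \<open>The iterated logarithm is bounded below by its positive value at 3, so additive
    constants become multiples of it.\<close>
  moreover have "2 \<le> 2 / ln (ln 3) * l"
  proof -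
    have "2 / ln (ln 3) * ln (ln 3) \<le> 2 / ln (ln 3) * l" using l0 l1 by (intro mult_left_mono) auto
    thus ?thesis using l0 by simp
  qed
  ultimately have ml: "real m + 1 \<le> A * l" by (simp add: A_def distrib_right)
  have A: "0 \<le> A" using l0 by (simp add: A_def)
  have "(real m + 1)\<^sup>2 = (real m + 1) powr 2" by simp
  \<comment> \<open>The exponent is raised while the base is at least 1; doing so for
    \<open>l\<close> itself could fail, as \<open>l\<close> may be below 1.\<close>
  also have "\<dots> \<le> (real m + 1) powr (6 + \<epsilon>)" using \<epsilon> by (intro powr_mono) auto
  also have "\<dots> \<le> (A * l) powr (6 + \<epsilon>)" using ml \<epsilon> by (intro powr_mono2) auto
  also have "\<dots> = A powr (6 + \<epsilon>) * l powr (6 + \<epsilon>)" using A l0 l1 by (simp add: powr_mult)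
  finally show ?thesis by (simp add: l_def)
qed

text \<open>The second term of \<open>err\<close> is the first times
  \<open>b powr ((3 - \<eta>) / \<eta>) * K\<close>, and this factor passes 1 exactly at the
  threshold for \<open>b\<close>.\<close>

lemma err_le_small:
  assumes \<eta>: "1 < \<eta>" "\<eta> < 2" and K: "1 \<le> K" and b: "0 < b" "b \<le> K powr (- \<eta> / (3 - \<eta>))"
  shows "err \<eta> K b \<le> 2 * (b powr (1 - 1 / \<eta>) * K)"
proof -
  have "b powr ((3 - \<eta>) / \<eta>) \<le> (K powr (- \<eta> / (3 - \<eta>))) powr ((3 - \<eta>) / \<eta>)"
    using b \<eta> by (intro powr_mono2) auto
  also have "\<dots> = K powr (- 1)" using \<eta> by (simp only: powr_powr) simp
  also have "\<dots> = 1 / K" using K by (simp add: powr_minus_divide)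
  finally have "b powr ((3 - \<eta>) / \<eta>) * K \<le> 1" using K by (simp add: pos_le_divide_eq)
  then have "(b powr (1 - 1 / \<eta>) * K) * (b powr ((3 - \<eta>) / \<eta>) * K) \<le> (b powr (1 - 1 / \<eta>) * K) * 1"
    using K by (intro mult_left_mono) auto
  moreover have "b powr (2 / \<eta>) = b powr (1 - 1 / \<eta>) * b powr ((3 - \<eta>) / \<eta>)"
    using \<eta> by (simp add: powr_add[symmetric] field_simps)
  ultimately show ?thesis by (simp add: err_def power2_eq_square mult_ac)
qed

lemma err_le_large:
  assumes \<eta>: "1 < \<eta>" "\<eta> < 2" and K: "1 \<le> K" and b: "K powr (- \<eta> / (3 - \<eta>)) \<le> b"
  shows "err \<eta> K b \<le> 2 * (b powr (2 / \<eta>) * K\<^sup>2)"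
proof -
  have "1 / K = K powr (- 1)" using K by (simp add: powr_minus_divide)
  also have "\<dots> = (K powr (- \<eta> / (3 - \<eta>))) powr ((3 - \<eta>) / \<eta>)" using \<eta> by (simp only: powr_powr) simp
  also have "\<dots> \<le> b powr ((3 - \<eta>) / \<eta>)"
    using b \<eta> by (intro powr_mono2) auto
  finally have "1 \<le> b powr ((3 - \<eta>) / \<eta>) * K" using K by (simp add: pos_divide_le_eq)
  then have "(b powr (1 - 1 / \<eta>) * K) * 1 \<le> (b powr (1 - 1 / \<eta>) * K) * (b powr ((3 - \<eta>) / \<eta>) * K)"
    using K by (intro mult_left_mono) auto
  moreover have "b powr (2 / \<eta>) = b powr (1 - 1 / \<eta>) * b powr ((3 - \<eta>) / \<eta>)"
    using \<eta> by (simp add: powr_add[symmetric] field_simps)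
  ultimately show ?thesis by (simp add: err_def power2_eq_square mult_ac)
qed

theorem theorem1p1:
  fixes \<eta> \<epsilon> :: real
  assumes "1 < \<eta>" and "\<eta> < 2" and "0 < \<epsilon>"
  shows "AE x in (lebesgue :: (real \<times> real) measure).
    \<exists>C>0. \<forall>T\<ge>(3::real). \<forall>b>(0::real).
      ((ln T) powr (-\<eta>) \<le> b \<and> b \<le> (ln T) powr (-\<eta> / (3 - \<eta>)) \<longrightarrow>
        \<bar>real (card {q \<in> L x b. real q \<in> {1..<T}}) - 2 * b * (ln T)\<^sup>2\<bar>
          \<le> C * b powr (1 - 1 / \<eta>) * (ln (ln T)) powr (6 + \<epsilon>) * ln T)
      \<and>
      ((ln T) powr (-\<eta> / (3 - \<eta>)) \<le> b \<longrightarrow>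
        \<bar>real (card {q \<in> L x b. real q \<in> {1..<T}}) - 2 * b * (ln T)\<^sup>2\<bar>
          \<le> C * b powr (2 / \<eta>) * (ln (ln T)) powr (6 + \<epsilon>) * (ln T)\<^sup>2)"
proof -
  note \<eta> = assms(1,2)
  let ?P = "\<lambda>x. \<exists>C>0. \<forall>m j k. k \<le> 2 ^ m \<longrightarrow>
    \<bar>disc (grid \<eta> m j) {1..<ceil_exp k} x\<bar> \<le> C * (real m + 1)\<^sup>2 * err \<eta> (2 ^ m) (grid \<eta> m j)"
  have "AE x in lborel. ?P x" by (intro AE_lborel_unit_squares AE_unit_square_disc_bound \<eta>)
  then have "AE x in lebesgue. ?P x" by (rule AE_completion)
  then show ?thesis
  proof eventually_elim
    case (elim x)
    then obtain C0 where C0: "0 < C0" and bound: "\<And>m j k. k \<le> 2 ^ m \<Longrightarrow>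
       \<bar>disc (grid \<eta> m j) {1..<ceil_exp k} x\<bar> \<le> C0 * (real m + 1)\<^sup>2 * err \<eta> (2 ^ m) (grid \<eta> m j)"
      by blast
    define c where "c = 3 + 1 / (2 / \<eta> - 1)"
    define c1 where "c1 = 4 * (16 * C0 + 580 * c + 8)"
    define A where "A = 2 / ln (ln (3::real)) + 2"
    define C where "C = 2 * (c1 * A powr (6 + \<epsilon>)) + 1"
    have c: "0 < c" using \<eta> by (simp add: c_def pos_less_divide_eq add_pos_pos)
    have c1: "0 < c1" unfolding c1_def using C0 c by simp
    have Cpos: "0 < C" unfolding C_def using c1 by (intro add_nonneg_pos) auto
    \<comment> \<open>\<open>Y\<close> stands for the dominant term of \<open>err\<close> in either
      range; the other term accounts for the factor 2 in \<open>C\<close>.\<close>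
    have main: "\<bar>real (card {q \<in> L x b. real q \<in> {1..<T}}) - 2 * b * (ln T)\<^sup>2\<bar> \<le> C * (ln (ln T)) powr (6 + \<epsilon>) * Y"
      if T: "3 \<le> T" and b: "(ln T) powr (- \<eta>) \<le> b" and Y: "err \<eta> (ln T) b \<le> 2 * Y" "0 \<le> Y" for T b Y
    proof -
      let ?l = "(ln (ln T)) powr (6 + \<epsilon>)"
      obtain m where m: "2 ^ m \<le> 2 * ln T"
        "\<bar>real (card {q \<in> L x b. real q \<in> {1..<T}}) - 2 * b * (ln T)\<^sup>2\<bar> \<le> c1 * (real m + 1)\<^sup>2 * err \<eta> (ln T) b"
        using card_L_approx[OF \<eta> C0 bound T b] unfolding c1_def c_def by blast
      note m(2)
      also have "c1 * (real m + 1)\<^sup>2 * err \<eta> (ln T) b \<le> c1 * (real m + 1)\<^sup>2 * (2 * Y)"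
        using Y c1 by (intro mult_left_mono) auto
      also have "\<dots> \<le> c1 * (A powr (6 + \<epsilon>) * ?l) * (2 * Y)"
        unfolding A_def using Y c1 by (intro mult_right_mono mult_left_mono square_le_ln_ln_powr assms T m) auto
      also have "\<dots> = 2 * (c1 * A powr (6 + \<epsilon>)) * (?l * Y)" by (simp add: mult_ac)
      also have "\<dots> \<le> C * (?l * Y)" unfolding C_def using Y by (intro mult_right_mono) auto
      finally show ?thesis by (simp only: mult.assoc)
    qed
    show ?case
    proof (intro exI[of _ C] conjI allI impI Cpos)
      fix T b :: real assume T: "3 \<le> T" and b0: "0 < b"
      have "exp 1 \<le> T" using exp_le T by simp
      then have lnT: "1 \<le> ln T" using T by (simp add: ln_ge_iff)
      {
        assume b: "(ln T) powr (-\<eta>) \<le> b \<and> b \<le> (ln T) powr (-\<eta> / (3 - \<eta>))"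
        have "err \<eta> (ln T) b \<le> 2 * (b powr (1 - 1 / \<eta>) * ln T)"
          using b by (intro err_le_small \<eta> lnT b0) auto
        from main[OF T _ this] b lnT
        show "\<bar>real (card {q \<in> L x b. real q \<in> {1..<T}}) - 2 * b * (ln T)\<^sup>2\<bar>
          \<le> C * b powr (1 - 1 / \<eta>) * (ln (ln T)) powr (6 + \<epsilon>) * ln T"
          by (simp add: mult_ac)
      next
        assume b: "(ln T) powr (-\<eta> / (3 - \<eta>)) \<le> b"
        \<comment> \<open>Since \<open>3 - \<eta> > 1\<close> and \<open>ln T \<ge> 1\<close>, the
          range of part (ii) lies above the lowest level that the grid covers.\<close>
        have "\<eta> / (3 - \<eta>) \<le> \<eta> / 1" using \<eta> by (intro divide_left_mono) auto
        then have "(ln T) powr (-\<eta>) \<le> (ln T) powr (-\<eta> / (3 - \<eta>))"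
          using lnT by (intro powr_mono) auto
        then have b': "(ln T) powr (-\<eta>) \<le> b" using b by linarith
        have "err \<eta> (ln T) b \<le> 2 * (b powr (2 / \<eta>) * (ln T)\<^sup>2)"
          by (intro err_le_large \<eta> lnT b)
        from main[OF T b' this]
        show "\<bar>real (card {q \<in> L x b. real q \<in> {1..<T}}) - 2 * b * (ln T)\<^sup>2\<bar>
          \<le> C * b powr (2 / \<eta>) * (ln (ln T)) powr (6 + \<epsilon>) * (ln T)\<^sup>2"
          by (simp add: mult_ac)
      }
    qed
  qed
qed

end
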